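(* Let $\boldsymbol{a}_0=(a_{0,\nu})_{\nu=1}^N\in\mathbb{R}^N$, let $\boldsymbol{a}=((a_{i,\nu})_{i=1}^{m_\nu})_{\nu=1}^N$ with all $a_{i,\nu}\in(0,\infty)$, let $M$ be a measure on $(0,\infty)$, and let $\tilde{\boldsymbol{\gamma}}=(\tilde\gamma_\nu)_{\nu=1}^N\colon(0,\infty)\to(0,\infty)^N$. Consider the priors $$\pi_{\boldsymbol{a}_0,\boldsymbol{a}}(\boldsymbol{p})\propto\prod_{\nu=1}^N\Big(p_{0,\nu}^{a_{0,\nu}-1}\prod_{i=1}^{m_\nu}p_{i,\nu}^{a_{i,\nu}-1}\Big),\qquad \pi_{M,\tilde{\boldsymbol{\gamma}},\boldsymbol{a}_0,\boldsymbol{a}}(\boldsymbol{p})=\int_0^\infty\Big[\prod_{\nu=1}^N\Big\{p_{0,\nu}^{\tilde\gamma_\nu(u)+a_{0,\nu}-1}\prod_{i=1}^{m_\nu}p_{i,\nu}^{a_{i,\nu}-1}\Big\}\Big]dM(u).$$ Then, for every $\boldsymbol{p}\in D$, the risk difference between $\hat g^{(\pi_{M,\tilde{\boldsymbol{\gamma}},\boldsymbol{a}_0,\boldsymbol{a}})}(\cdot;\boldsymbol{X})$ and $\hat g^{(\pi_{\boldsymbol{a}_0,\boldsymbol{a}})}(\cdot;\boldsymbol{X})$ is expressed as $$R(\boldsymbol{p},\hat g^{(\pi_{M,\tilde{\boldsymbol{\gamma}},\boldsymbol{a}_0,\boldsymbol{a}})})-R(\boldsymbol{p},\hat g^{(\pi_{\boldsymbol{a}_0,\boldsymbol{a}})})$$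 $$=\int_0^1\Big\{\sum_{\nu=1}^nt_\nu'(\tau)\sum_{k=1}^\infty\frac1kE\big[L^{\rm KL}(E_{\pi_{M,\tilde{\boldsymbol{\gamma}},\boldsymbol{a}_0,\boldsymbol{a}}}[p_{\cdot,\nu}^k|\boldsymbol{Z}(\tau)],p_{\cdot,\nu}^k)-L^{\rm KL}(E_{\pi_{\boldsymbol{a}_0,\boldsymbol{a}}}[p_{\cdot,\nu}^k|\boldsymbol{Z}(\tau)],p_{\cdot,\nu}^k)\big]\Big\}d\tau,$$ where $p_{\cdot,\nu}=\sum_{i=1}^{m_\nu}p_{i,\nu}$.
   Context: Notation: $\mathbb{N}=\{1,2,\dots\}$, $\mathbb{N}_0=\{0,1,2,\dots\}$. Let $N\in\mathbb{N}$, $n\in\{1,\dots,N\}$, $m_1,\dots,m_N\in\mathbb{N}$, $r_1,\dots,r_N>0$, $s_1,\dots,s_n>0$. For $\nu=1,\dots,N$, $\boldsymbol{p}_\nu=(p_{i,\nu})_{i=1}^{m_\nu}\in D_{m_\nu}=\{(q_1,\dots,q_{m_\nu}) : q_i>0\ \forall i,\ \sum_iq_i<1\}$ and $p_{0,\nu}=1-\sum_{i=1}^{m_\nu}p_{i,\nu}$; $\boldsymbol{p}=(\boldsymbol{p}_\nu)_{\nu=1}^N\in D=D_{m_1}\times\dots\times D_{m_N}$. For $r>0$, the negative multinomial distribution with parameters $(r,\boldsymbol{p}_\nu)$ has mass function $$\frac{\Gamma(r+\sum_{i=1}^{m_\nu}x_i)}{\Gamma(r)\prod_{i=1}^{m_\nu}x_i!}\,p_{0,\nu}^{r}\prod_{i=1}^{m_\nu}p_{i,\nu}^{x_i},\qquad(x_i)_{i=1}^{m_\nu}\in\mathbb{N}_0^{m_\nu}.$$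 $\boldsymbol{X}=(\boldsymbol{X}_\nu)_{\nu=1}^N$ is observed, with $\boldsymbol{X}_\nu$ independent negative multinomial with parameters $(r_\nu,\boldsymbol{p}_\nu)$. $\boldsymbol{Y}=(\boldsymbol{Y}_\nu)_{\nu=1}^n$ is to be predicted, with $\boldsymbol{Y}_\nu$ independent negative multinomial with parameters $(s_\nu,\boldsymbol{p}_\nu)$, independent of $\boldsymbol{X}$; $g(\boldsymbol{y}|\boldsymbol{p})$ denotes the joint mass function of $\boldsymbol{Y}$. For a (possibly improper) prior density $\pi$ on $D$, the Bayesian predictive mass is the posterior expectation $\hat g^{(\pi)}(\boldsymbol{y};\boldsymbol{X})=E_\pi[g(\boldsymbol{y}|\boldsymbol{p})|\boldsymbol{X}]$, and its risk is $R(\boldsymbol{p},\hat g^{(\pi)})=E[\log\{g(\boldsymbol{Y}|\boldsymbol{p})/\hat g^{(\pi)}(\boldsymbol{Y};\boldsymbol{X})\}]$, the expectation being taken over $(\boldsymbol{X},\boldsymbol{Y})$ given $\boldsymbol{p}$. It is understood that $\tilde{\boldsymbol{\gamma}}$ is measurable and that for both priors the posterior is well defined, i.e. $0<\int_D\pi(\boldsymbol{p})\prod_{\nu=1}^N(p_{0,\nu}^{r_\nu}\prod_ip_{i,\nu}^{x_{i,\nu}})\,d\boldsymbol{p}<\infty$ for all $\boldsymbol{x}\in\mathbb{N}_0^{m_1}\times\dots\times\mathbb{N}_0^{m_N}$ (for $\pi_{\boldsymbol{a}_0,\boldsymbol{a}}$ this means $r_\nu+a_{0,\nu}>0$ for all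 $\nu$). $t_1,\dots,t_N\colon[0,1]\to(0,\infty)$ are smooth nondecreasing functions with $t_\nu(0)=r_\nu$ for all $\nu$, $t_\nu(1)=r_\nu+s_\nu$ if $\nu\le n$, and $t_\nu(1)=r_\nu$ if $\nu\ge n+1$. For each $\tau\in[0,1]$, $\boldsymbol{Z}(\tau)=(\boldsymbol{Z}_\nu(\tau))_{\nu=1}^N$, where $\boldsymbol{Z}_\nu(\tau)$, $\nu=1,\dots,N$, are independent negative multinomial with parameters $(t_\nu(\tau),\boldsymbol{p}_\nu)$. $E_\pi[\,\cdot\,|\boldsymbol{Z}(\tau)]$ denotes posterior expectation of a function of the parameter under prior $\pi$ given the observation $\boldsymbol{Z}(\tau)$; the outer $E$ is over $\boldsymbol{Z}(\tau)$ given the true $\boldsymbol{p}$. $L^{\rm KL}(\tilde d,\theta)=\tilde d-\theta-\theta\log(\tilde d/\theta)$ for $\tilde d,\theta\in(0,\infty)$. *)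

theory Defs
  imports "HOL-Probability.Probability"
begin

text \<open>
  A parameter is a function \<^term>\<open>p\<close> with \<open>p \<nu> i\<close> standing for \<open>p\<^bsub>i,\<nu>\<^esub>\<close>, where \<open>\<nu>\<close> ranges over
  \<open>{1..N}\<close> and \<open>i\<close> over \<open>{1..m \<nu>}\<close>; observations \<open>x \<nu> i\<close> are indexed in the same way.
\<close>

definition open_simplex :: "nat \<Rightarrow> (nat \<Rightarrow> real) set" where
  "open_simplex m =
     {q \<in> {1..m} \<rightarrow>\<^sub>E UNIV. (\<forall>i\<in>{1..m}. 0 < q i) \<and> (\<Sum>i\<in>{1..m}. q i) < 1}"

definition param_space :: "nat \<Rightarrow> (nat \<Rightarrow> nat) \<Rightarrow> (nat \<Rightarrow> nat \<Rightarrow> real) set" where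
  "param_space N m = (\<Pi>\<^sub>E \<nu>\<in>{1..N}. open_simplex (m \<nu>))"

definition lebesgue_param :: "nat \<Rightarrow> (nat \<Rightarrow> nat) \<Rightarrow> (nat \<Rightarrow> nat \<Rightarrow> real) measure" where
  "lebesgue_param N m =
     restrict_space (\<Pi>\<^sub>M \<nu>\<in>{1..N}. \<Pi>\<^sub>M i\<in>{1..m \<nu>}. lborel) (param_space N m)"

definition psum :: "nat \<Rightarrow> (nat \<Rightarrow> real) \<Rightarrow> real" where
  "psum m q = (\<Sum>i\<in>{1..m}. q i)"

definition nm_mass :: "nat \<Rightarrow> real \<Rightarrow> (nat \<Rightarrow> real) \<Rightarrow> (nat \<Rightarrow> nat) \<Rightarrow> real" where
  "nm_mass m r q x =
     Gamma (r + real (\<Sum>i\<in>{1..m}. x i)) / (Gamma r * (\<Prod>i\<in>{1..m}. fact (x i)))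
       * (1 - psum m q) powr r * (\<Prod>i\<in>{1..m}. q i ^ x i)"

text \<open>
  Points of \<open>\<nat>\<^sub>0\<^sup>m\<close> are represented by the functions that vanish off \<open>{1..m}\<close>. That the argument of
  \<^const>\<open>embed_pmf\<close> is a probability mass function is shown in \<open>pmf_neg_multinomial\<close> below.
\<close>

definition neg_multinomial_pmf :: "nat \<Rightarrow> real \<Rightarrow> (nat \<Rightarrow> real) \<Rightarrow> (nat \<Rightarrow> nat) pmf" where
  "neg_multinomial_pmf m r q =
     embed_pmf (\<lambda>x. if \<forall>i. i \<notin> {1..m} \<longrightarrow> x i = 0 then nm_mass m r q x else 0)"

definition nm_product_pmf ::
  "nat \<Rightarrow> (nat \<Rightarrow> nat) \<Rightarrow> (nat \<Rightarrow> real) \<Rightarrow> (nat \<Rightarrow> nat \<Rightarrow> real) \<Rightarrow> (nat \<Rightarrow> nat \<Rightarrow> nat) pmf" where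
  "nm_product_pmf N m r p =
     Pi_pmf {1..N} (\<lambda>_. 0) (\<lambda>\<nu>. neg_multinomial_pmf (m \<nu>) (r \<nu>) (p \<nu>))"

definition joint_mass ::
  "nat \<Rightarrow> (nat \<Rightarrow> nat) \<Rightarrow> (nat \<Rightarrow> real) \<Rightarrow> (nat \<Rightarrow> nat \<Rightarrow> real) \<Rightarrow> (nat \<Rightarrow> nat \<Rightarrow> nat) \<Rightarrow> real" where
  "joint_mass N m r p x = (\<Prod>\<nu>\<in>{1..N}. nm_mass (m \<nu>) (r \<nu>) (p \<nu>) (x \<nu>))"

text \<open>
  Prior densities are taken with values in \<^typ>\<open>ennreal\<close>, since a mixture over an infinite measure
  may be infinite at some parameters.
\<close>

definition posterior_well_defined ::
  "nat \<Rightarrow> (nat \<Rightarrow> nat) \<Rightarrow> (nat \<Rightarrow> real) \<Rightarrow> ((nat \<Rightarrow> nat \<Rightarrow> real) \<Rightarrow> ennreal) \<Rightarrow> bool" where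
  "posterior_well_defined N m r \<pi> \<longleftrightarrow>
     (\<forall>x :: nat \<Rightarrow> nat \<Rightarrow> nat.
        let I = (\<integral>\<^sup>+ q. \<pi> q * ennreal (\<Prod>\<nu>\<in>{1..N}. (1 - psum (m \<nu>) (q \<nu>)) powr r \<nu>
                                          * (\<Prod>i\<in>{1..m \<nu>}. q \<nu> i ^ x \<nu> i)) \<partial>lebesgue_param N m)
        in 0 < I \<and> I < \<infinity>)"

definition posterior ::
  "nat \<Rightarrow> (nat \<Rightarrow> nat) \<Rightarrow> (nat \<Rightarrow> real) \<Rightarrow> ((nat \<Rightarrow> nat \<Rightarrow> real) \<Rightarrow> ennreal)
     \<Rightarrow> (nat \<Rightarrow> nat \<Rightarrow> nat) \<Rightarrow> (nat \<Rightarrow> nat \<Rightarrow> real) measure" where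
  "posterior N m r \<pi> x =
     density (lebesgue_param N m)
       (\<lambda>q. \<pi> q * ennreal (joint_mass N m r q x)
              / (\<integral>\<^sup>+ q'. \<pi> q' * ennreal (joint_mass N m r q' x) \<partial>lebesgue_param N m))"

definition bayes_predictive ::
  "nat \<Rightarrow> nat \<Rightarrow> (nat \<Rightarrow> nat) \<Rightarrow> (nat \<Rightarrow> real) \<Rightarrow> (nat \<Rightarrow> real) \<Rightarrow> ((nat \<Rightarrow> nat \<Rightarrow> real) \<Rightarrow> ennreal)
     \<Rightarrow> (nat \<Rightarrow> nat \<Rightarrow> nat) \<Rightarrow> (nat \<Rightarrow> nat \<Rightarrow> nat) \<Rightarrow> real" where
  "bayes_predictive N n m r s \<pi> y x = (LINT q|posterior N m r \<pi> x. joint_mass n m s q y)"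

definition log_ratio ::
  "nat \<Rightarrow> (nat \<Rightarrow> nat) \<Rightarrow> (nat \<Rightarrow> real) \<Rightarrow> (nat \<Rightarrow> nat \<Rightarrow> real)
     \<Rightarrow> ((nat \<Rightarrow> nat \<Rightarrow> nat) \<Rightarrow> (nat \<Rightarrow> nat \<Rightarrow> nat) \<Rightarrow> real)
     \<Rightarrow> (nat \<Rightarrow> nat \<Rightarrow> nat) \<times> (nat \<Rightarrow> nat \<Rightarrow> nat) \<Rightarrow> real" where
  "log_ratio n m s p ghat = (\<lambda>(x, y). ln (joint_mass n m s p y / ghat y x))"

definition obs_pmf ::
  "nat \<Rightarrow> nat \<Rightarrow> (nat \<Rightarrow> nat) \<Rightarrow> (nat \<Rightarrow> real) \<Rightarrow> (nat \<Rightarrow> real) \<Rightarrow> (nat \<Rightarrow> nat \<Rightarrow> real)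
     \<Rightarrow> ((nat \<Rightarrow> nat \<Rightarrow> nat) \<times> (nat \<Rightarrow> nat \<Rightarrow> nat)) pmf" where
  "obs_pmf N n m r s p = pair_pmf (nm_product_pmf N m r p) (nm_product_pmf n m s p)"

definition risk ::
  "nat \<Rightarrow> nat \<Rightarrow> (nat \<Rightarrow> nat) \<Rightarrow> (nat \<Rightarrow> real) \<Rightarrow> (nat \<Rightarrow> real) \<Rightarrow> (nat \<Rightarrow> nat \<Rightarrow> real)
     \<Rightarrow> ((nat \<Rightarrow> nat \<Rightarrow> nat) \<Rightarrow> (nat \<Rightarrow> nat \<Rightarrow> nat) \<Rightarrow> real) \<Rightarrow> real" where
  "risk N n m r s p ghat =
     measure_pmf.expectation (obs_pmf N n m r s p) (log_ratio n m s p ghat)"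

text \<open>
  The prior \<open>\<pi>\<^bsub>a\<^sub>0,a\<^esub>\<close> is determined up to a positive factor, which cancels in the posterior; the
  factor is taken to be 1.
\<close>

definition dirichlet_prior ::
  "nat \<Rightarrow> (nat \<Rightarrow> nat) \<Rightarrow> (nat \<Rightarrow> real) \<Rightarrow> (nat \<Rightarrow> nat \<Rightarrow> real)
     \<Rightarrow> (nat \<Rightarrow> nat \<Rightarrow> real) \<Rightarrow> ennreal" where
  "dirichlet_prior N m a0 a p =
     ennreal (\<Prod>\<nu>\<in>{1..N}. (1 - psum (m \<nu>) (p \<nu>)) powr (a0 \<nu> - 1)
                            * (\<Prod>i\<in>{1..m \<nu>}. p \<nu> i powr (a \<nu> i - 1)))"

definition mixture_prior ::
  "nat \<Rightarrow> (nat \<Rightarrow> nat) \<Rightarrow> real measure \<Rightarrow> (nat \<Rightarrow> real \<Rightarrow> real) \<Rightarrow> (nat \<Rightarrow> real)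
     \<Rightarrow> (nat \<Rightarrow> nat \<Rightarrow> real) \<Rightarrow> (nat \<Rightarrow> nat \<Rightarrow> real) \<Rightarrow> ennreal" where
  "mixture_prior N m M \<gamma> a0 a p =
     (\<integral>\<^sup>+ u. dirichlet_prior N m (\<lambda>\<nu>. \<gamma> \<nu> u + a0 \<nu>) a p \<partial>M)"

definition smooth_on_01 :: "(real \<Rightarrow> real) \<Rightarrow> bool" where
  "smooth_on_01 f \<longleftrightarrow>
     (\<exists>d :: nat \<Rightarrow> real \<Rightarrow> real. d 0 = f \<and>
        (\<forall>k. \<forall>\<tau>\<in>{0..1}. (d k has_real_derivative d (Suc k) \<tau>) (at \<tau> within {0..1})))"

definition KL_loss :: "real \<Rightarrow> real \<Rightarrow> real" where
  "KL_loss d \<theta> = d - \<theta> - \<theta> * ln (d / \<theta>)"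

definition post_moment ::
  "nat \<Rightarrow> (nat \<Rightarrow> nat) \<Rightarrow> (nat \<Rightarrow> real) \<Rightarrow> ((nat \<Rightarrow> nat \<Rightarrow> real) \<Rightarrow> ennreal)
     \<Rightarrow> nat \<Rightarrow> nat \<Rightarrow> (nat \<Rightarrow> nat \<Rightarrow> nat) \<Rightarrow> real" where
  "post_moment N m t \<pi> \<nu> k z = (LINT q|posterior N m t \<pi> z. psum (m \<nu>) (q \<nu>) ^ k)"

definition KL_loss_diff ::
  "nat \<Rightarrow> (nat \<Rightarrow> nat) \<Rightarrow> (nat \<Rightarrow> real) \<Rightarrow> ((nat \<Rightarrow> nat \<Rightarrow> real) \<Rightarrow> ennreal)
     \<Rightarrow> ((nat \<Rightarrow> nat \<Rightarrow> real) \<Rightarrow> ennreal) \<Rightarrow> (nat \<Rightarrow> nat \<Rightarrow> real)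
     \<Rightarrow> nat \<Rightarrow> nat \<Rightarrow> (nat \<Rightarrow> nat \<Rightarrow> nat) \<Rightarrow> real" where
  "KL_loss_diff N m t \<pi>\<^sub>1 \<pi>\<^sub>2 p \<nu> k z =
     KL_loss (post_moment N m t \<pi>\<^sub>1 \<nu> k z) (psum (m \<nu>) (p \<nu>) ^ k)
       - KL_loss (post_moment N m t \<pi>\<^sub>2 \<nu> k z) (psum (m \<nu>) (p \<nu>) ^ k)"


lemma neg_binomial_series:
  fixes \<rho> b :: real
  assumes "0 < \<rho>" "0 \<le> b" "b < 1"
  shows "(\<lambda>k. Gamma (\<rho> + real k) / (Gamma \<rho> * fact k) * (1 - b) powr \<rho> * b ^ k) sums 1"
proof -
  have "(\<lambda>k. ((-\<rho>) gchoose k) * (-b) ^ k) sums (1 + (-b)) powr (-\<rho>)"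
    using assms by (intro gen_binomial_real) auto
  also have "(\<lambda>k. ((-\<rho>) gchoose k) * (-b) ^ k) = (\<lambda>k. Gamma (\<rho> + real k) / (Gamma \<rho> * fact k) * b ^ k)"
  proof
    fix k
    have "\<rho> \<notin> \<int>\<^sub>\<le>\<^sub>0" using assms(1) by (auto elim!: nonpos_Ints_cases)
    then have "pochhammer \<rho> k = Gamma (\<rho> + real k) / Gamma \<rho>"
      using pochhammer_Gamma[of \<rho> k] by simp
    then show "((-\<rho>) gchoose k) * (-b) ^ k = Gamma (\<rho> + real k) / (Gamma \<rho> * fact k) * b ^ k"
      by (simp add: gbinomial_pochhammer power_minus[of b] mult_ac)
  qed
  finally have "(\<lambda>k. Gamma (\<rho> + real k) / (Gamma \<rho> * fact k) * b ^ k) sums (1 - b) powr (-\<rho>)"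
    by simp
  from sums_mult2[OF this, of "(1 - b) powr \<rho>"] show ?thesis
    using assms by (simp add: mult_ac powr_minus)
qed

lemma nm_mass_nonneg:
  assumes "0 < r" "\<And>i. i \<in> {1..m} \<Longrightarrow> 0 \<le> q i"
  shows "0 \<le> nm_mass m r q x"
proof -
  have "0 < Gamma (r + real (\<Sum>i\<in>{1..m}. x i))" "0 < Gamma r"
    using assms(1) by (auto intro!: Gamma_real_pos add_pos_nonneg simp del: of_nat_sum)
  then show ?thesis
    unfolding nm_mass_def using assms(2)
    by (intro mult_nonneg_nonneg divide_nonneg_nonneg prod_nonneg) auto
qed

lemma nm_mass_Suc:
  fixes q :: "nat \<Rightarrow> real"
  assumes "0 < r" "\<And>i. i \<in> {1..Suc m} \<Longrightarrow> 0 \<le> q i" "psum (Suc m) q < 1"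
  defines "b \<equiv> q (Suc m)"
  shows "nm_mass (Suc m) r q (x(Suc m := k)) =
           nm_mass m r (\<lambda>i. q i / (1 - b)) x *
           (Gamma ((r + real (\<Sum>i\<in>{1..m}. x i)) + real k)
              / (Gamma (r + real (\<Sum>i\<in>{1..m}. x i)) * fact k)
              * (1 - b) powr (r + real (\<Sum>i\<in>{1..m}. x i)) * b ^ k)"
proof -
  define S where "S = (\<Sum>i\<in>{1..m}. x i)"
  define Q where "Q = (\<Sum>i\<in>{1..m}. q i)"
  have Q0: "0 \<le> Q" unfolding Q_def using assms(2) by (auto intro!: sum_nonneg)
  have Qb: "Q + b < 1" using assms(3) by (simp add: psum_def Q_def b_def)
  have b1: "0 < 1 - b" using Q0 Qb by simp
  have "0 < Gamma (r + real S)"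
    using assms(1) by (auto intro!: Gamma_real_pos add_pos_nonneg)
  then have G: "Gamma (r + real S) \<noteq> 0" by simp
  have set: "{1..Suc m} = insert (Suc m) {1..m}" by auto
  have e1: "(\<Sum>i\<in>{1..Suc m}. (x(Suc m := k)) i) = S + k"
    by (simp add: set S_def)
  have e2: "(\<Prod>i\<in>{1..Suc m}. fact ((x(Suc m := k)) i) :: real) = fact k * (\<Prod>i\<in>{1..m}. fact (x i))"
    by (simp add: set)
  have e3: "(\<Prod>i\<in>{1..Suc m}. q i ^ (x(Suc m := k)) i) = b ^ k * (\<Prod>i\<in>{1..m}. q i ^ x i)"
    by (simp add: set b_def)
  have e4: "psum (Suc m) q = Q + b" by (simp add: psum_def Q_def b_def)
  have e5: "psum m (\<lambda>i. q i / (1 - b)) = Q / (1 - b)"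
    by (simp add: psum_def Q_def sum_divide_distrib)
  have e6: "1 - Q / (1 - b) = (1 - (Q + b)) / (1 - b)" using b1 by (simp add: field_simps)
  have e7: "((1 - (Q + b)) / (1 - b)) powr r * (1 - b) powr (r + real S)
              = (1 - (Q + b)) powr r * (1 - b) ^ S"
    using b1 Qb by (simp add: powr_divide powr_add powr_realpow)
  have e8: "(\<Prod>i\<in>{1..m}. (q i / (1 - b)) ^ x i) = (\<Prod>i\<in>{1..m}. q i ^ x i) / (1 - b) ^ S"
    by (simp add: power_divide prod_dividef power_sum S_def)
  have pow: "(1 - b) ^ S \<noteq> 0" using b1 by simp
  have "nm_mass m r (\<lambda>i. q i / (1 - b)) x *
           (Gamma ((r + real S) + real k) / (Gamma (r + real S) * fact k)
              * (1 - b) powr (r + real S) * b ^ k)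
        = Gamma (r + real S) / (Gamma r * (\<Prod>i\<in>{1..m}. fact (x i)))
            * (((1 - (Q + b)) / (1 - b)) powr r * (1 - b) powr (r + real S))
            * ((\<Prod>i\<in>{1..m}. q i ^ x i) / (1 - b) ^ S)
            * (Gamma ((r + real S) + real k) / (Gamma (r + real S) * fact k)) * b ^ k"
    unfolding nm_mass_def e5 e6 e8 S_def[symmetric] by (simp only: mult_ac)
  also have "\<dots> = nm_mass (Suc m) r q (x(Suc m := k))"
    unfolding e7 nm_mass_def e1 e2 e3 e4 using G pow by (simp add: field_simps)
  finally show ?thesis unfolding S_def by simp
qed

lemma nm_mass_nn_integral:
  assumes "0 < r" "\<And>i. i \<in> {1..m} \<Longrightarrow> 0 \<le> q i" "psum m q < 1"
  shows "(\<integral>\<^sup>+ x. ennreal (nm_mass m r q x) \<partial>count_space {x. \<forall>i. i \<notin> {1..m} \<longrightarrow> x i = 0}) = 1"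
  using assms(2,3)
proof (induction m arbitrary: q)
  case 0
  have "{x :: nat \<Rightarrow> nat. \<forall>i. i \<notin> {1..0} \<longrightarrow> x i = 0} = {\<lambda>_. 0}" by auto
  moreover have "Gamma r \<noteq> 0" using Gamma_real_pos[OF assms(1)] by simp
  ultimately show ?case by (simp add: nn_integral_count_space_finite nm_mass_def psum_def)
next
  case (Suc m)
  define F where "F = (\<lambda>m. {x :: nat \<Rightarrow> nat. \<forall>i. i \<notin> {1..m} \<longrightarrow> x i = 0})"
  define b where "b = q (Suc m)"
  have Q0: "0 \<le> (\<Sum>i\<in>{1..m}. q i)" using Suc.prems(1) by (auto intro!: sum_nonneg)
  have b: "0 \<le> b" "b < 1" using Suc.prems Q0 by (auto simp: b_def psum_def)
  have bij: "bij_betw (\<lambda>(x, k). x(Suc m := k)) (F m \<times> UNIV) (F (Suc m))"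
    by (rule bij_betw_byWitness[where f' = "\<lambda>x. (x(Suc m := 0), x (Suc m))"])
       (auto simp: F_def fun_eq_iff)
  let ?w = "\<lambda>x k. Gamma ((r + real (\<Sum>i\<in>{1..m}. x i)) + real k)
              / (Gamma (r + real (\<Sum>i\<in>{1..m}. x i)) * fact k)
              * (1 - b) powr (r + real (\<Sum>i\<in>{1..m}. x i)) * b ^ k"
  let ?q = "\<lambda>i. q i / (1 - b)"
  have w: "(\<integral>\<^sup>+ k. ennreal (?w x k) \<partial>count_space UNIV) = 1" for x
  proof -
    have pos: "0 < r + real (\<Sum>i\<in>{1..m}. x i)"
      using assms(1) by (simp add: add_pos_nonneg del: of_nat_sum)
    have nn: "0 \<le> ?w x k" for k
      using b Gamma_real_pos[OF pos] Gamma_real_pos[OF add_pos_nonneg[OF pos of_nat_0_le_iff[of k]]]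
      by (intro mult_nonneg_nonneg divide_nonneg_nonneg) auto
    have "(\<Sum>k. ennreal (?w x k)) = ennreal 1"
      using nn neg_binomial_series[OF pos b] by (rule suminf_ennreal_eq)
    then show ?thesis by (simp add: nn_integral_count_space_nat)
  qed
  have q1: "psum m ?q < 1"
    using Suc.prems(2) b by (simp add: psum_def b_def field_simps flip: sum_divide_distrib)
  have q0: "\<And>i. i \<in> {1..m} \<Longrightarrow> 0 \<le> ?q i" using Suc.prems(1) b by auto
  have nmS: "ennreal (nm_mass (Suc m) r q (x(Suc m := k)))
               = ennreal (nm_mass m r ?q x) * ennreal (?w x k)" for x k
  proof -
    have "nm_mass (Suc m) r q (x(Suc m := k)) = nm_mass m r ?q x * ?w x k"
      unfolding b_def by (rule nm_mass_Suc) (use assms(1) Suc.prems in auto)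
    moreover have "0 \<le> nm_mass m r ?q x"
      by (rule nm_mass_nonneg) (use assms(1) q0 in auto)
    ultimately show ?thesis by (simp only: ennreal_mult')
  qed
  have "(\<integral>\<^sup>+ x. ennreal (nm_mass (Suc m) r q x) \<partial>count_space (F (Suc m)))
      = (\<integral>\<^sup>+ z. ennreal (nm_mass (Suc m) r q ((\<lambda>(x, k). x(Suc m := k)) z)) \<partial>count_space (F m \<times> UNIV))"
    by (rule nn_integral_bij_count_space[OF bij, symmetric])
  also have "\<dots> = (\<integral>\<^sup>+ z. ennreal (nm_mass (Suc m) r q ((fst z)(Suc m := snd z)))
                       * indicator (F m \<times> UNIV) z \<partial>count_space UNIV)"
    by (simp add: nn_integral_count_space_indicator case_prod_beta)
  also have "\<dots> = (\<integral>\<^sup>+ x. \<integral>\<^sup>+ k. ennreal (nm_mass (Suc m) r q (x(Suc m := k)))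
                       * indicator (F m) x \<partial>count_space UNIV \<partial>count_space UNIV)"
    by (subst nn_integral_fst_count_space[symmetric])
       (auto intro!: nn_integral_cong simp: indicator_def)
  also have "\<dots> = (\<integral>\<^sup>+ x. \<integral>\<^sup>+ k. (ennreal (nm_mass m r ?q x) * indicator (F m) x) * ennreal (?w x k)
                       \<partial>count_space UNIV \<partial>count_space UNIV)"
    by (simp only: nmS mult_ac)
  also have "\<dots> = (\<integral>\<^sup>+ x. ennreal (nm_mass m r ?q x) * indicator (F m) x \<partial>count_space UNIV)"
    by (simp only: nn_integral_cmult[OF borel_measurable_count_space] w mult_1_right)
  also have "\<dots> = (\<integral>\<^sup>+ x. ennreal (nm_mass m r ?q x) \<partial>count_space (F m))"
    by (simp add: nn_integral_count_space_indicator)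
  also have "\<dots> = 1" unfolding F_def by (rule Suc.IH[OF q0 q1])
  finally show ?case unfolding F_def .
qed

lemma pmf_neg_multinomial:
  assumes "0 < r" "q \<in> open_simplex m"
  shows "pmf (neg_multinomial_pmf m r q) x =
           (if \<forall>i. i \<notin> {1..m} \<longrightarrow> x i = 0 then nm_mass m r q x else 0)"
  unfolding neg_multinomial_pmf_def
proof (rule pmf_embed_pmf)
  have q: "\<And>i. i \<in> {1..m} \<Longrightarrow> 0 \<le> q i" "psum m q < 1"
    using assms(2) by (auto simp: open_simplex_def psum_def intro: less_imp_le)
  show "0 \<le> (if \<forall>i. i \<notin> {1..m} \<longrightarrow> x i = 0 then nm_mass m r q x else 0)" for x
    using nm_mass_nonneg[OF assms(1) q(1)] by simp
  let ?F = "{x :: nat \<Rightarrow> nat. \<forall>i. i \<notin> {1..m} \<longrightarrow> x i = 0}"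
  have "(\<integral>\<^sup>+ x. ennreal (if \<forall>i. i \<notin> {1..m} \<longrightarrow> x i = 0 then nm_mass m r q x else 0) \<partial>count_space UNIV)
      = (\<integral>\<^sup>+ x. ennreal (nm_mass m r q x) * indicator ?F x \<partial>count_space UNIV)"
    by (intro nn_integral_cong) (auto simp: indicator_def)
  also have "\<dots> = (\<integral>\<^sup>+ x. ennreal (nm_mass m r q x) \<partial>count_space ?F)"
    by (simp add: nn_integral_count_space_indicator)
  finally show "(\<integral>\<^sup>+ x. ennreal (if \<forall>i. i \<notin> {1..m} \<longrightarrow> x i = 0 then nm_mass m r q x else 0)
                  \<partial>count_space UNIV) = 1"
    using nm_mass_nn_integral[OF assms(1) q] by simp
qed

end

theory Submission
  imports Defs
begin

text \<open>
  The prior enters the problem only through the masses of its kernels,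
  \<open>W(t, z) = \<integral> \<pi>(q) \<Prod>\<^sub>\<nu> (q\<^sub>0\<^sub>,\<^sub>\<nu> ^ t\<^sub>\<nu> \<Prod>\<^sub>i q\<^sub>i\<^sub>,\<^sub>\<nu> ^ z\<^sub>i\<^sub>,\<^sub>\<nu>) dq\<close>.
  Kernels multiply, so the predictive mass is a combinatorial factor times
  \<open>W(t(1), X + Y) / W(t(0), X)\<close>, and \<open>X + Y\<close> is negative multinomial with the parameters \<open>t(1)\<close>.
  Up to a term that does not depend on the prior, the risk is therefore minus the increment over
  \<open>[0, 1]\<close> of \<open>\<Phi>(\<tau>) = E ln W(t(\<tau>), Z(\<tau>))\<close>, and the identity is the fundamental theorem of calculus
  for \<open>\<Phi>\<close>.

  Both priors are of the form \<open>\<Prod> q\<^sub>i\<^sub>,\<^sub>\<nu> ^ (a\<^sub>i\<^sub>,\<^sub>\<nu> - 1)\<close> times a function of the sums \<open>v\<^sub>\<nu> = \<Sum>\<^sub>i q\<^sub>i\<^sub>,\<^sub>\<nu>\<close>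
  (the first one is the mixture with mixing measure a point mass and with zero shift). By
  Liouville's formula (\<open>Liouville_Dirichlet\<close>, \<open>prior_integral\<close>) such a prior satisfies
  \<open>W(t, z) = C(z) J(t, \<zeta>)\<close>, where \<open>\<zeta>\<close> collects the totals of \<open>z\<close>, \<open>J(t, \<zeta>)\<close> is the prior integral
  of \<open>\<Prod> (1 - v\<^sub>\<nu>) ^ t\<^sub>\<nu> v\<^sub>\<nu> ^ \<zeta>\<^sub>\<nu>\<close>, and \<open>C\<close> is the same for both priors. Hence \<open>C\<close> cancels from
  the risk difference, only the totals matter, which are independent negative binomial variables
  (\<open>map_totals_nm_product_pmf\<close>, \<open>map_totals_obs_pmf\<close>), and the posterior moments of \<open>v\<^sub>\<nu>\<close> are the
  quotients \<open>m\<^sub>k(\<zeta>) = J(t, \<zeta> + k e\<^sub>\<nu>) / J(t, \<zeta>)\<close> (\<open>post_moment_eq\<close>).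

  The derivative of \<open>\<Phi>\<close> in the direction \<open>t\<^sub>\<nu>\<close> has two parts. Differentiating \<open>J\<close> gives
  \<open>\<partial> ln J = E[ln (1 - v\<^sub>\<nu>) | \<zeta>] = - \<Sum>\<^sub>k m\<^sub>k(\<zeta>) / k\<close> (\<open>moment_sums\<close>). Differentiating the negative
  binomial mass \<open>w\<close> with success probability \<open>p = p\<^sub>\<cdot>\<^sub>,\<^sub>\<nu>\<close> gives
  \<open>\<partial> w(\<zeta>) = \<Sum>\<^sub>k (p ^ k / k) (w(\<zeta> - k) - w(\<zeta>))\<close> (\<open>nb_mass_sums_shift\<close>), and after summation by parts
  this contributes \<open>\<Sum>\<^sub>k (p ^ k / k) E[ln J(\<zeta> + k e\<^sub>\<nu>) - ln J(\<zeta>)] = \<Sum>\<^sub>k (1 / k) E[p ^ k ln m\<^sub>k]\<close>. So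
  the derivative is \<open>\<Sum>\<^sub>k (1 / k) E[p ^ k ln m\<^sub>k - m\<^sub>k]\<close> (\<open>drift_sums\<close>), which is
  \<open>- \<Sum>\<^sub>k (1 / k) E[L(m\<^sub>k, p ^ k)]\<close> up to terms depending on \<open>p\<close> alone.

  What remains is to justify the exchanges of limits. Everything follows from two bounds that are
  linear in the totals: \<open>\<bar>ln J(t, \<zeta>)\<bar> \<le> C (1 + \<bar>\<zeta>\<bar>)\<close> (\<open>ln_kernel_integral_bound\<close>) and
  \<open>E[- ln (1 - v\<^sub>\<nu>) | \<zeta>] \<le> C (1 + \<zeta>\<^sub>\<nu>)\<close> (\<open>log_weight_integral_bound\<close>), together with a single
  probability mass that dominates all negative binomial laws along the path even after
  multiplication by \<open>(1 + \<bar>\<zeta>\<bar>)\<^sup>2\<close> (\<open>nb_product_dominated\<close>). The second bound is where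
  \<open>a\<^sub>0\<^sub>,\<^sub>\<nu> + r\<^sub>\<nu> > 0\<close> and the sign of the shifts enter: they keep the Beta densities of \<open>v\<^sub>\<nu>\<close> uniformly
  away from the non-integrable exponent at \<open>1\<close>, already at \<open>\<tau> = 0\<close>.
\<close>

section \<open>Beta integrals and Liouville's formula\<close>

text \<open>
  The cut-off to the positive half-line turns integrals over simplices into integrals of products
  of functions of the single coordinates.
\<close>

definition halfline_power :: "real \<Rightarrow> real \<Rightarrow> ennreal" where
  "halfline_power a x = ennreal (x powr (a - 1)) * indicator {0<..} x"

lemma halfline_power_measurable [measurable]: "halfline_power a \<in> borel_measurable borel"
  unfolding halfline_power_def by measurable

lemma Beta_nn_integral:
  fixes a b :: real
  assumes "0 < a" "0 < b"
  shows "(\<integral>\<^sup>+ v. halfline_power a v * halfline_power b (1 - v) \<partial>lborel) = ennreal (Beta a b)"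
proof -
  have "((\<lambda>x. x powr (a - 1) * (1 - x) powr (b - 1)) has_integral Beta a b) {0<..<1}"
    using has_integral_Beta_real[of a b] assms by (simp add: has_integral_Icc_iff_Ioo)
  then have "(\<integral>\<^sup>+ v. ennreal (indicator {0<..<1} v * (v powr (a - 1) * (1 - v) powr (b - 1))) \<partial>lborel)
      = ennreal (Beta a b)"
    by (rule nn_integral_has_integral_lebesgue[rotated]) auto
  moreover have "halfline_power a v * halfline_power b (1 - v)
      = ennreal (indicator {0<..<1} v * (v powr (a - 1) * (1 - v) powr (b - 1)))" for v
    by (auto simp: halfline_power_def indicator_def ennreal_mult')
  ultimately show ?thesis by simp
qed

lemma Beta_real_pos: "0 < a \<Longrightarrow> 0 < b \<Longrightarrow> 0 < Beta a (b :: real)"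
  unfolding Beta_def by (intro divide_pos_pos mult_pos_pos Gamma_real_pos) auto

text \<open>
  After the substitution \<open>w = x + y\<close> and an exchange of the order of integration, the inner
  integral is a Beta integral over \<open>(0, w)\<close>, scaled by \<open>w\<close>.
\<close>

lemma halfline_power_convolution:
  assumes "0 < a" "0 < b" and [measurable]: "f \<in> borel_measurable borel"
  shows "(\<integral>\<^sup>+ x. halfline_power a x * (\<integral>\<^sup>+ y. halfline_power b y * f (x + y) \<partial>lborel) \<partial>lborel)
       = ennreal (Beta a b) * (\<integral>\<^sup>+ w. halfline_power (a + b) w * f w \<partial>lborel)"
proof -
  have scale: "(\<integral>\<^sup>+ x. halfline_power a x * halfline_power b (w - x) \<partial>lborel)
      = ennreal (Beta a b) * halfline_power (a + b) w" for w
  proof (cases "0 < w")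
    case True
    have "(\<integral>\<^sup>+ x. halfline_power a x * halfline_power b (w - x) \<partial>lborel)
        = ennreal w * (\<integral>\<^sup>+ v. halfline_power a (w * v) * halfline_power b (w - w * v) \<partial>lborel)"
      using nn_integral_real_affine[of "\<lambda>x. halfline_power a x * halfline_power b (w - x)" w 0] True
      by simp
    also have "(\<integral>\<^sup>+ v. halfline_power a (w * v) * halfline_power b (w - w * v) \<partial>lborel)
        = (\<integral>\<^sup>+ v. ennreal (w powr (a + b - 2)) * (halfline_power a v * halfline_power b (1 - v)) \<partial>lborel)"
    proof (intro nn_integral_cong)
      fix v :: real
      have e1: "halfline_power a (w * v) = ennreal (w powr (a - 1)) * halfline_power a v"
        using True by (auto simp: halfline_power_def indicator_def powr_mult ennreal_mult' zero_less_mult_iff)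
      have "w - w * v = w * (1 - v)" by (simp add: algebra_simps)
      then have e2: "halfline_power b (w - w * v) = ennreal (w powr (b - 1)) * halfline_power b (1 - v)"
        using True by (auto simp: halfline_power_def indicator_def powr_mult ennreal_mult' zero_less_mult_iff)
      have e3: "ennreal (w powr (a + b - 2)) = ennreal (w powr (a - 1)) * ennreal (w powr (b - 1))"
        by (simp add: ennreal_mult'[symmetric] powr_add[symmetric])
      show "halfline_power a (w * v) * halfline_power b (w - w * v)
          = ennreal (w powr (a + b - 2)) * (halfline_power a v * halfline_power b (1 - v))"
        unfolding e1 e2 e3 by (simp add: mult_ac)
    qed
    also have "\<dots> = ennreal (w powr (a + b - 2)) * ennreal (Beta a b)"
      by (simp add: nn_integral_cmult Beta_nn_integral assms)
    also have "ennreal w * (ennreal (w powr (a + b - 2)) * ennreal (Beta a b))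
        = ennreal (Beta a b) * (ennreal w * ennreal (w powr (a + b - 2)))"
      by (simp add: mult_ac)
    also have "ennreal w * ennreal (w powr (a + b - 2)) = halfline_power (a + b) w"
      using True powr_add[of w 1 "a + b - 2"]
      by (simp add: halfline_power_def ennreal_mult'[symmetric] algebra_simps)
    finally show ?thesis .
  next
    case False
    then have "(\<integral>\<^sup>+ x. halfline_power a x * halfline_power b (w - x) \<partial>lborel) = (\<integral>\<^sup>+ (x::real). 0 \<partial>lborel)"
      by (intro nn_integral_cong) (auto simp: halfline_power_def indicator_def)
    then show ?thesis using False by (simp add: halfline_power_def)
  qed
  have "(\<integral>\<^sup>+ x. halfline_power a x * (\<integral>\<^sup>+ y. halfline_power b y * f (x + y) \<partial>lborel) \<partial>lborel)
      = (\<integral>\<^sup>+ x. (\<integral>\<^sup>+ w. halfline_power a x * (halfline_power b (w - x) * f w) \<partial>lborel) \<partial>lborel)"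
  proof (intro nn_integral_cong)
    fix x :: real
    have "(\<integral>\<^sup>+ y. halfline_power b y * f (x + y) \<partial>lborel) = (\<integral>\<^sup>+ w. halfline_power b (w - x) * f w \<partial>lborel)"
      using nn_integral_real_affine[of "\<lambda>w. halfline_power b (w - x) * f w" 1 x] by simp
    then show "halfline_power a x * (\<integral>\<^sup>+ y. halfline_power b y * f (x + y) \<partial>lborel)
        = (\<integral>\<^sup>+ w. halfline_power a x * (halfline_power b (w - x) * f w) \<partial>lborel)"
      by (simp add: nn_integral_cmult)
  qed
  also have "\<dots> = (\<integral>\<^sup>+ w. (\<integral>\<^sup>+ x. halfline_power a x * (halfline_power b (w - x) * f w) \<partial>lborel) \<partial>lborel)"
    by (rule lborel_pair.Fubini') measurable
  also have "\<dots> = (\<integral>\<^sup>+ w. ennreal (Beta a b) * (halfline_power (a + b) w * f w) \<partial>lborel)"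
  proof (intro nn_integral_cong)
    fix w
    have "(\<integral>\<^sup>+ x. halfline_power a x * (halfline_power b (w - x) * f w) \<partial>lborel)
        = (\<integral>\<^sup>+ x. (halfline_power a x * halfline_power b (w - x)) * f w \<partial>lborel)"
      by (simp add: mult_ac)
    also have "\<dots> = ennreal (Beta a b) * halfline_power (a + b) w * f w"
      by (subst nn_integral_multc) (auto simp: scale)
    finally show "(\<integral>\<^sup>+ x. halfline_power a x * (halfline_power b (w - x) * f w) \<partial>lborel)
        = ennreal (Beta a b) * (halfline_power (a + b) w * f w)" by (simp add: mult_ac)
  qed
  finally show ?thesis by (simp add: nn_integral_cmult)
qed

definition dirichlet_const :: "'i set \<Rightarrow> ('i \<Rightarrow> real) \<Rightarrow> real" where
  "dirichlet_const I \<alpha> = (\<Prod>i\<in>I. Gamma (\<alpha> i)) / Gamma (\<Sum>i\<in>I. \<alpha> i)"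

lemma dirichlet_const_pos:
  assumes "finite I" "I \<noteq> {}" "\<And>i. i \<in> I \<Longrightarrow> 0 < \<alpha> i"
  shows "0 < dirichlet_const I \<alpha>"
  unfolding dirichlet_const_def using assms
  by (intro divide_pos_pos prod_pos Gamma_real_pos sum_pos) auto

text \<open>
  Liouville's formula: under a product of powers the sum of the coordinates decouples from their
  proportions. The coordinates are added one at a time, each step being a convolution of powers.
\<close>

lemma Liouville_Dirichlet:
  fixes \<alpha> :: "'i \<Rightarrow> real"
  assumes "finite I" "I \<noteq> {}" "\<And>i. i \<in> I \<Longrightarrow> 0 < \<alpha> i" and "f \<in> borel_measurable borel"
  shows "(\<integral>\<^sup>+ q. (\<Prod>i\<in>I. halfline_power (\<alpha> i) (q i)) * f (\<Sum>i\<in>I. q i) \<partial>(\<Pi>\<^sub>M i\<in>I. lborel))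
      = ennreal (dirichlet_const I \<alpha>) * (\<integral>\<^sup>+ v. halfline_power (\<Sum>i\<in>I. \<alpha> i) v * f v \<partial>lborel)"
  using assms
proof (induction I arbitrary: f rule: finite_ne_induct)
  case (singleton i)
  interpret product_sigma_finite "\<lambda>_::'i. lborel :: real measure" ..
  have "Gamma (\<alpha> i) \<noteq> 0" using Gamma_real_pos[of "\<alpha> i"] singleton.prems(1)[of i] by (metis insertI1 less_irrefl)
  then show ?case using singleton
    product_nn_integral_singleton[of "\<lambda>x. halfline_power (\<alpha> i) x * f x" i]
    by (simp add: dirichlet_const_def)
next
  case (insert i I)
  interpret product_sigma_finite "\<lambda>_::'i. lborel :: real measure" ..
  note [measurable] = insert.prems(2)
  have pos: "0 < \<alpha> i" "0 < sum \<alpha> I"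
    using insert by (auto intro!: sum_pos)
  let ?F = "\<lambda>q. (\<Prod>i\<in>insert i I. halfline_power (\<alpha> i) (q i)) * f (\<Sum>i\<in>insert i I. q i)"
  have "(\<integral>\<^sup>+ q. ?F q \<partial>(\<Pi>\<^sub>M i\<in>insert i I. lborel))
      = (\<integral>\<^sup>+ y. (\<integral>\<^sup>+ q. ?F (q(i := y)) \<partial>(\<Pi>\<^sub>M i\<in>I. lborel)) \<partial>lborel)"
    using insert.hyps by (intro product_nn_integral_insert_rev) auto
  also have "\<dots> = (\<integral>\<^sup>+ y. halfline_power (\<alpha> i) y *
      (\<integral>\<^sup>+ q. (\<Prod>j\<in>I. halfline_power (\<alpha> j) (q j)) * f (y + (\<Sum>j\<in>I. q j)) \<partial>(\<Pi>\<^sub>M i\<in>I. lborel)) \<partial>lborel)"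
  proof (intro nn_integral_cong)
    fix y
    have "?F (q(i := y)) = halfline_power (\<alpha> i) y *
        ((\<Prod>j\<in>I. halfline_power (\<alpha> j) (q j)) * f (y + (\<Sum>j\<in>I. q j)))" for q
    proof -
      have "(\<Prod>j\<in>I. halfline_power (\<alpha> j) ((q(i := y)) j)) = (\<Prod>j\<in>I. halfline_power (\<alpha> j) (q j))"
        using insert.hyps by (intro prod.cong) auto
      moreover have "(\<Sum>j\<in>I. (q(i := y)) j) = (\<Sum>j\<in>I. q j)"
        using insert.hyps by (intro sum.cong) auto
      ultimately show ?thesis using insert.hyps by (simp add: mult_ac)
    qed
    then show "(\<integral>\<^sup>+ q. ?F (q(i := y)) \<partial>(\<Pi>\<^sub>M i\<in>I. lborel)) = halfline_power (\<alpha> i) y *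
      (\<integral>\<^sup>+ q. (\<Prod>j\<in>I. halfline_power (\<alpha> j) (q j)) * f (y + (\<Sum>j\<in>I. q j)) \<partial>(\<Pi>\<^sub>M i\<in>I. lborel))"
      by (simp only:) (rule nn_integral_cmult, measurable)
  qed
  also have "\<dots> = (\<integral>\<^sup>+ y. ennreal (dirichlet_const I \<alpha>) * (halfline_power (\<alpha> i) y *
      (\<integral>\<^sup>+ v. halfline_power (sum \<alpha> I) v * f (y + v) \<partial>lborel)) \<partial>lborel)"
  proof (intro nn_integral_cong)
    fix y :: real
    have "(\<lambda>s. f (y + s)) \<in> borel_measurable borel" by measurable
    from insert.IH[OF _ this] insert.prems(1) show "halfline_power (\<alpha> i) y *
      (\<integral>\<^sup>+ q. (\<Prod>j\<in>I. halfline_power (\<alpha> j) (q j)) * f (y + (\<Sum>j\<in>I. q j)) \<partial>(\<Pi>\<^sub>M i\<in>I. lborel))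
      = ennreal (dirichlet_const I \<alpha>) * (halfline_power (\<alpha> i) y *
        (\<integral>\<^sup>+ v. halfline_power (sum \<alpha> I) v * f (y + v) \<partial>lborel))"
      by (simp add: mult_ac)
  qed
  also have "\<dots> = ennreal (dirichlet_const I \<alpha>) * (ennreal (Beta (\<alpha> i) (sum \<alpha> I)) *
      (\<integral>\<^sup>+ w. halfline_power (\<alpha> i + sum \<alpha> I) w * f w \<partial>lborel))"
    by (subst nn_integral_cmult, measurable) (simp add: halfline_power_convolution pos)
  also have "\<dots> = ennreal (dirichlet_const I \<alpha> * Beta (\<alpha> i) (sum \<alpha> I)) *
      (\<integral>\<^sup>+ w. halfline_power (\<alpha> i + sum \<alpha> I) w * f w \<partial>lborel)"
    using pos by (simp add: ennreal_mult'' Beta_real_pos less_imp_le mult.assoc)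
  also have "dirichlet_const I \<alpha> * Beta (\<alpha> i) (sum \<alpha> I) = dirichlet_const (insert i I) \<alpha>"
    using Gamma_real_pos[OF pos(2)] insert.hyps by (simp add: dirichlet_const_def Beta_def)
  finally show ?case using insert.hyps by simp
qed

text \<open>
  A factor \<open>(1 - v) ^ (- \<eta>)\<close> costs no more than a multiple that is linear in \<open>\<beta>\<close>. This is the
  recurrence \<open>(\<beta> + y) B(\<beta>, y + 1) = y B(\<beta>, y)\<close> combined with the monotonicity of \<open>B\<close>; it makes
  logarithmic singularities at \<open>v = 1\<close> harmless.
\<close>

lemma Beta_shift_bound:
  fixes \<beta> y \<eta> :: real
  assumes "0 < \<beta>" "0 < y" "0 \<le> \<eta>" "\<eta> \<le> 1"
  shows "Beta \<beta> y \<le> (1 + \<beta> / y) * Beta \<beta> (y + \<eta>)"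
proof -
  have "y \<notin> \<int>\<^sub>\<le>\<^sub>0" using assms by (auto elim!: nonpos_Ints_cases)
  then have "(\<beta> + y) * Beta \<beta> (y + 1) = y * Beta \<beta> y" by (rule Beta_plus1_right)
  then have "Beta \<beta> y = (1 + \<beta> / y) * Beta \<beta> (y + 1)" using assms by (simp add: field_simps)
  also have "\<dots> \<le> (1 + \<beta> / y) * Beta \<beta> (y + \<eta>)"
    using assms by (intro mult_left_mono Beta_real_mono) auto
  finally show ?thesis .
qed

text \<open>
  The integrand dominates the one with \<open>b\<close> replaced by any \<open>c > 0\<close>, and \<open>B(a, c)\<close> is of order
  \<open>1 / c\<close> as \<open>c\<close> tends to \<open>0\<close>.
\<close>

lemma Beta_nn_integral_infinite:
  fixes a b :: real
  assumes "0 < a" "b \<le> 0"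
  shows "(\<integral>\<^sup>+ v. halfline_power a v * halfline_power b (1 - v) \<partial>lborel) = \<infinity>"
proof -
  have "ennreal (real n) \<le> (\<integral>\<^sup>+ v. halfline_power a v * halfline_power b (1 - v) \<partial>lborel)" for n
  proof -
    \<comment> \<open>Chosen so that the lower bound \<open>a B(a, 2) / c\<close> for \<open>B(a, c)\<close> exceeds \<open>n\<close>.\<close>
    define c where "c = min 1 (a * Beta a 2 / (real n + 1))"
    have B2: "0 < Beta a 2" using assms by (intro Beta_real_pos) auto
    have c: "0 < c" "c \<le> 1" using assms B2 by (auto simp: c_def)
    have "c \<notin> \<int>\<^sub>\<le>\<^sub>0" using c by (auto elim!: nonpos_Ints_cases)
    then have "(a + c) * Beta a (c + 1) = c * Beta a c" by (rule Beta_plus1_right)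
    then have "Beta a c = (a + c) / c * Beta a (c + 1)" using c by (simp add: field_simps)
    also have "\<dots> \<ge> a / c * Beta a 2"
      using c assms by (intro mult_mono Beta_real_mono divide_right_mono) (auto intro!: less_imp_le[OF Beta_real_pos])
    finally have "a * Beta a 2 / c \<le> Beta a c" by simp
    moreover have "real n + 1 \<le> a * Beta a 2 / c"
    proof -
      have "c \<le> a * Beta a 2 / (real n + 1)" by (simp add: c_def)
      then show ?thesis using c by (simp add: field_simps)
    qed
    ultimately have "ennreal (real n) \<le> ennreal (Beta a c)" by (intro ennreal_leI) linarith
    also have "\<dots> = (\<integral>\<^sup>+ v. halfline_power a v * halfline_power c (1 - v) \<partial>lborel)"
      using assms c by (simp add: Beta_nn_integral)
    also have "\<dots> \<le> (\<integral>\<^sup>+ v. halfline_power a v * halfline_power b (1 - v) \<partial>lborel)"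
    proof (intro nn_integral_mono)
      fix v
      show "halfline_power a v * halfline_power c (1 - v) \<le> halfline_power a v * halfline_power b (1 - v)"
      proof (cases "0 < v")
        case True
        then show ?thesis using assms c
          by (intro mult_left_mono)
            (auto simp: halfline_power_def indicator_def intro!: ennreal_leI powr_mono')
      qed (simp add: halfline_power_def)
    qed
    finally show ?thesis .
  qed
  note large = this
  show ?thesis
  proof (rule ccontr)
    assume "\<not> ?thesis"
    then obtain n where "(\<integral>\<^sup>+ v. halfline_power a v * halfline_power b (1 - v) \<partial>lborel) < of_nat n"
      using ennreal_Ex_less_of_nat by (auto simp: less_top)
    with large[of n] show False by (simp add: ennreal_of_nat_eq_real_of_nat)
  qed
qed

section \<open>Negative binomial totals\<close>

(* Index sets have the form {1..N}; rewriting 1 to Suc 0 would keep lemmas about them from matching. *)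
declare One_nat_def [simp del]

definition nb_mass :: "real \<Rightarrow> real \<Rightarrow> nat \<Rightarrow> real" where
  "nb_mass t p z = pochhammer t z / fact z * p ^ z * (1 - p) powr t"

definition nb_pmf :: "real \<Rightarrow> real \<Rightarrow> nat pmf" where
  "nb_pmf t p = embed_pmf (nb_mass t p)"

lemma nb_mass_nonneg: "0 < t \<Longrightarrow> 0 \<le> p \<Longrightarrow> 0 \<le> nb_mass t p z"
  unfolding nb_mass_def by (intro mult_nonneg_nonneg divide_nonneg_nonneg pochhammer_nonneg) auto

lemma nb_mass_sums:
  assumes "0 < t" "0 \<le> p" "p < 1"
  shows "nb_mass t p sums 1"
proof -
  have "t \<notin> \<int>\<^sub>\<le>\<^sub>0" using assms(1) by (auto elim!: nonpos_Ints_cases)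
  then have "nb_mass t p = (\<lambda>k. Gamma (t + real k) / (Gamma t * fact k) * (1 - p) powr t * p ^ k)"
    by (intro ext) (simp add: nb_mass_def pochhammer_Gamma)
  then show ?thesis using neg_binomial_series[OF assms] by (simp only:)
qed

lemma pmf_nb:
  assumes "0 < t" "0 \<le> p" "p < 1"
  shows "pmf (nb_pmf t p) z = nb_mass t p z"
  unfolding nb_pmf_def
proof (rule pmf_embed_pmf)
  show "0 \<le> nb_mass t p x" for x using assms by (intro nb_mass_nonneg)
  have "(\<Sum>k. ennreal (nb_mass t p k)) = ennreal 1"
    using nb_mass_sums[OF assms] nb_mass_nonneg[of t p] assms by (intro suminf_ennreal_eq) auto
  then show "(\<integral>\<^sup>+ x. ennreal (nb_mass t p x) \<partial>count_space UNIV) = 1"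
    by (simp add: nn_integral_count_space_nat)
qed

definition compositions :: "nat \<Rightarrow> nat \<Rightarrow> (nat \<Rightarrow> nat) set" where
  "compositions m k = {x. (\<forall>i. i \<notin> {1..m} \<longrightarrow> x i = 0) \<and> (\<Sum>i\<in>{1..m}. x i) = k}"

lemma compositions_0: "compositions 0 k = (if k = 0 then {\<lambda>_. 0} else {})"
  by (auto simp: compositions_def)

lemma bij_betw_compositions_Suc:
  "bij_betw (\<lambda>(j, x). x(Suc m := j)) (SIGMA j:{..k}. compositions m (k - j)) (compositions (Suc m) k)"
proof (rule bij_betw_byWitness[where f' = "\<lambda>x. (x (Suc m), x(Suc m := 0))"])
  have s: "{1..Suc m} = insert (Suc m) {1..m}" by auto
  have *: "(\<Sum>i\<in>{1..m}. (x(Suc m := j)) i) = (\<Sum>i\<in>{1..m}. x i)" for x :: "nat \<Rightarrow> nat" and j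
    by (intro sum.cong) auto
  show "\<forall>a\<in>SIGMA j:{..k}. compositions m (k - j).
       ((case a of (j, x) \<Rightarrow> x(Suc m := j)) (Suc m), (case a of (j, x) \<Rightarrow> x(Suc m := j))(Suc m := 0)) = a"
    by (auto simp: compositions_def fun_eq_iff)
  show "\<forall>a'\<in>compositions (Suc m) k. (case (a' (Suc m), a'(Suc m := 0)) of (j, x) \<Rightarrow> x(Suc m := j)) = a'"
    by (auto simp: fun_eq_iff)
  show "(\<lambda>(j, x). x(Suc m := j)) ` (SIGMA j:{..k}. compositions m (k - j)) \<subseteq> compositions (Suc m) k"
    by (auto simp: compositions_def s * simp del: fun_upd_apply) (auto simp: s)
  show "(\<lambda>x. (x (Suc m), x(Suc m := 0))) ` compositions (Suc m) k \<subseteq> (SIGMA j:{..k}. compositions m (k - j))"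
    by (auto simp: compositions_def s * simp del: fun_upd_apply) (auto simp: s)
qed

lemma finite_compositions [simp]: "finite (compositions m k)"
proof (induction m arbitrary: k)
  case (Suc m)
  then show ?case using bij_betw_finite[OF bij_betw_compositions_Suc[of m k]] by simp
qed (simp add: compositions_0)

text \<open>
  The multinomial theorem in the form in which it adds up the negative multinomial masses of a
  given total; splitting off the last coordinate reduces it to the binomial theorem.
\<close>

lemma multinomial_expansion:
  fixes q :: "nat \<Rightarrow> real"
  shows "(\<Sum>x\<in>compositions m k. \<Prod>i\<in>{1..m}. q i ^ x i / fact (x i)) = psum m q ^ k / fact k"
proof (induction m arbitrary: k)
  case 0
  then show ?case by (simp add: compositions_0 psum_def power_0_left)
next
  case (Suc m)
  have s: "{1..Suc m} = insert (Suc m) {1..m}" by auto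
  have "(\<Sum>x\<in>compositions (Suc m) k. \<Prod>i\<in>{1..Suc m}. q i ^ x i / fact (x i))
      = (\<Sum>(j, x)\<in>(SIGMA j:{..k}. compositions m (k - j)).
           q (Suc m) ^ j / fact j * (\<Prod>i\<in>{1..m}. q i ^ x i / fact (x i)))"
    by (subst sum.reindex_bij_betw[OF bij_betw_compositions_Suc, symmetric])
       (auto simp: s intro!: sum.cong prod.cong)
  also have "\<dots> = (\<Sum>j\<le>k. q (Suc m) ^ j / fact j * (psum m q ^ (k - j) / fact (k - j)))"
    by (subst sum.Sigma[symmetric]) (auto simp only: sum_distrib_left[symmetric] Suc finite_compositions finite_atMost)
  also have "\<dots> = (\<Sum>j\<le>k. of_nat (k choose j) * q (Suc m) ^ j * psum m q ^ (k - j)) / fact k"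
    by (auto simp: sum_divide_distrib binomial_fact intro!: sum.cong)
  also have "\<dots> = (q (Suc m) + psum m q) ^ k / fact k"
    by (simp add: binomial_ring)
  also have "q (Suc m) + psum m q = psum (Suc m) q" by (simp add: psum_def s)
  finally show ?case .
qed

lemma map_sum_neg_multinomial_pmf:
  assumes r: "0 < r" and q: "q \<in> open_simplex m"
  shows "map_pmf (\<lambda>x. \<Sum>i\<in>{1..m}. x i) (neg_multinomial_pmf m r q) = nb_pmf r (psum m q)"
proof (rule pmf_eqI)
  fix k
  have Q: "0 \<le> psum m q" "psum m q < 1"
    using q by (auto simp: open_simplex_def psum_def intro!: sum_nonneg intro: less_imp_le)
  let ?p = "neg_multinomial_pmf m r q"
  have sub: "set_pmf ?p \<subseteq> {x. \<forall>i. i \<notin> {1..m} \<longrightarrow> x i = 0}"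
    by (auto simp: set_pmf_iff pmf_neg_multinomial[OF r q] split: if_splits)
  have "pmf (map_pmf (\<lambda>x. \<Sum>i\<in>{1..m}. x i) ?p) k = measure ?p ((\<lambda>x. \<Sum>i\<in>{1..m}. x i) -` {k} \<inter> set_pmf ?p)"
    by (simp add: pmf_map measure_Int_set_pmf)
  also have "\<dots> = measure ?p (compositions m k \<inter> set_pmf ?p)"
    using sub by (intro arg_cong[where f = "measure ?p"]) (auto simp: compositions_def)
  also have "\<dots> = (\<Sum>x\<in>compositions m k. pmf ?p x)"
    by (simp add: measure_Int_set_pmf measure_measure_pmf_finite)
  also have "\<dots> = (\<Sum>x\<in>compositions m k. Gamma (r + real k) / Gamma r * (1 - psum m q) powr r *
      (\<Prod>i\<in>{1..m}. q i ^ x i / fact (x i)))"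
    by (intro sum.cong) (auto simp: pmf_neg_multinomial[OF r q] compositions_def nm_mass_def prod_dividef
        simp del: of_nat_sum)
  also have "\<dots> = Gamma (r + real k) / Gamma r * (1 - psum m q) powr r * (psum m q ^ k / fact k)"
    by (simp only: sum_distrib_left[symmetric] multinomial_expansion)
  also have "\<dots> = nb_mass r (psum m q) k"
  proof -
    have "r \<notin> \<int>\<^sub>\<le>\<^sub>0" using r by (auto elim!: nonpos_Ints_cases)
    then show ?thesis by (simp add: nb_mass_def pochhammer_Gamma)
  qed
  finally show "pmf (map_pmf (\<lambda>x. \<Sum>i\<in>{1..m}. x i) ?p) k = pmf (nb_pmf r (psum m q)) k"
    using r Q by (simp add: pmf_nb)
qed

text \<open>
  The masses convolve by the Vandermonde identity for rising factorials.
\<close>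

lemma nb_pmf_add:
  assumes "0 < r" "0 < s" "0 \<le> p" "p < 1"
  shows "map_pmf (\<lambda>(x, y). x + y) (pair_pmf (nb_pmf r p) (nb_pmf s p)) = nb_pmf (r + s) p"
proof (rule pmf_eqI)
  fix k
  have img: "((\<lambda>(x, y). x + y) -` {k} :: (nat \<times> nat) set) = (\<lambda>i. (i, k - i)) ` {..k}"
    by (auto simp: image_iff)
  have inj: "inj_on (\<lambda>i. (i, k - i)) {..k}" by (auto simp: inj_on_def)
  have "pmf (map_pmf (\<lambda>(x, y). x + y) (pair_pmf (nb_pmf r p) (nb_pmf s p))) k
      = (\<Sum>i\<le>k. nb_mass r p i * nb_mass s p (k - i))"
    unfolding pmf_map img using assms
    by (simp add: measure_measure_pmf_finite sum.reindex[OF inj] pmf_pair pmf_nb)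
  also have "\<dots> = (\<Sum>i\<le>k. of_nat (k choose i) * pochhammer r i * pochhammer s (k - i)) *
      (p ^ k * (1 - p) powr (r + s) / fact k)"
    unfolding sum_distrib_right
  proof (intro sum.cong refl)
    fix i assume "i \<in> {..k}"
    then have i: "i \<le> k" by simp
    then have "p ^ k = p ^ i * p ^ (k - i)" by (simp add: power_add[symmetric])
    then show "nb_mass r p i * nb_mass s p (k - i) =
      of_nat (k choose i) * pochhammer r i * pochhammer s (k - i) * (p ^ k * (1 - p) powr (r + s) / fact k)"
      using i by (simp add: nb_mass_def powr_add binomial_fact)
  qed
  also have "\<dots> = nb_mass (r + s) p k"
    by (simp add: pochhammer_binomial_sum[symmetric] nb_mass_def)
  finally show "pmf (map_pmf (\<lambda>(x, y). x + y) (pair_pmf (nb_pmf r p) (nb_pmf s p))) k = pmf (nb_pmf (r + s) p) k"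
    using assms by (simp add: pmf_nb)
qed

lemma Pi_pmf_map_dependent:
  assumes A: "finite A" and f: "\<And>x. x \<notin> A \<Longrightarrow> f x d = d'"
  shows "map_pmf (\<lambda>h x. f x (h x)) (Pi_pmf A d g) = Pi_pmf A d' (\<lambda>x. map_pmf (f x) (g x))"
proof -
  have "Pi_pmf A d' (\<lambda>x. map_pmf (f x) (g x)) = Pi_pmf A d' (\<lambda>x. g x \<bind> (\<lambda>y. return_pmf (f x y)))"
    by (simp add: map_pmf_def)
  also have "\<dots> = Pi_pmf A d g \<bind> (\<lambda>h. return_pmf (\<lambda>x. if x \<in> A then f x (h x) else d'))"
    using A by (subst Pi_pmf_bind[where d' = d]) auto
  also have "\<dots> = map_pmf (\<lambda>h x. f x (h x)) (Pi_pmf A d g)"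
    unfolding map_pmf_def using set_Pi_pmf_subset[OF A, of d g] f
    by (intro bind_pmf_cong refl arg_cong[of _ _ return_pmf]) (auto simp: fun_eq_iff)
  finally show ?thesis ..
qed

lemma Pi_pmf_pair:
  assumes A: "finite A"
  shows "map_pmf (\<lambda>(f, g) x. (f x, g x)) (pair_pmf (Pi_pmf A d p) (Pi_pmf A d' q))
       = Pi_pmf A (d, d') (\<lambda>x. pair_pmf (p x) (q x))"
proof (rule pmf_eqI)
  fix h :: "'a \<Rightarrow> 'b \<times> 'c"
  have inj: "inj (\<lambda>(f, g) (x :: 'a). (f x :: 'b, g x :: 'c))" by (auto simp: inj_def fun_eq_iff)
  have h: "h = (\<lambda>(f, g) x. (f x, g x)) (fst \<circ> h, snd \<circ> h)" by auto
  have "pmf (map_pmf (\<lambda>(f, g) x. (f x, g x)) (pair_pmf (Pi_pmf A d p) (Pi_pmf A d' q))) h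
      = pmf (pair_pmf (Pi_pmf A d p) (Pi_pmf A d' q)) (fst \<circ> h, snd \<circ> h)"
    by (subst h) (rule pmf_map_inj'[OF inj])
  also have "\<dots> = pmf (Pi_pmf A (d, d') (\<lambda>x. pair_pmf (p x) (q x))) h"
    unfolding pmf_pair pmf_Pi[OF A] o_def
    by (auto simp: prod.distrib[symmetric] prod_eq_iff pmf_pair[symmetric])
  finally show "pmf (map_pmf (\<lambda>(f, g) x. (f x, g x)) (pair_pmf (Pi_pmf A d p) (Pi_pmf A d' q))) h
      = pmf (Pi_pmf A (d, d') (\<lambda>x. pair_pmf (p x) (q x))) h" .
qed

definition nb_product :: "nat \<Rightarrow> (nat \<Rightarrow> real) \<Rightarrow> (nat \<Rightarrow> real) \<Rightarrow> (nat \<Rightarrow> nat) pmf" where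
  "nb_product N t P = Pi_pmf {1..N} 0 (\<lambda>\<nu>. nb_pmf (t \<nu>) (P \<nu>))"

definition totals :: "(nat \<Rightarrow> nat) \<Rightarrow> (nat \<Rightarrow> nat \<Rightarrow> nat) \<Rightarrow> nat \<Rightarrow> nat" where
  "totals m z \<nu> = (\<Sum>i\<in>{1..m \<nu>}. z \<nu> i)"

lemma map_totals_nm_product_pmf:
  assumes t: "\<And>\<nu>. \<nu> \<in> {1..N} \<Longrightarrow> 0 < t \<nu>" and p: "p \<in> param_space N m"
  shows "map_pmf (totals m) (nm_product_pmf N m t p) = nb_product N t (\<lambda>\<nu>. psum (m \<nu>) (p \<nu>))"
proof -
  have "map_pmf (totals m) (nm_product_pmf N m t p)
      = map_pmf (\<lambda>h \<nu>. (\<Sum>i\<in>{1..m \<nu>}. h \<nu> i)) (nm_product_pmf N m t p)"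
    by (simp add: totals_def[abs_def])
  also have "\<dots> = Pi_pmf {1..N} 0 (\<lambda>\<nu>. map_pmf (\<lambda>x. \<Sum>i\<in>{1..m \<nu>}. x i) (neg_multinomial_pmf (m \<nu>) (t \<nu>) (p \<nu>)))"
    unfolding nm_product_pmf_def by (intro Pi_pmf_map_dependent) auto
  also have "\<dots> = nb_product N t (\<lambda>\<nu>. psum (m \<nu>) (p \<nu>))"
    unfolding nb_product_def using p t
    by (intro Pi_pmf_cong map_sum_neg_multinomial_pmf) (auto simp: param_space_def PiE_def Pi_def)
  finally show ?thesis .
qed

text \<open>
  Blocks beyond \<open>n\<close> have nothing to predict. Giving them a point mass at \<open>0\<close> makes both vectors
  independent families over the same index set, so that the laws can be added block by block.
\<close>

lemma map_totals_obs_pmf: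
  assumes n: "n \<le> N" and r: "\<And>\<nu>. \<nu> \<in> {1..N} \<Longrightarrow> 0 < r \<nu>" and s: "\<And>\<nu>. \<nu> \<in> {1..n} \<Longrightarrow> 0 < s \<nu>"
    and p: "p \<in> param_space N m"
  shows "map_pmf (\<lambda>(x, y) \<nu>. totals m x \<nu> + totals m y \<nu>) (obs_pmf N n m r s p)
       = nb_product N (\<lambda>\<nu>. if \<nu> \<le> n then r \<nu> + s \<nu> else r \<nu>) (\<lambda>\<nu>. psum (m \<nu>) (p \<nu>))"
proof -
  define Y where "Y = (\<lambda>\<nu>. if \<nu> \<le> n then neg_multinomial_pmf (m \<nu>) (s \<nu>) (p \<nu>) else return_pmf (\<lambda>_. 0))"
  have "{\<nu> \<in> {1..N}. \<nu> \<le> n} = {1..n}" using n by auto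
  then have Y: "nm_product_pmf n m s p = Pi_pmf {1..N} (\<lambda>_. 0) Y"
    unfolding Y_def nm_product_pmf_def by (subst Pi_pmf_if_set) auto
  have "map_pmf (\<lambda>(x, y) \<nu>. totals m x \<nu> + totals m y \<nu>) (obs_pmf N n m r s p)
      = map_pmf (\<lambda>h \<nu>. (case h \<nu> of (x, y) \<Rightarrow> (\<Sum>i\<in>{1..m \<nu>}. x i) + (\<Sum>i\<in>{1..m \<nu>}. y i)))
          (map_pmf (\<lambda>(f, g) x. (f x, g x)) (obs_pmf N n m r s p))"
    unfolding map_pmf_comp by (intro map_pmf_cong refl) (auto simp: totals_def fun_eq_iff)
  also have "map_pmf (\<lambda>(f, g) x. (f x, g x)) (obs_pmf N n m r s p)
      = Pi_pmf {1..N} (\<lambda>_. 0, \<lambda>_. 0) (\<lambda>\<nu>. pair_pmf (neg_multinomial_pmf (m \<nu>) (r \<nu>) (p \<nu>)) (Y \<nu>))"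
    unfolding obs_pmf_def Y unfolding nm_product_pmf_def by (rule Pi_pmf_pair) auto
  also have "map_pmf (\<lambda>h \<nu>. (case h \<nu> of (x, y) \<Rightarrow> (\<Sum>i\<in>{1..m \<nu>}. x i) + (\<Sum>i\<in>{1..m \<nu>}. y i))) \<dots>
      = Pi_pmf {1..N} 0 (\<lambda>\<nu>. map_pmf (\<lambda>(x, y). (\<Sum>i\<in>{1..m \<nu>}. x i) + (\<Sum>i\<in>{1..m \<nu>}. y i))
          (pair_pmf (neg_multinomial_pmf (m \<nu>) (r \<nu>) (p \<nu>)) (Y \<nu>)))"
    by (rule Pi_pmf_map_dependent) auto
  also have "\<dots> = nb_product N (\<lambda>\<nu>. if \<nu> \<le> n then r \<nu> + s \<nu> else r \<nu>) (\<lambda>\<nu>. psum (m \<nu>) (p \<nu>))"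
    unfolding nb_product_def
  proof (intro Pi_pmf_cong refl)
    fix \<nu> assume \<nu>: "\<nu> \<in> {1..N}"
    have q: "p \<nu> \<in> open_simplex (m \<nu>)" using p \<nu> by (auto simp: param_space_def PiE_def Pi_def)
    have Q: "0 \<le> psum (m \<nu>) (p \<nu>)" "psum (m \<nu>) (p \<nu>) < 1"
      using q by (auto simp: open_simplex_def psum_def intro!: sum_nonneg intro: less_imp_le)
    let ?S = "\<lambda>x :: nat \<Rightarrow> nat. \<Sum>i\<in>{1..m \<nu>}. x i"
    have "map_pmf (\<lambda>(x, y). ?S x + ?S y) (pair_pmf (neg_multinomial_pmf (m \<nu>) (r \<nu>) (p \<nu>)) (Y \<nu>))
        = map_pmf (\<lambda>(x, y). x + y) (map_pmf (map_prod ?S ?S) (pair_pmf (neg_multinomial_pmf (m \<nu>) (r \<nu>) (p \<nu>)) (Y \<nu>)))"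
      by (auto simp: map_pmf_comp intro!: map_pmf_cong)
    also have "map_pmf (map_prod ?S ?S) (pair_pmf (neg_multinomial_pmf (m \<nu>) (r \<nu>) (p \<nu>)) (Y \<nu>))
        = pair_pmf (nb_pmf (r \<nu>) (psum (m \<nu>) (p \<nu>))) (map_pmf ?S (Y \<nu>))"
      unfolding map_prod_def map_pair map_sum_neg_multinomial_pmf[OF r[OF \<nu>] q] ..
    also have "map_pmf (\<lambda>(x, y). x + y) \<dots>
        = nb_pmf (if \<nu> \<le> n then r \<nu> + s \<nu> else r \<nu>) (psum (m \<nu>) (p \<nu>))"
    proof (cases "\<nu> \<le> n")
      case True
      then have "0 < s \<nu>" using s \<nu> by auto
      then show ?thesis using True q Q r[OF \<nu>]
        by (simp add: Y_def map_sum_neg_multinomial_pmf nb_pmf_add)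
    next
      case False
      then show ?thesis
        by (simp add: Y_def pair_return_pmf2 map_pmf_comp)
    qed
    finally show "map_pmf (\<lambda>(x, y). ?S x + ?S y) (pair_pmf (neg_multinomial_pmf (m \<nu>) (r \<nu>) (p \<nu>)) (Y \<nu>))
        = nb_pmf (if \<nu> \<le> n then r \<nu> + s \<nu> else r \<nu>) (psum (m \<nu>) (p \<nu>))" .
  qed
  finally show ?thesis .
qed

text \<open>
  The coefficients \<open>c z\<close> are those of \<open>(1 - x) ^ (- t)\<close>, and the identity compares coefficients in
  \<open>\<partial>\<^sub>t (1 - x) ^ (- t) = - ln (1 - x) (1 - x) ^ (- t)\<close>. Both sides satisfy the recurrence
  \<open>(z + 1) u(z + 1) = (t + z) u(z) + c(z)\<close>, which is what the induction verifies.
\<close>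

lemma pochhammer_score_convolution:
  fixes t :: real
  assumes "0 < t"
  defines "c \<equiv> \<lambda>z. pochhammer t z / fact z"
  shows "(\<Sum>k<z. c (z - Suc k) / real (Suc k)) = c z * (\<Sum>i<z. 1 / (t + real i))"
proof (induction z)
  case (Suc z)
  have c_Suc: "real (Suc j) * c (Suc j) = (t + real j) * c j" for j
    unfolding c_def fact_Suc pochhammer_Suc by (simp add: field_simps del: of_nat_Suc)
  have tz: "t + real z \<noteq> 0" using assms(1) by auto
  have rev: "(\<Sum>k<j. c (j - Suc k)) = (\<Sum>k<j. c k)" for j
    by (rule sum.nat_diff_reindex)
  have "real (Suc z) * (\<Sum>k<Suc z. c (Suc z - Suc k) / real (Suc k))
      = (\<Sum>k<Suc z. real (z - k) * c (z - k) / real (Suc k) + c (z - k))"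
    unfolding sum_distrib_left
  proof (intro sum.cong refl)
    fix k assume "k \<in> {..<Suc z}"
    then have "real (Suc z) = real (z - k) + real (Suc k)" by (simp add: of_nat_diff)
    then show "real (Suc z) * (c (Suc z - Suc k) / real (Suc k)) = real (z - k) * c (z - k) / real (Suc k) + c (z - k)"
      by (simp add: field_simps del: of_nat_Suc)
  qed
  also have "\<dots> = (\<Sum>k<Suc z. real (z - k) * c (z - k) / real (Suc k)) + (\<Sum>k<Suc z. c k)"
    using rev[of "Suc z"] by (simp add: sum.distrib)
  also have "(\<Sum>k<Suc z. real (z - k) * c (z - k) / real (Suc k))
      = (\<Sum>k<z. (t + real z) * (c (z - Suc k) / real (Suc k)) - c (z - Suc k))"
  proof -
    have "(\<Sum>k<Suc z. real (z - k) * c (z - k) / real (Suc k)) = (\<Sum>k<z. real (z - k) * c (z - k) / real (Suc k))"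
      by simp
    also have "\<dots> = (\<Sum>k<z. (t + real z) * (c (z - Suc k) / real (Suc k)) - c (z - Suc k))"
    proof (intro sum.cong refl)
      fix k assume "k \<in> {..<z}"
      then have k: "z - k = Suc (z - Suc k)" "real (z - Suc k) = real z - real (Suc k)" by (auto simp: of_nat_diff)
      have "real (z - k) * c (z - k) = (t + real z - real (Suc k)) * c (z - Suc k)"
        unfolding k(1) c_Suc k(2) by simp
      then show "real (z - k) * c (z - k) / real (Suc k) = (t + real z) * (c (z - Suc k) / real (Suc k)) - c (z - Suc k)"
        by (simp add: field_simps del: of_nat_Suc)
    qed
    finally show ?thesis .
  qed
  also have "\<dots> = (t + real z) * (c z * (\<Sum>i<z. 1 / (t + real i))) - (\<Sum>k<z. c k)"
    by (simp only: sum_subtractf sum_distrib_left[symmetric] Suc rev)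
  also have "\<dots> + (\<Sum>k<Suc z. c k) = (t + real z) * c z * (\<Sum>i<Suc z. 1 / (t + real i))"
    using tz by (simp add: field_simps)
  also have "\<dots> = real (Suc z) * (c (Suc z) * (\<Sum>i<Suc z. 1 / (t + real i)))"
    by (simp only: c_Suc[symmetric] mult.assoc)
  finally show ?case by (simp del: of_nat_Suc)
qed simp

text \<open>
  The forward equation of the negative binomial process: as \<open>t\<close> grows, jumps of size \<open>k\<close> arrive at
  rate \<open>p ^ k / k\<close>. The right-hand side is the derivative of the mass in \<open>t\<close>.
\<close>

lemma nb_mass_sums_shift:
  assumes "0 < t" "0 < p" "p < 1"
  shows "(\<lambda>k. p ^ Suc k / real (Suc k) * ((if Suc k \<le> z then nb_mass t p (z - Suc k) else 0) - nb_mass t p z))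
    sums (nb_mass t p z * ((\<Sum>i<z. 1 / (t + real i)) + ln (1 - p)))"
proof -
  have "(\<lambda>k. p ^ Suc k / real (Suc k) * (if Suc k \<le> z then nb_mass t p (z - Suc k) else 0))
      sums (\<Sum>k<z. p ^ Suc k / real (Suc k) * (if Suc k \<le> z then nb_mass t p (z - Suc k) else 0))"
    by (rule sums_finite) auto
  also have "(\<Sum>k<z. p ^ Suc k / real (Suc k) * (if Suc k \<le> z then nb_mass t p (z - Suc k) else 0))
      = p ^ z * (1 - p) powr t * (\<Sum>k<z. (pochhammer t (z - Suc k) / fact (z - Suc k)) / real (Suc k))"
    unfolding sum_distrib_left
  proof (intro sum.cong refl)
    fix k assume "k \<in> {..<z}"
    then have k: "Suc k \<le> z" by simp
    then have "p ^ z = p ^ Suc k * p ^ (z - Suc k)" by (simp only: power_add[symmetric]) simp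
    then show "p ^ Suc k / real (Suc k) * (if Suc k \<le> z then nb_mass t p (z - Suc k) else 0)
      = p ^ z * (1 - p) powr t * (pochhammer t (z - Suc k) / fact (z - Suc k) / real (Suc k))"
      using k by (simp add: nb_mass_def mult_ac del: of_nat_Suc power_Suc)
  qed
  also have "\<dots> = nb_mass t p z * (\<Sum>i<z. 1 / (t + real i))"
    using pochhammer_score_convolution[OF assms(1), of z] by (simp add: nb_mass_def)
  finally have 1: "(\<lambda>k. p ^ Suc k / real (Suc k) * (if Suc k \<le> z then nb_mass t p (z - Suc k) else 0))
      sums (nb_mass t p z * (\<Sum>i<z. 1 / (t + real i)))" .
  have "(\<lambda>k. - (p ^ k) / real k) sums ln (1 + - p)"
    using ln_series'[of "- p"] assms by simp
  then have "(\<lambda>k. - (p ^ Suc k) / real (Suc k)) sums ln (1 - p)"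
    by (subst sums_Suc_iff) simp
  from sums_add[OF 1 sums_mult[OF this, of "nb_mass t p z"]] show ?thesis
    by (simp add: algebra_simps del: of_nat_Suc power_Suc)
qed

lemma has_derivative_nb_mass:
  assumes "0 < t" "p < 1"
  shows "((\<lambda>t. nb_mass t p z) has_real_derivative nb_mass t p z * ((\<Sum>i<z. 1 / (t + real i)) + ln (1 - p))) (at t)"
proof -
  have "((\<lambda>t. pochhammer t z) has_real_derivative pochhammer t z * (\<Sum>i<z. 1 / (t + real i))) (at t)" for z
  proof (induction z)
    case (Suc z)
    have "t + real z \<noteq> 0" using assms(1) by auto
    then show ?case unfolding pochhammer_Suc
      by (auto intro!: derivative_eq_intros Suc simp: field_simps)
  qed auto
  then show ?thesis
    unfolding nb_mass_def using assms
    by (auto intro!: derivative_eq_intros simp: field_simps)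
qed

section \<open>Dirichlet densities on the parameter space\<close>

definition nm_kernel ::
  "nat \<Rightarrow> (nat \<Rightarrow> nat) \<Rightarrow> (nat \<Rightarrow> real) \<Rightarrow> (nat \<Rightarrow> nat \<Rightarrow> nat) \<Rightarrow> (nat \<Rightarrow> nat \<Rightarrow> real) \<Rightarrow> real" where
  "nm_kernel N m t z q =
     (\<Prod>\<nu>\<in>{1..N}. (1 - psum (m \<nu>) (q \<nu>)) powr t \<nu> * (\<Prod>i\<in>{1..m \<nu>}. q \<nu> i ^ z \<nu> i))"

lemma psum_measurable [measurable]:
  "psum m \<in> borel_measurable (\<Pi>\<^sub>M i\<in>{1..m}. lborel)"
  unfolding psum_def[abs_def] by measurable

lemma open_simplex_sets [measurable]:
  "open_simplex m \<in> sets (\<Pi>\<^sub>M i\<in>{1..m}. (lborel :: real measure))"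
proof -
  have "open_simplex m = {q \<in> space (\<Pi>\<^sub>M i\<in>{1..m}. (lborel :: real measure)).
      (\<forall>i\<in>{1..m}. 0 < q i) \<and> (\<Sum>i\<in>{1..m}. q i) < 1}"
    by (auto simp: open_simplex_def space_PiM)
  also have "\<dots> \<in> sets (\<Pi>\<^sub>M i\<in>{1..m}. (lborel :: real measure))" by measurable
  finally show ?thesis .
qed

lemma param_space_sets [measurable]:
  "param_space N m \<in> sets (\<Pi>\<^sub>M \<nu>\<in>{1..N}. \<Pi>\<^sub>M i\<in>{1..m \<nu>}. (lborel :: real measure))"
  unfolding param_space_def by (intro sets_PiM_I_finite) auto

lemma space_lebesgue_param: "space (lebesgue_param N m) = param_space N m"
proof -
  have "param_space N m \<subseteq> space (\<Pi>\<^sub>M \<nu>\<in>{1..N}. \<Pi>\<^sub>M i\<in>{1..m \<nu>}. (lborel :: real measure))"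
    using sets.sets_into_space[OF param_space_sets] .
  then show ?thesis by (auto simp: lebesgue_param_def space_restrict_space)
qed

lemma psum_in_unit:
  assumes "1 \<le> m" "q \<in> open_simplex m"
  shows "0 < psum m q" "psum m q < 1"
  using assms by (auto simp: open_simplex_def psum_def intro!: sum_pos)

lemma param_space_unit:
  assumes "q \<in> param_space N m" "\<nu> \<in> {1..N}" "1 \<le> m \<nu>"
  shows "0 < psum (m \<nu>) (q \<nu>)" "psum (m \<nu>) (q \<nu>) < 1"
  using assms psum_in_unit[of "m \<nu>" "q \<nu>"] by (auto simp: param_space_def PiE_def Pi_def)

lemma param_space_pos:
  assumes "q \<in> param_space N m" "\<nu> \<in> {1..N}" "i \<in> {1..m \<nu>}"
  shows "0 < q \<nu> i"
  using assms by (auto simp: param_space_def open_simplex_def PiE_def Pi_def)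

text \<open>
  The pointwise conditions defining the parameter space, without its convention on the values of
  functions outside the index sets.
\<close>

definition interior_point :: "nat \<Rightarrow> (nat \<Rightarrow> nat) \<Rightarrow> (nat \<Rightarrow> nat \<Rightarrow> real) \<Rightarrow> bool" where
  "interior_point N m q \<longleftrightarrow> (\<forall>\<nu>\<in>{1..N}. 0 < psum (m \<nu>) (q \<nu>) \<and> psum (m \<nu>) (q \<nu>) < 1 \<and> (\<forall>i\<in>{1..m \<nu>}. 0 < q \<nu> i))"

lemma param_space_interior_point:
  assumes "q \<in> param_space N m" "\<And>\<nu>. \<nu> \<in> {1..N} \<Longrightarrow> 1 \<le> m \<nu>" "n \<le> N"
  shows "interior_point n m q"
  unfolding interior_point_def
  using assms param_space_unit[OF assms(1)] param_space_pos[OF assms(1)] by auto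

lemma nm_kernel_pos: "interior_point N m q \<Longrightarrow> 0 < nm_kernel N m t z q"
  unfolding nm_kernel_def interior_point_def by (intro prod_pos mult_pos_pos) force+

lemma nm_kernel_le:
  assumes q: "interior_point N m q" and t: "\<And>\<nu>. \<nu> \<in> {1..N} \<Longrightarrow> t0 \<nu> \<le> t \<nu>"
  shows "nm_kernel N m t z q \<le> nm_kernel N m t0 (\<lambda>_ _. 0) q"
  unfolding nm_kernel_def
proof (intro prod_mono conjI)
  fix \<nu> assume \<nu>: "\<nu> \<in> {1..N}"
  have u: "psum (m \<nu>) (q \<nu>) < 1" and pos: "\<And>i. i \<in> {1..m \<nu>} \<Longrightarrow> 0 < q \<nu> i" and u0: "0 < psum (m \<nu>) (q \<nu>)"
    using q \<nu> by (auto simp: interior_point_def)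
  have le1: "q \<nu> i \<le> 1" if "i \<in> {1..m \<nu>}" for i
  proof -
    have "q \<nu> i \<le> psum (m \<nu>) (q \<nu>)"
      unfolding psum_def using pos that by (intro member_le_sum) (auto simp: less_imp_le)
    then show ?thesis using u by linarith
  qed
  have pr: "0 \<le> (\<Prod>i\<in>{1..m \<nu>}. q \<nu> i ^ z \<nu> i)" "(\<Prod>i\<in>{1..m \<nu>}. q \<nu> i ^ z \<nu> i) \<le> 1"
    using pos le1 by (auto intro!: prod_nonneg prod_le_1 power_le_one simp: less_imp_le)
  show "0 \<le> (1 - psum (m \<nu>) (q \<nu>)) powr t \<nu> * (\<Prod>i\<in>{1..m \<nu>}. q \<nu> i ^ z \<nu> i)" using pr by simp
  show "(1 - psum (m \<nu>) (q \<nu>)) powr t \<nu> * (\<Prod>i\<in>{1..m \<nu>}. q \<nu> i ^ z \<nu> i)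
      \<le> (1 - psum (m \<nu>) (q \<nu>)) powr t0 \<nu> * (\<Prod>i\<in>{1..m \<nu>}. q \<nu> i ^ 0)"
    using pr u u0 t[OF \<nu>] by (intro mult_mono powr_mono') auto
qed

lemma measurable_lebesgue_paramI:
  "f \<in> borel_measurable (\<Pi>\<^sub>M \<nu>\<in>{1..N}. \<Pi>\<^sub>M i\<in>{1..m \<nu>}. lborel) \<Longrightarrow> f \<in> borel_measurable (lebesgue_param N m)"
  unfolding lebesgue_param_def by (rule measurable_restrict_space1)

lemma psum_component_measurable:
  assumes "\<nu> \<in> {1..N}"
  shows "(\<lambda>q. psum (m \<nu>) (q \<nu>)) \<in> borel_measurable (lebesgue_param N m)"
  using measurable_compose[OF measurable_component_singleton[OF assms, of "\<lambda>\<nu>. \<Pi>\<^sub>M i\<in>{1..m \<nu>}. lborel"] psum_measurable]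
  by (intro measurable_lebesgue_paramI) simp

lemma coordinate_measurable:
  assumes "\<nu> \<in> {1..N}" "i \<in> {1..m \<nu>}"
  shows "(\<lambda>q. q \<nu> i) \<in> borel_measurable (lebesgue_param N m)"
proof (intro measurable_lebesgue_paramI)
  show "(\<lambda>q. q \<nu> i) \<in> borel_measurable (\<Pi>\<^sub>M \<nu>\<in>{1..N}. \<Pi>\<^sub>M i\<in>{1..m \<nu>}. lborel)"
    using measurable_compose[OF measurable_component_singleton[OF assms(1), of "\<lambda>\<nu>. \<Pi>\<^sub>M i\<in>{1..m \<nu>}. lborel"]
        measurable_component_singleton[OF assms(2), of "\<lambda>_. lborel"]] by simp
qed

lemma nm_kernel_measurable [measurable]:
  "nm_kernel N m t z \<in> borel_measurable (lebesgue_param N m)"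
  unfolding nm_kernel_def[abs_def]
  by (intro borel_measurable_prod borel_measurable_times borel_measurable_power powr_real_measurable
      borel_measurable_diff borel_measurable_const psum_component_measurable coordinate_measurable)

text \<open>
  The factor \<open>halfline_power b (1 - v)\<close> vanishes for \<open>v \<ge> 1\<close>, so it carries the constraint that
  the coordinates add up to less than one.
\<close>

lemma simplex_integral:
  assumes m: "1 \<le> m" and \<alpha>: "\<And>i. i \<in> {1..m} \<Longrightarrow> 0 < \<alpha> i" and [measurable]: "f \<in> borel_measurable borel"
  shows "(\<integral>\<^sup>+ q. indicator (open_simplex m) q * ennreal (\<Prod>i\<in>{1..m}. q i powr (\<alpha> i - 1))
            * (f (psum m q) * halfline_power b (1 - psum m q)) \<partial>(\<Pi>\<^sub>M i\<in>{1..m}. lborel))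
       = ennreal (dirichlet_const {1..m} \<alpha>) *
           (\<integral>\<^sup>+ v. halfline_power (\<Sum>i\<in>{1..m}. \<alpha> i) v * (f v * halfline_power b (1 - v)) \<partial>lborel)"
proof -
  have "(\<integral>\<^sup>+ q. indicator (open_simplex m) q * ennreal (\<Prod>i\<in>{1..m}. q i powr (\<alpha> i - 1))
            * (f (psum m q) * halfline_power b (1 - psum m q)) \<partial>(\<Pi>\<^sub>M i\<in>{1..m}. lborel))
      = (\<integral>\<^sup>+ q. (\<Prod>i\<in>{1..m}. halfline_power (\<alpha> i) (q i)) *
            (f (\<Sum>i\<in>{1..m}. q i) * halfline_power b (1 - (\<Sum>i\<in>{1..m}. q i))) \<partial>(\<Pi>\<^sub>M i\<in>{1..m}. lborel))"
  proof (intro nn_integral_cong)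
    fix q assume q: "q \<in> space (\<Pi>\<^sub>M i\<in>{1..m}. (lborel :: real measure))"
    show "indicator (open_simplex m) q * ennreal (\<Prod>i\<in>{1..m}. q i powr (\<alpha> i - 1))
            * (f (psum m q) * halfline_power b (1 - psum m q))
        = (\<Prod>i\<in>{1..m}. halfline_power (\<alpha> i) (q i)) *
            (f (\<Sum>i\<in>{1..m}. q i) * halfline_power b (1 - (\<Sum>i\<in>{1..m}. q i)))"
    proof (cases "(\<Sum>i\<in>{1..m}. q i) < 1")
      case less: True
      show ?thesis
      proof (cases "\<forall>i\<in>{1..m}. 0 < q i")
        case True
        then have "q \<in> open_simplex m" using q less by (auto simp: open_simplex_def space_PiM)
        moreover have "ennreal (\<Prod>i\<in>{1..m}. q i powr (\<alpha> i - 1)) = (\<Prod>i\<in>{1..m}. halfline_power (\<alpha> i) (q i))"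
          using True by (subst prod_ennreal[symmetric]) (auto simp: halfline_power_def intro!: prod.cong)
        ultimately show ?thesis by (simp add: psum_def)
      next
        case False
        then have "q \<notin> open_simplex m" by (auto simp: open_simplex_def)
        moreover have "(\<Prod>i\<in>{1..m}. halfline_power (\<alpha> i) (q i)) = 0"
          using False by (auto simp: halfline_power_def prod_zero_iff indicator_def)
        ultimately show ?thesis by simp
      qed
    next
      case False
      then show ?thesis by (simp add: psum_def halfline_power_def)
    qed
  qed
  also have "\<dots> = ennreal (dirichlet_const {1..m} \<alpha>) *
           (\<integral>\<^sup>+ v. halfline_power (\<Sum>i\<in>{1..m}. \<alpha> i) v * (f v * halfline_power b (1 - v)) \<partial>lborel)"
    using m \<alpha> by (intro Liouville_Dirichlet) auto
  finally show ?thesis .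
qed

text \<open>
  The part of a kernel mass that sees more of the counts than their totals.
\<close>

definition prior_const :: "nat \<Rightarrow> (nat \<Rightarrow> nat) \<Rightarrow> (nat \<Rightarrow> nat \<Rightarrow> real) \<Rightarrow> (nat \<Rightarrow> nat \<Rightarrow> nat) \<Rightarrow> real" where
  "prior_const N m a z = (\<Prod>\<nu>\<in>{1..N}. dirichlet_const {1..m \<nu>} (\<lambda>i. a \<nu> i + real (z \<nu> i)))"

text \<open>
  Density and kernel factor over the blocks, and in each block the counts only shift the exponents
  of the Dirichlet density. The block sums enter through \<open>totals m z \<nu> + k \<nu>\<close> alone, so an extra
  power of a block sum acts like additional counts.
\<close>

lemma dirichlet_prior_integral:
  assumes m: "\<And>\<nu>. \<nu> \<in> {1..N} \<Longrightarrow> 1 \<le> m \<nu>"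
    and a: "\<And>\<nu> i. \<nu> \<in> {1..N} \<Longrightarrow> i \<in> {1..m \<nu>} \<Longrightarrow> 0 < a \<nu> i"
  shows "(\<integral>\<^sup>+ q. dirichlet_prior N m c a q *
            ennreal (nm_kernel N m t z q * (\<Prod>\<nu>\<in>{1..N}. psum (m \<nu>) (q \<nu>) ^ k \<nu>)) \<partial>lebesgue_param N m)
       = ennreal (prior_const N m a z) *
         (\<Prod>\<nu>\<in>{1..N}. \<integral>\<^sup>+ v. halfline_power (psum (m \<nu>) (a \<nu>) + real (totals m z \<nu> + k \<nu>)) v
                             * halfline_power (c \<nu> + t \<nu>) (1 - v) \<partial>lborel)"
proof -
  let ?v = "\<lambda>q \<nu>. psum (m \<nu>) (q \<nu>)"
  let ?L = "\<lambda>\<nu>. \<Pi>\<^sub>M i\<in>{1..m \<nu>}. (lborel :: real measure)"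
  let ?K = "\<lambda>q. nm_kernel N m t z q * (\<Prod>\<nu>\<in>{1..N}. ?v q \<nu> ^ k \<nu>)"
  let ?d = "\<lambda>q \<nu>. (1 - ?v q \<nu>) powr (c \<nu> - 1) * (\<Prod>i\<in>{1..m \<nu>}. q \<nu> i powr (a \<nu> i - 1))"
  let ?k = "\<lambda>q \<nu>. (1 - ?v q \<nu>) powr t \<nu> * (\<Prod>i\<in>{1..m \<nu>}. q \<nu> i ^ z \<nu> i) * ?v q \<nu> ^ k \<nu>"
  let ?\<alpha> = "\<lambda>\<nu> i. a \<nu> i + real (z \<nu> i)"
  define blk where "blk = (\<lambda>\<nu> q. indicator (open_simplex (m \<nu>)) q *
      ennreal (\<Prod>i\<in>{1..m \<nu>}. q i powr (?\<alpha> \<nu> i - 1))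
        * (ennreal (psum (m \<nu>) q ^ k \<nu>) * halfline_power (c \<nu> + t \<nu>) (1 - psum (m \<nu>) q)))"
  have sf: "sigma_finite_measure (?L \<nu>)" for \<nu>
  proof -
    interpret finite_product_sigma_finite "\<lambda>_. lborel :: real measure" "{1..m \<nu>}" by standard auto
    show ?thesis by unfold_locales
  qed
  interpret P: product_sigma_finite ?L
    by (rule product_sigma_finite.intro) (rule sf)
  have "(\<integral>\<^sup>+ q. dirichlet_prior N m c a q * ennreal (?K q) \<partial>lebesgue_param N m)
      = (\<integral>\<^sup>+ q. dirichlet_prior N m c a q * ennreal (?K q) * indicator (param_space N m) q \<partial>(\<Pi>\<^sub>M \<nu>\<in>{1..N}. ?L \<nu>))"
    unfolding lebesgue_param_def
    using sets.sets_into_space[OF param_space_sets[of N m]]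
    by (subst nn_integral_restrict_space) (auto simp: Int_absorb1 Int_absorb2)
  also have "\<dots> = (\<integral>\<^sup>+ q. (\<Prod>\<nu>\<in>{1..N}. blk \<nu> (q \<nu>)) \<partial>(\<Pi>\<^sub>M \<nu>\<in>{1..N}. ?L \<nu>))"
  proof (intro nn_integral_cong)
    fix q assume q: "q \<in> space (\<Pi>\<^sub>M \<nu>\<in>{1..N}. ?L \<nu>)"
    show "dirichlet_prior N m c a q * ennreal (?K q) * indicator (param_space N m) q = (\<Prod>\<nu>\<in>{1..N}. blk \<nu> (q \<nu>))"
    proof (cases "q \<in> param_space N m")
      case False
      then obtain \<nu> where "\<nu> \<in> {1..N}" "q \<nu> \<notin> open_simplex (m \<nu>)"
        using q by (auto simp: param_space_def space_PiM PiE_def Pi_def)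
      then have "(\<Prod>\<nu>\<in>{1..N}. blk \<nu> (q \<nu>)) = 0"
        by (intro prod_zero finite_atLeastAtMost bexI[of _ \<nu>]) (auto simp: blk_def)
      then show ?thesis using False by simp
    next
      case True
      note pos = param_space_pos[OF True] and unit = param_space_unit[OF True _ m]
      have nn: "0 \<le> ?d q \<nu>" "0 \<le> ?k q \<nu>" if "\<nu> \<in> {1..N}" for \<nu>
        using pos[OF that] unit[OF that that]
        by (auto intro!: mult_nonneg_nonneg prod_nonneg simp: less_imp_le)
      have "?K q = (\<Prod>\<nu>\<in>{1..N}. ?k q \<nu>)" by (simp only: nm_kernel_def prod.distrib)
      then have "dirichlet_prior N m c a q * ennreal (?K q) = ennreal ((\<Prod>\<nu>\<in>{1..N}. ?d q \<nu>) * (\<Prod>\<nu>\<in>{1..N}. ?k q \<nu>))"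
        unfolding dirichlet_prior_def using nn(1) by (subst ennreal_mult') (simp_all add: prod_nonneg)
      also have "\<dots> = (\<Prod>\<nu>\<in>{1..N}. ennreal (?d q \<nu> * ?k q \<nu>))"
        using nn by (subst prod_ennreal) (simp_all add: prod.distrib)
      also have "\<dots> = (\<Prod>\<nu>\<in>{1..N}. blk \<nu> (q \<nu>))"
      proof (intro prod.cong refl)
        fix \<nu> assume \<nu>: "\<nu> \<in> {1..N}"
        have ind: "q \<nu> \<in> open_simplex (m \<nu>)" using True \<nu> by (auto simp: param_space_def)
        have e1: "(\<Prod>i\<in>{1..m \<nu>}. q \<nu> i powr (?\<alpha> \<nu> i - 1))
            = (\<Prod>i\<in>{1..m \<nu>}. q \<nu> i powr (a \<nu> i - 1)) * (\<Prod>i\<in>{1..m \<nu>}. q \<nu> i ^ z \<nu> i)"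
          unfolding prod.distrib[symmetric]
        proof (intro prod.cong refl)
          fix i assume "i \<in> {1..m \<nu>}"
          then have "0 < q \<nu> i" using pos \<nu> by auto
          then show "q \<nu> i powr (?\<alpha> \<nu> i - 1) = q \<nu> i powr (a \<nu> i - 1) * q \<nu> i ^ z \<nu> i"
            by (simp add: powr_realpow[symmetric] powr_add[symmetric] algebra_simps)
        qed
        have e2: "(1 - ?v q \<nu>) powr (c \<nu> + t \<nu> - 1) = (1 - ?v q \<nu>) powr (c \<nu> - 1) * (1 - ?v q \<nu>) powr t \<nu>"
          by (simp add: powr_add[symmetric] algebra_simps)
        have n0: "0 \<le> (\<Prod>i\<in>{1..m \<nu>}. q \<nu> i powr (a \<nu> i - 1)) * (\<Prod>i\<in>{1..m \<nu>}. q \<nu> i ^ z \<nu> i)"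
          using pos \<nu> by (intro mult_nonneg_nonneg prod_nonneg) (auto intro: less_imp_le)
        show "ennreal (?d q \<nu> * ?k q \<nu>) = blk \<nu> (q \<nu>)"
          using ind unit[OF \<nu> \<nu>] n0 unfolding blk_def e1 halfline_power_def e2
          by (simp add: ennreal_mult'[symmetric] ennreal_mult''[symmetric] mult_ac)
      qed
      finally show ?thesis using True by simp
    qed
  qed
  also have "\<dots> = (\<Prod>\<nu>\<in>{1..N}. integral\<^sup>N (?L \<nu>) (blk \<nu>))"
    unfolding blk_def by (intro P.product_nn_integral_prod) measurable
  also have "\<dots> = (\<Prod>\<nu>\<in>{1..N}. ennreal (dirichlet_const {1..m \<nu>} (?\<alpha> \<nu>)) *
        (\<integral>\<^sup>+ v. halfline_power (psum (m \<nu>) (a \<nu>) + real (totals m z \<nu> + k \<nu>)) v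
                             * halfline_power (c \<nu> + t \<nu>) (1 - v) \<partial>lborel))"
  proof (intro prod.cong refl)
    fix \<nu> assume \<nu>: "\<nu> \<in> {1..N}"
    have "integral\<^sup>N (?L \<nu>) (blk \<nu>) = ennreal (dirichlet_const {1..m \<nu>} (?\<alpha> \<nu>)) *
           (\<integral>\<^sup>+ v. halfline_power (\<Sum>i\<in>{1..m \<nu>}. ?\<alpha> \<nu> i) v * (ennreal (v ^ k \<nu>) * halfline_power (c \<nu> + t \<nu>) (1 - v)) \<partial>lborel)"
      unfolding blk_def by (rule simplex_integral[OF m[OF \<nu>]])
        (use a \<nu> in \<open>auto intro: add_pos_nonneg\<close>)
    moreover have "halfline_power (\<Sum>i\<in>{1..m \<nu>}. ?\<alpha> \<nu> i) v * ennreal (v ^ k \<nu>)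
          = halfline_power (psum (m \<nu>) (a \<nu>) + real (totals m z \<nu> + k \<nu>)) v" for v
      by (auto simp: halfline_power_def indicator_def psum_def totals_def sum.distrib
            ennreal_mult'[symmetric] powr_realpow[symmetric] powr_add[symmetric] algebra_simps)
    ultimately show "integral\<^sup>N (?L \<nu>) (blk \<nu>) = ennreal (dirichlet_const {1..m \<nu>} (?\<alpha> \<nu>)) *
        (\<integral>\<^sup>+ v. halfline_power (psum (m \<nu>) (a \<nu>) + real (totals m z \<nu> + k \<nu>)) v
                             * halfline_power (c \<nu> + t \<nu>) (1 - v) \<partial>lborel)"
      by (simp only: mult.assoc[symmetric])
  qed
  also have "\<dots> = ennreal (prior_const N m a z) *
         (\<Prod>\<nu>\<in>{1..N}. \<integral>\<^sup>+ v. halfline_power (psum (m \<nu>) (a \<nu>) + real (totals m z \<nu> + k \<nu>)) v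
                             * halfline_power (c \<nu> + t \<nu>) (1 - v) \<partial>lborel)"
    unfolding prod.distrib prior_const_def
    by (subst prod_ennreal) (auto intro!: less_imp_le[OF dirichlet_const_pos] add_pos_nonneg a simp: m)
  finally show ?thesis .
qed

section \<open>Differentiation under the integral sign and domination\<close>

lemma expectation_eq_count_space:
  fixes f :: "'a \<Rightarrow> real"
  shows "measure_pmf.expectation p f = (\<integral>x. pmf p x * f x \<partial>count_space UNIV)"
  unfolding measure_pmf_eq_density by (subst integral_density) auto

lemma integrable_pmf_iff_count_space:
  fixes f :: "'a \<Rightarrow> real"
  shows "integrable (measure_pmf p) f \<longleftrightarrow> integrable (count_space UNIV) (\<lambda>x. pmf p x * f x)"
  unfolding measure_pmf_eq_density by (subst integrable_density) auto

lemma integrable_pmf_count_space: "integrable (count_space UNIV) (pmf p)"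
  using integrable_pmf_iff_count_space[of p "\<lambda>_. 1"] by simp

text \<open>
  The mean value inequality bounds the difference quotients by \<open>B\<close>, so dominated convergence
  applies along every sequence.
\<close>

lemma has_derivative_integral_dominated:
  fixes f f' :: "real \<Rightarrow> 'a \<Rightarrow> real"
  assumes S: "convex S" "\<tau> \<in> S"
    and int: "\<And>\<tau>. \<tau> \<in> S \<Longrightarrow> integrable M (f \<tau>)"
    and der: "\<And>x \<tau>. x \<in> space M \<Longrightarrow> \<tau> \<in> S \<Longrightarrow> ((\<lambda>\<tau>. f \<tau> x) has_real_derivative f' \<tau> x) (at \<tau> within S)"
    and meas: "f' \<tau> \<in> borel_measurable M"
    and bnd: "\<And>x \<tau>. x \<in> space M \<Longrightarrow> \<tau> \<in> S \<Longrightarrow> \<bar>f' \<tau> x\<bar> \<le> B x"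
    and B: "integrable M B"
  shows "((\<lambda>\<tau>. \<integral>x. f \<tau> x \<partial>M) has_real_derivative (\<integral>x. f' \<tau> x \<partial>M)) (at \<tau> within S)"
  unfolding has_field_derivative_iff tendsto_at_iff_sequentially
proof (intro allI impI)
  fix X :: "nat \<Rightarrow> real" assume X: "\<forall>i. X i \<in> S - {\<tau>}" "X \<longlonglongrightarrow> \<tau>"
  define g where "g = (\<lambda>i x. (f (X i) x - f \<tau> x) / (X i - \<tau>))"
  have "(\<lambda>i. \<integral>x. g i x \<partial>M) \<longlonglongrightarrow> (\<integral>x. f' \<tau> x \<partial>M)"
  proof (rule integral_dominated_convergence[where w = B])
    show "g i \<in> borel_measurable M" for i
      unfolding g_def using int[of "X i"] int[OF S(2)] X(1)
      by (intro borel_measurable_divide borel_measurable_diff borel_measurable_integrable) auto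
    show "AE x in M. (\<lambda>i. g i x) \<longlonglongrightarrow> f' \<tau> x"
    proof (intro AE_I2)
      fix x assume "x \<in> space M"
      from der[OF this S(2)] X show "(\<lambda>i. g i x) \<longlonglongrightarrow> f' \<tau> x"
        unfolding has_field_derivative_iff tendsto_at_iff_sequentially by (auto simp: g_def o_def)
    qed
    show "AE x in M. norm (g i x) \<le> B x" for i
    proof (intro AE_I2)
      fix x assume x: "x \<in> space M"
      have "norm (f (X i) x - f \<tau> x) \<le> B x * norm (X i - \<tau>)"
        by (rule field_differentiable_bound[OF S(1), where f' = "\<lambda>\<tau>. f' \<tau> x"])
           (use der[OF x] bnd[OF x] X(1) S(2) in auto)
      moreover have "X i \<noteq> \<tau>" using X(1) by auto
      ultimately show "norm (g i x) \<le> B x" by (simp add: g_def field_simps abs_divide)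
    qed
  qed (use meas B in auto)
  moreover have "(\<integral>x. g i x \<partial>M) = ((\<integral>x. f (X i) x \<partial>M) - (\<integral>x. f \<tau> x \<partial>M)) / (X i - \<tau>)" for i
    unfolding g_def using int[of "X i"] int[OF S(2)] X(1) by simp
  ultimately show "((\<lambda>y. ((\<integral>x. f y x \<partial>M) - (\<integral>x. f \<tau> x \<partial>M)) / (y - \<tau>)) \<circ> X) \<longlonglongrightarrow> (\<integral>x. f' \<tau> x \<partial>M)"
    by (simp add: o_def)
qed

lemma continuous_on_integral_dominated:
  fixes f :: "real \<Rightarrow> 'a \<Rightarrow> real"
  assumes meas: "\<And>\<tau>. \<tau> \<in> S \<Longrightarrow> f \<tau> \<in> borel_measurable M"
    and cont: "\<And>x. x \<in> space M \<Longrightarrow> continuous_on S (\<lambda>\<tau>. f \<tau> x)"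
    and bnd: "\<And>x \<tau>. x \<in> space M \<Longrightarrow> \<tau> \<in> S \<Longrightarrow> \<bar>f \<tau> x\<bar> \<le> B x"
    and B: "integrable M B"
  shows "continuous_on S (\<lambda>\<tau>. \<integral>x. f \<tau> x \<partial>M)"
  unfolding continuous_on_sequentially
proof (intro allI ballI impI)
  fix X :: "nat \<Rightarrow> real" and \<tau> assume X: "\<tau> \<in> S" "(\<forall>n. X n \<in> S) \<and> X \<longlonglongrightarrow> \<tau>"
  have "(\<lambda>i. \<integral>x. f (X i) x \<partial>M) \<longlonglongrightarrow> (\<integral>x. f \<tau> x \<partial>M)"
  proof (rule integral_dominated_convergence[where w = B])
    show "AE x in M. (\<lambda>i. f (X i) x) \<longlonglongrightarrow> f \<tau> x"
      using cont X unfolding continuous_on_sequentially by (auto simp: o_def)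
  qed (use meas B X bnd in auto)
  then show "((\<lambda>\<tau>. \<integral>x. f \<tau> x \<partial>M) \<circ> X) \<longlonglongrightarrow> (\<integral>x. f \<tau> x \<partial>M)" by (simp add: o_def)
qed

text \<open>
  Some set \<open>{x. 1 / (i + 1) \<le> f x}\<close> has positive mass, and on it \<open>f ^ k\<close> decays only
  exponentially in \<open>k\<close>.
\<close>

lemma nn_integral_powr_lower_bound:
  fixes f :: "'a \<Rightarrow> real"
  assumes [measurable]: "f \<in> borel_measurable M" and pos: "\<And>x. x \<in> space M \<Longrightarrow> 0 < f x"
    and M: "emeasure M (space M) \<noteq> 0"
  shows "\<exists>C\<ge>0. \<forall>k\<ge>0. ennreal (exp (- C * (1 + k))) \<le> (\<integral>\<^sup>+ x. ennreal (f x powr k) \<partial>M)"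
proof -
  define A where "A = (\<lambda>i :: nat. {x \<in> space M. 1 / real (Suc i) \<le> f x})"
  have A [measurable]: "A i \<in> sets M" for i unfolding A_def by measurable
  have "(\<Union>i. A i) = space M"
  proof safe
    fix x assume x: "x \<in> space M"
    obtain i where "inverse (real (Suc i)) < f x" using reals_Archimedean[OF pos[OF x]] by auto
    then show "x \<in> (\<Union>i. A i)" using x by (auto simp: A_def inverse_eq_divide intro!: exI[of _ i])
  qed (auto simp: A_def)
  then obtain i where i: "emeasure M (A i) \<noteq> 0"
    using M A emeasure_UN_eq_0[where N = A and M = M] by (metis image_subsetI)
  obtain c where c: "0 < c" "ennreal c \<le> emeasure M (A i)"
  proof (cases "emeasure M (A i)")
    case (real c)
    then show ?thesis using that[of c] i by (cases "c = 0") auto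
  next
    case top
    then show ?thesis using that[of 1] by auto
  qed
  define C where "C = \<bar>ln c\<bar> + ln (real (Suc i))"
  have C: "0 \<le> C" "\<bar>ln c\<bar> \<le> C" "ln (real (Suc i)) \<le> C" by (auto simp: C_def)
  show ?thesis
  proof (intro exI[of _ C] conjI allI impI C)
    fix k :: real assume k: "0 \<le> k"
    have "ln (real (Suc i)) * k \<le> C * k" using C k by (intro mult_right_mono)
    then have "- C * (1 + k) \<le> ln c - k * ln (real (Suc i))"
      using C by (simp add: algebra_simps)
    then have "exp (- C * (1 + k)) \<le> exp (ln c - k * ln (real (Suc i)))" by simp
    also have "\<dots> = (1 / real (Suc i)) powr k * c"
      using c by (simp add: exp_diff powr_def ln_div exp_minus field_simps)
    finally have "ennreal (exp (- C * (1 + k))) \<le> ennreal ((1 / real (Suc i)) powr k) * ennreal c"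
      using c by (simp add: ennreal_mult'[symmetric] ennreal_leI)
    also have "\<dots> \<le> ennreal ((1 / real (Suc i)) powr k) * emeasure M (A i)"
      using c by (intro mult_left_mono) auto
    also have "\<dots> = (\<integral>\<^sup>+ x. ennreal ((1 / real (Suc i)) powr k) * indicator (A i) x \<partial>M)"
      by (simp add: nn_integral_cmult_indicator)
    also have "\<dots> \<le> (\<integral>\<^sup>+ x. ennreal (f x powr k) \<partial>M)"
      using k by (intro nn_integral_mono) (auto simp: A_def indicator_def intro!: ennreal_leI powr_mono2)
    finally show "ennreal (exp (- C * (1 + k))) \<le> (\<integral>\<^sup>+ x. ennreal (f x powr k) \<partial>M)" .
  qed
qed

text \<open>
  All factors are at least the product of the \<open>g i\<close>, because each of them is at most one; this
  reduces the claim to powers of a single function.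
\<close>

lemma nn_integral_prod_powr_lower_bound:
  fixes g :: "'i \<Rightarrow> 'a \<Rightarrow> real"
  assumes I: "finite I" and g [measurable]: "\<And>i. i \<in> I \<Longrightarrow> g i \<in> borel_measurable M"
    and unit: "\<And>i x. i \<in> I \<Longrightarrow> x \<in> space M \<Longrightarrow> 0 < g i x \<and> g i x \<le> 1"
    and M: "emeasure M (space M) \<noteq> 0"
  shows "\<exists>C\<ge>0. \<forall>e. (\<forall>i\<in>I. 0 \<le> e i) \<longrightarrow>
    ennreal (exp (- C * (1 + (\<Sum>i\<in>I. e i)))) \<le> (\<integral>\<^sup>+ x. ennreal (\<Prod>i\<in>I. g i x powr e i) \<partial>M)"
proof -
  define f where "f = (\<lambda>x. \<Prod>i\<in>I. g i x)"
  have fpos: "0 < f x" if "x \<in> space M" for x unfolding f_def using unit that by (intro prod_pos) auto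
  have fle: "f x \<le> g i x" if "x \<in> space M" "i \<in> I" for x i
  proof -
    have "(\<Prod>j\<in>I - {i}. g j x) \<le> 1" using unit that by (intro prod_le_1) (auto intro: less_imp_le)
    then show ?thesis
      unfolding f_def using unit[OF that(2,1)] that I by (subst prod.remove[of _ i]) (auto intro!: mult_left_le)
  qed
  have "f \<in> borel_measurable M" unfolding f_def by measurable
  from nn_integral_powr_lower_bound[OF this fpos M] obtain C where
    C: "0 \<le> C" "\<And>k. 0 \<le> k \<Longrightarrow> ennreal (exp (- C * (1 + k))) \<le> (\<integral>\<^sup>+ x. ennreal (f x powr k) \<partial>M)"
    by auto
  show ?thesis
  proof (intro exI[of _ C] conjI allI impI C)
    fix e :: "'i \<Rightarrow> real" assume e: "\<forall>i\<in>I. 0 \<le> e i"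
    then have "ennreal (exp (- C * (1 + (\<Sum>i\<in>I. e i)))) \<le> (\<integral>\<^sup>+ x. ennreal (f x powr (\<Sum>i\<in>I. e i)) \<partial>M)"
      by (intro C(2) sum_nonneg) auto
    also have "\<dots> \<le> (\<integral>\<^sup>+ x. ennreal (\<Prod>i\<in>I. g i x powr e i) \<partial>M)"
    proof (intro nn_integral_mono ennreal_leI)
      fix x assume x: "x \<in> space M"
      have "f x powr (\<Sum>i\<in>I. e i) = (\<Prod>i\<in>I. f x powr e i)"
        using fpos[OF x] I by (simp add: powr_sum)
      also have "\<dots> \<le> (\<Prod>i\<in>I. g i x powr e i)"
        using fpos[OF x] fle[OF x] e by (intro prod_mono) (auto intro!: powr_mono2)
      finally show "f x powr (\<Sum>i\<in>I. e i) \<le> (\<Prod>i\<in>I. g i x powr e i)" .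
    qed
    finally show "ennreal (exp (- C * (1 + (\<Sum>i\<in>I. e i)))) \<le> (\<integral>\<^sup>+ x. ennreal (\<Prod>i\<in>I. g i x powr e i) \<partial>M)" .
  qed
qed

definition grand_total :: "nat \<Rightarrow> (nat \<Rightarrow> nat) \<Rightarrow> real" where
  "grand_total N z = real (\<Sum>\<nu>\<in>{1..N}. z \<nu>)"

lemma grand_total_nonneg [simp]: "0 \<le> grand_total N \<zeta>"
  unfolding grand_total_def by (rule of_nat_0_le_iff)

lemma square_times_geometric_bounded:
  fixes \<theta> :: real
  assumes "0 \<le> \<theta>" "\<theta> < 1"
  shows "\<exists>B\<ge>0. \<forall>k. (1 + real k)\<^sup>2 * \<theta> ^ k \<le> B"
proof -
  \<comment> \<open>One factor \<open>x ^ k\<close> goes with each of the two linear factors.\<close>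
  define x where "x = sqrt \<theta>"
  have x: "0 \<le> x" "x < 1" "x\<^sup>2 = \<theta>" using assms by (auto simp: x_def)
  have "(\<lambda>k. real k * x ^ k + x ^ k) \<longlonglongrightarrow> 0 + 0"
    using x by (intro tendsto_add powser_times_n_limit_0 LIMSEQ_realpow_zero) auto
  then have "Bseq (\<lambda>k. real k * x ^ k + x ^ k)" by (intro convergent_imp_Bseq convergentI)
  then obtain K where K: "\<And>k. \<bar>real k * x ^ k + x ^ k\<bar> \<le> K" unfolding Bseq_def real_norm_def by blast
  show ?thesis
  proof (intro exI[of _ "K\<^sup>2"] conjI allI)
    fix k
    have "(1 + real k)\<^sup>2 * \<theta> ^ k = (real k * x ^ k + x ^ k)\<^sup>2"
    proof -
      have "\<theta> ^ k = (x ^ k)\<^sup>2" by (metis x(3) power_mult mult.commute)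
      moreover have "real k * x ^ k + x ^ k = (1 + real k) * x ^ k" by (simp add: algebra_simps)
      ultimately show ?thesis by (simp only: power_mult_distrib)
    qed
    also have "\<dots> \<le> K\<^sup>2" using power_mono[OF K[of k], of 2] by (simp only: power2_abs)
    finally show "(1 + real k)\<^sup>2 * \<theta> ^ k \<le> K\<^sup>2" .
  qed auto
qed

text \<open>
  Raising the probabilities to a common \<open>\<rho> > P \<nu>\<close> and the parameters to \<open>T\<close> leaves a geometric
  factor \<open>\<theta> ^ \<bar>z\<bar>\<close> with \<open>\<theta> < 1\<close> to spare, which absorbs the polynomial.
\<close>

lemma nb_product_dominated:
  assumes P: "\<And>\<nu>. \<nu> \<in> {1..N} \<Longrightarrow> 0 < P \<nu> \<and> P \<nu> < 1"
    and T: "\<And>\<nu>. \<nu> \<in> {1..N} \<Longrightarrow> 0 < T \<nu>"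
  shows "\<exists>C Q. 0 \<le> C \<and> (\<forall>t z. (\<forall>\<nu>\<in>{1..N}. 0 < t \<nu> \<and> t \<nu> \<le> T \<nu>) \<longrightarrow>
           (1 + grand_total N z)\<^sup>2 * pmf (nb_product N t P) z \<le> C * pmf Q z)"
proof -
  define pm where "pm = Max (insert 0 (P ` {1..N}))"
  have pm: "pm < 1" "0 \<le> pm" "\<And>\<nu>. \<nu> \<in> {1..N} \<Longrightarrow> P \<nu> \<le> pm"
    unfolding pm_def using P by (simp, intro Max_ge, simp, simp, intro Max_ge, simp, simp)
  define \<rho> where "\<rho> = (1 + pm) / 2"
  have \<rho>: "0 < \<rho>" "\<rho> < 1" "pm < \<rho>" using pm by (auto simp: \<rho>_def)
  define \<theta> where "\<theta> = pm / \<rho>"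
  have \<theta>: "0 \<le> \<theta>" "\<theta> < 1" using pm \<rho> by (auto simp: \<theta>_def)
  obtain B where B: "0 \<le> B" "\<And>k. (1 + real k)\<^sup>2 * \<theta> ^ k \<le> B"
    using square_times_geometric_bounded[OF \<theta>] by auto
  define Q where "Q = nb_product N T (\<lambda>_. \<rho>)"
  define K where "K = (\<Prod>\<nu>\<in>{1..N}. (1 - \<rho>) powr (- T \<nu>))"
  have K: "0 \<le> K" unfolding K_def by (intro prod_nonneg) auto
  show ?thesis
  proof (intro exI[of _ "B * K"] exI[of _ Q] conjI allI impI)
    show "0 \<le> B * K" using B K by simp
    fix t :: "nat \<Rightarrow> real" and z :: "nat \<Rightarrow> nat" assume t: "\<forall>\<nu>\<in>{1..N}. 0 < t \<nu> \<and> t \<nu> \<le> T \<nu>"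
    show "(1 + grand_total N z)\<^sup>2 * pmf (nb_product N t P) z \<le> B * K * pmf Q z"
    proof (cases "\<forall>\<nu>. \<nu> \<notin> {1..N} \<longrightarrow> z \<nu> = 0")
      case False
      then have "pmf (nb_product N t P) z = 0" unfolding nb_product_def by (intro pmf_Pi_outside) auto
      then show ?thesis using B K by simp
    next
      case True
      have "pmf (nb_product N t P) z = (\<Prod>\<nu>\<in>{1..N}. nb_mass (t \<nu>) (P \<nu>) (z \<nu>))"
        unfolding nb_product_def using True t P
        by (subst pmf_Pi') (auto intro!: prod.cong pmf_nb simp: order_less_imp_le)
      also have "\<dots> \<le> (\<Prod>\<nu>\<in>{1..N}. (1 - \<rho>) powr (- T \<nu>) * \<theta> ^ z \<nu> * nb_mass (T \<nu>) \<rho> (z \<nu>))"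
      proof (intro prod_mono conjI)
        fix \<nu> assume \<nu>: "\<nu> \<in> {1..N}"
        have t\<nu>: "0 < t \<nu>" "t \<nu> \<le> T \<nu>" and P\<nu>: "0 \<le> P \<nu>" "P \<nu> < 1" and T\<nu>: "0 < T \<nu>"
          using t P[OF \<nu>] T[OF \<nu>] \<nu> by auto
        show "0 \<le> nb_mass (t \<nu>) (P \<nu>) (z \<nu>)" by (rule nb_mass_nonneg[OF t\<nu>(1) P\<nu>(1)])
        have p1: "pochhammer (t \<nu>) (z \<nu>) \<le> pochhammer (T \<nu>) (z \<nu>)"
          unfolding pochhammer_prod using t\<nu> by (intro prod_mono) auto
        have p2: "(1 - P \<nu>) powr t \<nu> \<le> 1" using P\<nu> t\<nu> by (intro powr_le1) auto
        have p3: "P \<nu> ^ z \<nu> \<le> pm ^ z \<nu>" using P\<nu> pm(3)[OF \<nu>] by (intro power_mono) auto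
        have p4: "0 \<le> pochhammer (T \<nu>) (z \<nu>)" by (rule pochhammer_nonneg[OF T\<nu>])
        have "nb_mass (t \<nu>) (P \<nu>) (z \<nu>) \<le> pochhammer (T \<nu>) (z \<nu>) / fact (z \<nu>) * pm ^ z \<nu> * 1"
          unfolding nb_mass_def using p1 p2 p3 p4 pm(2) P\<nu>
          by (intro mult_mono divide_right_mono mult_nonneg_nonneg divide_nonneg_nonneg) simp_all
        also have "\<dots> = (1 - \<rho>) powr (- T \<nu>) * \<theta> ^ z \<nu> * nb_mass (T \<nu>) \<rho> (z \<nu>)"
        proof -
          have "(1 - \<rho>) powr (- T \<nu>) * (1 - \<rho>) powr T \<nu> = 1" using \<rho> by (simp add: powr_add[symmetric])
          moreover have "\<theta> ^ z \<nu> * \<rho> ^ z \<nu> = pm ^ z \<nu>"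
            using \<rho> by (simp add: \<theta>_def power_mult_distrib[symmetric])
          moreover have "(1 - \<rho>) powr (- T \<nu>) * \<theta> ^ z \<nu> * nb_mass (T \<nu>) \<rho> (z \<nu>)
              = pochhammer (T \<nu>) (z \<nu>) / fact (z \<nu>) * (\<theta> ^ z \<nu> * \<rho> ^ z \<nu>)
                * ((1 - \<rho>) powr (- T \<nu>) * (1 - \<rho>) powr T \<nu>)"
            unfolding nb_mass_def by (simp only: mult_ac)
          ultimately show ?thesis by simp
        qed
        finally show "nb_mass (t \<nu>) (P \<nu>) (z \<nu>) \<le> (1 - \<rho>) powr (- T \<nu>) * \<theta> ^ z \<nu> * nb_mass (T \<nu>) \<rho> (z \<nu>)" .
      qed
      also have "\<dots> = K * \<theta> ^ (\<Sum>\<nu>\<in>{1..N}. z \<nu>) * (\<Prod>\<nu>\<in>{1..N}. nb_mass (T \<nu>) \<rho> (z \<nu>))"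
        by (simp add: prod.distrib K_def power_sum)
      also have "(\<Prod>\<nu>\<in>{1..N}. nb_mass (T \<nu>) \<rho> (z \<nu>)) = pmf Q z"
        unfolding Q_def nb_product_def using True T \<rho>
        by (subst pmf_Pi') (auto intro!: prod.cong simp: pmf_nb)
      finally have "(1 + grand_total N z)\<^sup>2 * pmf (nb_product N t P) z
          \<le> (1 + grand_total N z)\<^sup>2 * (K * \<theta> ^ (\<Sum>\<nu>\<in>{1..N}. z \<nu>) * pmf Q z)"
        by (intro mult_left_mono) auto
      also have "\<dots> = ((1 + grand_total N z)\<^sup>2 * \<theta> ^ (\<Sum>\<nu>\<in>{1..N}. z \<nu>)) * (K * pmf Q z)" by (simp add: mult_ac)
      also have "\<dots> \<le> B * (K * pmf Q z)"
        unfolding grand_total_def using K by (intro mult_right_mono B) auto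
      finally show ?thesis by (simp add: mult_ac)
    qed
  qed
qed

lemma nb_product_integrable:
  fixes f :: "(nat \<Rightarrow> nat) \<Rightarrow> real"
  assumes P: "\<And>\<nu>. \<nu> \<in> {1..N} \<Longrightarrow> 0 < P \<nu> \<and> P \<nu> < 1"
    and t: "\<And>\<nu>. \<nu> \<in> {1..N} \<Longrightarrow> 0 < t \<nu>"
    and f: "\<And>z. \<bar>f z\<bar> \<le> C * (1 + grand_total N z)\<^sup>2"
  shows "integrable (nb_product N t P) f"
proof -
  obtain B Q where B: "\<And>z. (1 + grand_total N z)\<^sup>2 * pmf (nb_product N t P) z \<le> B * pmf Q z"
  proof -
    have "\<exists>B Q. 0 \<le> B \<and> (\<forall>t' z. (\<forall>\<nu>\<in>{1..N}. 0 < t' \<nu> \<and> t' \<nu> \<le> t \<nu>) \<longrightarrow>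
           (1 + grand_total N z)\<^sup>2 * pmf (nb_product N t' P) z \<le> B * pmf Q z)"
      by (rule nb_product_dominated) (use P t in blast)+
    then obtain B Q where "\<forall>t' z. (\<forall>\<nu>\<in>{1..N}. 0 < t' \<nu> \<and> t' \<nu> \<le> t \<nu>) \<longrightarrow>
           (1 + grand_total N z)\<^sup>2 * pmf (nb_product N t' P) z \<le> B * pmf Q z"
      by (elim exE conjE)
    then have "(1 + grand_total N z)\<^sup>2 * pmf (nb_product N t P) z \<le> B * pmf Q z" for z
      using t by simp
    then show thesis by (rule that)
  qed
  have C: "0 \<le> C"
    using order_trans[OF abs_ge_zero f[of "\<lambda>_. 0"]] by (simp add: grand_total_def)
  have "\<bar>pmf (nb_product N t P) z * f z\<bar> \<le> C * (B * pmf Q z)" for z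
  proof -
    have "\<bar>pmf (nb_product N t P) z * f z\<bar> \<le> pmf (nb_product N t P) z * (C * (1 + grand_total N z)\<^sup>2)"
      unfolding abs_mult abs_of_nonneg[OF pmf_nonneg] by (intro mult_left_mono f pmf_nonneg)
    also have "\<dots> = C * ((1 + grand_total N z)\<^sup>2 * pmf (nb_product N t P) z)" by (simp add: mult_ac)
    also have "\<dots> \<le> C * (B * pmf Q z)" using C B by (intro mult_left_mono)
    finally show ?thesis .
  qed
  note bound = this
  show ?thesis
    unfolding integrable_pmf_iff_count_space
  proof (rule Bochner_Integration.integrable_bound[of _ "\<lambda>z. C * (B * pmf Q z)"])
    show "integrable (count_space UNIV) (\<lambda>z. C * (B * pmf Q z))"
      by (intro integrable_mult_right integrable_pmf_count_space)
    show "AE z in count_space UNIV. norm (pmf (nb_product N t P) z * f z) \<le> norm (C * (B * pmf Q z))"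
      unfolding real_norm_def by (intro AE_I2 order_trans[OF bound abs_ge_self])
  qed (rule borel_measurable_count_space)
qed

lemma nm_kernel_lower_bound:
  fixes Q :: "'a \<Rightarrow> nat \<Rightarrow> nat \<Rightarrow> real"
  assumes meas: "\<And>\<nu>. \<nu> \<in> {1..N} \<Longrightarrow> (\<lambda>x. psum (m \<nu>) (Q x \<nu>)) \<in> borel_measurable M"
      "\<And>\<nu> i. \<nu> \<in> {1..N} \<Longrightarrow> i \<in> {1..m \<nu>} \<Longrightarrow> (\<lambda>x. Q x \<nu> i) \<in> borel_measurable M"
    and int: "\<And>x. x \<in> space M \<Longrightarrow> interior_point N m (Q x)"
    and M: "emeasure M (space M) \<noteq> 0"
  shows "\<exists>C\<ge>0. \<forall>t z. (\<forall>\<nu>\<in>{1..N}. 0 \<le> t \<nu>) \<longrightarrow>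
    ennreal (exp (- C * (1 + (\<Sum>\<nu>\<in>{1..N}. t \<nu>) + grand_total N (totals m z))))
      \<le> (\<integral>\<^sup>+ x. ennreal (nm_kernel N m t z (Q x)) \<partial>M)"
proof -
  define I where "I = (SIGMA \<nu>:{1..N}. {0..m \<nu>})"
  \<comment> \<open>The pair with second component \<open>0\<close> stands for the factor with the complementary probability.\<close>
  define g where "g = (\<lambda>(\<nu>, i) x. if i = 0 then 1 - psum (m \<nu>) (Q x \<nu>) else Q x \<nu> i)"
  have split: "{0..k} = insert 0 {1..k}" for k :: nat by auto
  have unit: "0 < psum (m \<nu>) (Q x \<nu>)" "psum (m \<nu>) (Q x \<nu>) < 1" if "\<nu> \<in> {1..N}" "x \<in> space M" for \<nu> x
    using int[OF that(2)] that(1) by (auto simp: interior_point_def)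
  have pos: "0 < Q x \<nu> i" if "\<nu> \<in> {1..N}" "i \<in> {1..m \<nu>}" "x \<in> space M" for \<nu> i x
    using int[OF that(3)] that(1,2) by (auto simp: interior_point_def)
  have le1: "Q x \<nu> i \<le> 1" if "\<nu> \<in> {1..N}" "i \<in> {1..m \<nu>}" "x \<in> space M" for \<nu> i x
  proof -
    have "Q x \<nu> i \<le> psum (m \<nu>) (Q x \<nu>)"
      unfolding psum_def using pos[OF that(1) _ that(3)] that(2) by (intro member_le_sum) (auto simp: less_imp_le)
    then show ?thesis using unit[OF that(1,3)] by linarith
  qed
  have "\<exists>C\<ge>0. \<forall>e. (\<forall>i\<in>I. 0 \<le> e i) \<longrightarrow>
    ennreal (exp (- C * (1 + (\<Sum>i\<in>I. e i)))) \<le> (\<integral>\<^sup>+ x. ennreal (\<Prod>i\<in>I. g i x powr e i) \<partial>M)"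
  proof (rule nn_integral_prod_powr_lower_bound)
    show "finite I" unfolding I_def by auto
    fix i assume i: "i \<in> I"
    obtain \<nu> j where ij: "i = (\<nu>, j)" "\<nu> \<in> {1..N}" "j = 0 \<or> j \<in> {1..m \<nu>}" using i by (auto simp: I_def split)
    show "g i \<in> borel_measurable M"
      using meas(1)[OF ij(2)] meas(2)[OF ij(2), of j] ij by (cases "j = 0") (auto simp: g_def)
    fix x assume x: "x \<in> space M"
    show "0 < g i x \<and> g i x \<le> 1"
      using unit[OF ij(2) x] pos[OF ij(2) _ x, of j] le1[OF ij(2) _ x, of j] ij
      by (cases "j = 0") (auto simp: g_def)
  qed (rule M)
  then obtain C where C: "0 \<le> C" and low: "\<And>e. (\<forall>i\<in>I. 0 \<le> e i) \<Longrightarrow>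
    ennreal (exp (- C * (1 + (\<Sum>i\<in>I. e i)))) \<le> (\<integral>\<^sup>+ x. ennreal (\<Prod>i\<in>I. g i x powr e i) \<partial>M)"
    by blast
  show ?thesis
  proof (intro exI[of _ C] conjI allI impI C)
    fix t :: "nat \<Rightarrow> real" and z :: "nat \<Rightarrow> nat \<Rightarrow> nat" assume t: "\<forall>\<nu>\<in>{1..N}. 0 \<le> t \<nu>"
    define e where "e = (\<lambda>(\<nu>, i). if i = 0 then t \<nu> else real (z \<nu> i))"
    have "(\<Sum>i\<in>I. e i) = (\<Sum>\<nu>\<in>{1..N}. \<Sum>i\<in>{0..m \<nu>}. e (\<nu>, i))"
      unfolding I_def by (subst sum.Sigma) auto
    also have "\<dots> = (\<Sum>\<nu>\<in>{1..N}. t \<nu> + real (totals m z \<nu>))"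
      unfolding split by (intro sum.cong refl) (auto simp: e_def totals_def intro!: sum.cong)
    finally have se: "(\<Sum>i\<in>I. e i) = (\<Sum>\<nu>\<in>{1..N}. t \<nu>) + grand_total N (totals m z)"
      by (simp add: sum.distrib grand_total_def)
    have "ennreal (exp (- C * (1 + (\<Sum>i\<in>I. e i)))) \<le> (\<integral>\<^sup>+ x. ennreal (\<Prod>i\<in>I. g i x powr e i) \<partial>M)"
      by (rule low) (use t in \<open>auto simp: e_def I_def\<close>)
    also have "\<dots> = (\<integral>\<^sup>+ x. ennreal (nm_kernel N m t z (Q x)) \<partial>M)"
    proof (intro nn_integral_cong arg_cong[where f = ennreal])
      fix x assume x: "x \<in> space M"
      have "(\<Prod>i\<in>I. g i x powr e i) = (\<Prod>\<nu>\<in>{1..N}. \<Prod>i\<in>{0..m \<nu>}. g (\<nu>, i) x powr e (\<nu>, i))"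
        unfolding I_def by (subst prod.Sigma) auto
      also have "\<dots> = nm_kernel N m t z (Q x)"
        unfolding split nm_kernel_def
        by (intro prod.cong refl) (use pos x in \<open>auto simp: g_def e_def powr_realpow intro!: prod.cong\<close>)
      finally show "(\<Prod>i\<in>I. g i x powr e i) = nm_kernel N m t z (Q x)" .
    qed
    finally show "ennreal (exp (- C * (1 + (\<Sum>\<nu>\<in>{1..N}. t \<nu>) + grand_total N (totals m z))))
      \<le> (\<integral>\<^sup>+ x. ennreal (nm_kernel N m t z (Q x)) \<partial>M)" unfolding se by (simp add: add.assoc)
  qed
qed


text \<open>
  Kernel masses decrease in the exponents, which bounds them from above, and decay at most
  exponentially in the counts. The points at which the kernels are evaluated are given by a map \<open>Q\<close>
  so that the bound covers the full kernels, those of the totals (blocks of length one) and a single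
  point.
\<close>

lemma ln_kernel_integral_bound:
  fixes Q :: "'a \<Rightarrow> nat \<Rightarrow> nat \<Rightarrow> real" and lo T :: "nat \<Rightarrow> real"
  assumes meas: "\<And>\<nu>. \<nu> \<in> {1..N} \<Longrightarrow> (\<lambda>x. psum (m \<nu>) (Q x \<nu>)) \<in> borel_measurable M"
      "\<And>\<nu> i. \<nu> \<in> {1..N} \<Longrightarrow> i \<in> {1..m \<nu>} \<Longrightarrow> (\<lambda>x. Q x \<nu> i) \<in> borel_measurable M"
    and int: "\<And>x. x \<in> space M \<Longrightarrow> interior_point N m (Q x)"
    and M: "emeasure M (space M) \<noteq> 0"
    and lo: "\<And>\<nu>. \<nu> \<in> {1..N} \<Longrightarrow> 0 \<le> lo \<nu>"
    and fin: "(\<integral>\<^sup>+ x. ennreal (nm_kernel N m lo (\<lambda>_ _. 0) (Q x)) \<partial>M) < \<infinity>"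
  defines "I \<equiv> \<lambda>t z. enn2real (\<integral>\<^sup>+ x. ennreal (nm_kernel N m t z (Q x)) \<partial>M)"
  shows "\<exists>C\<ge>0. \<forall>t z. (\<forall>\<nu>\<in>{1..N}. lo \<nu> \<le> t \<nu> \<and> t \<nu> \<le> T \<nu>) \<longrightarrow>
    0 < I t z \<and> \<bar>ln (I t z)\<bar> \<le> C * (1 + grand_total N (totals m z))"
proof -
  obtain C where C: "0 \<le> C" and low: "\<And>t z. (\<forall>\<nu>\<in>{1..N}. 0 \<le> t \<nu>) \<Longrightarrow>
    ennreal (exp (- C * (1 + (\<Sum>\<nu>\<in>{1..N}. t \<nu>) + grand_total N (totals m z))))
      \<le> (\<integral>\<^sup>+ x. ennreal (nm_kernel N m t z (Q x)) \<partial>M)"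
    using nm_kernel_lower_bound[of N m Q M] meas int M by blast
  define S where "S = \<bar>\<Sum>\<nu>\<in>{1..N}. T \<nu>\<bar>"
  define D where "D = \<bar>ln (I lo (\<lambda>_ _. 0))\<bar>"
  show ?thesis
  proof (intro exI[of _ "C * (1 + S) + D"] conjI allI impI)
    show "0 \<le> C * (1 + S) + D" using C by (simp add: D_def S_def)
    fix t :: "nat \<Rightarrow> real" and z :: "nat \<Rightarrow> nat \<Rightarrow> nat"
    assume t: "\<forall>\<nu>\<in>{1..N}. lo \<nu> \<le> t \<nu> \<and> t \<nu> \<le> T \<nu>"
    let ?g = "grand_total N (totals m z)" and ?W = "\<lambda>t z. \<integral>\<^sup>+ x. ennreal (nm_kernel N m t z (Q x)) \<partial>M"
    have up: "?W t z \<le> ?W lo (\<lambda>_ _. 0)"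
      using t by (intro nn_integral_mono ennreal_leI nm_kernel_le int) auto
    have low_exp: "ennreal (exp (- C * (1 + (\<Sum>\<nu>\<in>{1..N}. t \<nu>) + ?g))) \<le> ?W t z"
    proof (intro low ballI)
      show "0 \<le> t \<nu>" if "\<nu> \<in> {1..N}" for \<nu> using lo[OF that] bspec[OF t that] by linarith
    qed
    have W: "?W t z = ennreal (I t z)" "?W lo (\<lambda>_ _. 0) = ennreal (I lo (\<lambda>_ _. 0))"
      using fin up by (simp_all add: I_def le_less_trans)
    have low_I: "exp (- C * (1 + (\<Sum>\<nu>\<in>{1..N}. t \<nu>) + ?g)) \<le> I t z"
      using low_exp unfolding W by (subst (asm) ennreal_le_iff) (simp_all add: I_def)
    then show pos: "0 < I t z" using exp_gt_zero less_le_trans by blast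
    have "I t z \<le> I lo (\<lambda>_ _. 0)"
      using up unfolding W by (subst (asm) ennreal_le_iff) (simp_all add: I_def)
    then have "ln (I t z) \<le> ln (I lo (\<lambda>_ _. 0))" using pos by simp
    then have ln_up: "ln (I t z) \<le> D" unfolding D_def by linarith
    have ln_lo: "- C * (1 + (\<Sum>\<nu>\<in>{1..N}. t \<nu>) + ?g) \<le> ln (I t z)" using low_I pos by (subst ln_ge_iff)
    have "(\<Sum>\<nu>\<in>{1..N}. t \<nu>) \<le> (\<Sum>\<nu>\<in>{1..N}. T \<nu>)" using t by (intro sum_mono) auto
    moreover have "(\<Sum>\<nu>\<in>{1..N}. T \<nu>) \<le> S" "0 \<le> S * ?g" by (simp_all add: S_def)
    ultimately have le: "1 + (\<Sum>\<nu>\<in>{1..N}. t \<nu>) + ?g \<le> (1 + S) * (1 + ?g)" by (simp add: algebra_simps)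
    from mult_left_mono[OF le C] have "C * (1 + (\<Sum>\<nu>\<in>{1..N}. t \<nu>) + ?g) \<le> C * ((1 + S) * (1 + ?g))" .
    moreover have "0 \<le> D" "0 \<le> D * ?g" "0 \<le> C * ((1 + S) * (1 + ?g))"
      using C by (simp_all add: D_def S_def)
    ultimately show "\<bar>ln (I t z)\<bar> \<le> (C * (1 + S) + D) * (1 + ?g)"
      using ln_up ln_lo unfolding distrib_right[of "C * (1 + S)"] mult.assoc distrib_left[of D] by linarith
  qed
qed

section \<open>Expected log masses along the path\<close>

lemma has_log_derivative_prod:
  fixes f :: "'i \<Rightarrow> real \<Rightarrow> real"
  assumes "finite A" "\<And>i. i \<in> A \<Longrightarrow> (f i has_real_derivative f i x * g i) (at x within S)"
  shows "((\<lambda>x. \<Prod>i\<in>A. f i x) has_real_derivative (\<Prod>i\<in>A. f i x) * (\<Sum>i\<in>A. g i)) (at x within S)"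
  using assms
proof (induction A rule: finite_induct)
  case (insert i A)
  have "((\<lambda>x. f i x * (\<Prod>i\<in>A. f i x)) has_real_derivative
      f i x * g i * (\<Prod>i\<in>A. f i x) + (\<Prod>i\<in>A. f i x) * (\<Sum>i\<in>A. g i) * f i x) (at x within S)"
    using insert by (intro DERIV_mult) auto
  then show ?case using insert.hyps by (simp add: algebra_simps)
qed simp

lemma grand_total_shift:
  assumes "\<nu> \<in> {1..N}"
  shows "grand_total N (\<zeta>(\<nu> := \<zeta> \<nu> + k)) = grand_total N \<zeta> + real k"
proof -
  have "(\<Sum>\<nu>'\<in>{1..N} - {\<nu>}. (\<zeta>(\<nu> := \<zeta> \<nu> + k)) \<nu>') = (\<Sum>\<nu>'\<in>{1..N} - {\<nu>}. \<zeta> \<nu>')"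
    by (intro sum.cong) auto
  then show ?thesis
    unfolding grand_total_def using assms by (simp add: sum.remove[of _ \<nu>] del: of_nat_sum)
qed

lemma component_le_grand_total:
  assumes "\<nu> \<in> {1..N}"
  shows "real (\<zeta> \<nu>) \<le> grand_total N \<zeta>"
  unfolding grand_total_def using assms by (intro of_nat_mono member_le_sum) auto

text \<open>
  The kernel of the totals, as a function of the block sums \<open>w\<close>.
\<close>

definition total_weight :: "nat \<Rightarrow> (nat \<Rightarrow> real) \<Rightarrow> (nat \<Rightarrow> nat) \<Rightarrow> (nat \<Rightarrow> real) \<Rightarrow> real" where
  "total_weight N t \<zeta> w = (\<Prod>\<nu>\<in>{1..N}. (1 - w \<nu>) powr t \<nu> * w \<nu> ^ \<zeta> \<nu>)"

lemma total_weight_eq_kernel: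
  "total_weight N t \<zeta> w = nm_kernel N (\<lambda>_. 1) t (\<lambda>\<nu> _. \<zeta> \<nu>) (\<lambda>\<nu> _. w \<nu>)"
  by (simp add: total_weight_def nm_kernel_def psum_def)

text \<open>
  The setting for the derivative of the expected log mass: \<open>M\<close> is a prior measure, of which only
  the values \<open>v \<nu>\<close> matter, \<open>t\<close> is the path of parameters with derivative \<open>t'\<close>, and \<open>P\<close> contains the
  true probabilities. The last analytic assumption bounds the posterior expectation of
  \<open>- ln (1 - v \<nu>)\<close> linearly in the observed total.
\<close>

locale tilted_prior =
  fixes N :: nat and M :: "'a measure" and v :: "nat \<Rightarrow> 'a \<Rightarrow> real"
    and t t' :: "nat \<Rightarrow> real \<Rightarrow> real" and P :: "nat \<Rightarrow> real"
  assumes v_meas [measurable]: "\<And>\<nu>. \<nu> \<in> {1..N} \<Longrightarrow> v \<nu> \<in> borel_measurable M"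
    and v_unit: "\<And>\<nu> x. \<nu> \<in> {1..N} \<Longrightarrow> x \<in> space M \<Longrightarrow> 0 < v \<nu> x \<and> v \<nu> x < 1"
    and nonnull: "emeasure M (space M) \<noteq> 0"
    and finite_mass: "(\<integral>\<^sup>+ x. ennreal (total_weight N (\<lambda>\<nu>. t \<nu> 0) (\<lambda>_. 0) (\<lambda>\<nu>. v \<nu> x)) \<partial>M) < \<infinity>"
    and log_bound: "\<exists>C\<ge>0. \<forall>\<nu>\<in>{1..N}. \<forall>\<tau>\<in>{0..1}. \<forall>\<zeta>.
      (\<integral>\<^sup>+ x. ennreal (- ln (1 - v \<nu> x) * total_weight N (\<lambda>\<nu>. t \<nu> \<tau>) \<zeta> (\<lambda>\<nu>. v \<nu> x)) \<partial>M)
       \<le> ennreal (C * (1 + real (\<zeta> \<nu>))) *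
         (\<integral>\<^sup>+ x. ennreal (total_weight N (\<lambda>\<nu>. t \<nu> \<tau>) \<zeta> (\<lambda>\<nu>. v \<nu> x)) \<partial>M)"
    and t_pos: "\<And>\<nu>. \<nu> \<in> {1..N} \<Longrightarrow> 0 < t \<nu> 0"
    and t_mono: "\<And>\<nu>. \<nu> \<in> {1..N} \<Longrightarrow> mono_on {0..1} (t \<nu>)"
    and t_deriv: "\<And>\<nu> \<tau>. \<nu> \<in> {1..N} \<Longrightarrow> \<tau> \<in> {0..1} \<Longrightarrow>
      (t \<nu> has_real_derivative t' \<nu> \<tau>) (at \<tau> within {0..1})"
    and t'_cont: "\<And>\<nu>. \<nu> \<in> {1..N} \<Longrightarrow> continuous_on {0..1} (t' \<nu>)"
    and P_unit: "\<And>\<nu>. \<nu> \<in> {1..N} \<Longrightarrow> 0 < P \<nu> \<and> P \<nu> < 1"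
begin

definition weight :: "real \<Rightarrow> (nat \<Rightarrow> nat) \<Rightarrow> 'a \<Rightarrow> real" where
  "weight \<tau> \<zeta> x = total_weight N (\<lambda>\<nu>. t \<nu> \<tau>) \<zeta> (\<lambda>\<nu>. v \<nu> x)"

definition J :: "real \<Rightarrow> (nat \<Rightarrow> nat) \<Rightarrow> real" where
  "J \<tau> \<zeta> = (\<integral>x. weight \<tau> \<zeta> x \<partial>M)"

definition moment :: "real \<Rightarrow> nat \<Rightarrow> nat \<Rightarrow> (nat \<Rightarrow> nat) \<Rightarrow> real" where
  "moment \<tau> \<nu> k \<zeta> = J \<tau> (\<zeta>(\<nu> := \<zeta> \<nu> + k)) / J \<tau> \<zeta>"

definition log_integral :: "real \<Rightarrow> nat \<Rightarrow> (nat \<Rightarrow> nat) \<Rightarrow> real" where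
  "log_integral \<tau> \<nu> \<zeta> = (\<integral>x. - ln (1 - v \<nu> x) * weight \<tau> \<zeta> x \<partial>M)"

text \<open>
  The logarithmic derivative in \<open>t \<nu>\<close> of the negative binomial mass.
\<close>

definition score :: "real \<Rightarrow> nat \<Rightarrow> (nat \<Rightarrow> nat) \<Rightarrow> real" where
  "score \<tau> \<nu> \<zeta> = (\<Sum>i<\<zeta> \<nu>. 1 / (t \<nu> \<tau> + real i)) + ln (1 - P \<nu>)"

abbreviation NB :: "real \<Rightarrow> (nat \<Rightarrow> nat) pmf" where
  "NB \<tau> \<equiv> nb_product N (\<lambda>\<nu>. t \<nu> \<tau>) P"

abbreviation expect :: "real \<Rightarrow> ((nat \<Rightarrow> nat) \<Rightarrow> real) \<Rightarrow> real" where
  "expect \<tau> f \<equiv> measure_pmf.expectation (NB \<tau>) f"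

definition integrand :: "real \<Rightarrow> nat \<Rightarrow> (nat \<Rightarrow> nat) \<Rightarrow> real" where
  "integrand \<tau> \<nu> \<zeta> = score \<tau> \<nu> \<zeta> * ln (J \<tau> \<zeta>) - log_integral \<tau> \<nu> \<zeta> / J \<tau> \<zeta>"

text \<open>
  The partial derivative of \<open>E ln J\<close> in the direction \<open>t \<nu>\<close>: the first term of the integrand moves
  the law of the totals, the second one moves \<open>J\<close> itself.
\<close>

definition drift :: "real \<Rightarrow> nat \<Rightarrow> real" where
  "drift \<tau> \<nu> = expect \<tau> (integrand \<tau> \<nu>)"

lemma t_range:
  assumes "\<nu> \<in> {1..N}" "\<tau> \<in> {0..1}"
  shows "t \<nu> 0 \<le> t \<nu> \<tau>" "t \<nu> \<tau> \<le> t \<nu> 1" "0 < t \<nu> \<tau>"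
proof -
  show a: "t \<nu> 0 \<le> t \<nu> \<tau>" and "t \<nu> \<tau> \<le> t \<nu> 1"
    using t_mono[OF assms(1)] assms(2) by (auto simp: mono_on_def)
  show "0 < t \<nu> \<tau>" using a t_pos[OF assms(1)] by linarith
qed

lemma interior_v: "x \<in> space M \<Longrightarrow> interior_point N (\<lambda>_. 1) (\<lambda>\<nu> _. v \<nu> x)"
  using v_unit by (auto simp: interior_point_def psum_def)

lemma weight_pos: "x \<in> space M \<Longrightarrow> 0 < weight \<tau> \<zeta> x"
  unfolding weight_def total_weight_eq_kernel by (intro nm_kernel_pos interior_v)

lemma weight_le:
  assumes "x \<in> space M" "\<tau> \<in> {0..1}"
  shows "weight \<tau> \<zeta> x \<le> weight 0 (\<lambda>_. 0) x"
  unfolding weight_def total_weight_eq_kernel by (intro nm_kernel_le interior_v assms t_range(1))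

lemma weight_measurable [measurable]: "weight \<tau> \<zeta> \<in> borel_measurable M"
  unfolding weight_def[abs_def] total_weight_def by measurable

lemma weight_integrable:
  assumes "\<tau> \<in> {0..1}"
  shows "integrable M (weight \<tau> \<zeta>)"
proof -
  have "integrable M (weight 0 (\<lambda>_. 0))"
  proof (rule integrableI_nonneg)
    show "AE x in M. 0 \<le> weight 0 (\<lambda>_. 0) x" using weight_pos by (intro AE_I2 less_imp_le)
    show "(\<integral>\<^sup>+ x. ennreal (weight 0 (\<lambda>_. 0) x) \<partial>M) < \<infinity>" using finite_mass by (simp add: weight_def)
  qed simp
  then show ?thesis
    by (rule Bochner_Integration.integrable_bound)
       (use weight_le[OF _ assms] weight_pos in \<open>auto intro!: AE_I2 simp: abs_of_pos\<close>)
qed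

lemma nn_integral_weight:
  assumes "\<tau> \<in> {0..1}"
  shows "(\<integral>\<^sup>+ x. ennreal (weight \<tau> \<zeta> x) \<partial>M) = ennreal (J \<tau> \<zeta>)"
  unfolding J_def using weight_pos
  by (intro nn_integral_eq_integral weight_integrable assms AE_I2) (auto intro: less_imp_le)

lemma J_bounds:
  "\<exists>C\<ge>0. \<forall>\<tau>\<in>{0..1}. \<forall>\<zeta>. 0 < J \<tau> \<zeta> \<and> \<bar>ln (J \<tau> \<zeta>)\<bar> \<le> C * (1 + grand_total N \<zeta>)"
proof -
  let ?I = "\<lambda>t z. enn2real (\<integral>\<^sup>+ x. ennreal (nm_kernel N (\<lambda>_. 1) t z (\<lambda>\<nu> _. v \<nu> x)) \<partial>M)"
  have "\<exists>C\<ge>0. \<forall>s z. (\<forall>\<nu>\<in>{1..N}. t \<nu> 0 \<le> s \<nu> \<and> s \<nu> \<le> t \<nu> 1) \<longrightarrow>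
      0 < ?I s z \<and> \<bar>ln (?I s z)\<bar> \<le> C * (1 + grand_total N (totals (\<lambda>_. 1) z))"
    using finite_mass unfolding total_weight_eq_kernel
    by (intro ln_kernel_integral_bound[where lo = "\<lambda>\<nu>. t \<nu> 0"])
       (auto simp: interior_v nonnull psum_def less_imp_le[OF t_pos] intro: v_meas)
  then obtain C where C: "0 \<le> C" "\<And>s z. (\<forall>\<nu>\<in>{1..N}. t \<nu> 0 \<le> s \<nu> \<and> s \<nu> \<le> t \<nu> 1) \<Longrightarrow>
      0 < ?I s z \<and> \<bar>ln (?I s z)\<bar> \<le> C * (1 + grand_total N (totals (\<lambda>_. 1) z))"
    by blast
  show ?thesis
  proof (intro exI[of _ C] conjI ballI allI C(1))
    fix \<tau> :: real and \<zeta> :: "nat \<Rightarrow> nat" assume \<tau>: "\<tau> \<in> {0..1}"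
    have "0 \<le> J \<tau> \<zeta>" unfolding J_def using weight_pos by (intro integral_nonneg_AE AE_I2 less_imp_le)
    then have "?I (\<lambda>\<nu>. t \<nu> \<tau>) (\<lambda>\<nu> _. \<zeta> \<nu>) = J \<tau> \<zeta>"
      using nn_integral_weight[OF \<tau>, of \<zeta>] by (simp add: weight_def total_weight_eq_kernel)
    moreover have "totals (\<lambda>_. 1) (\<lambda>\<nu> _. \<zeta> \<nu>) = \<zeta>" by (simp add: totals_def fun_eq_iff)
    ultimately show "0 < J \<tau> \<zeta>" "\<bar>ln (J \<tau> \<zeta>)\<bar> \<le> C * (1 + grand_total N \<zeta>)"
      using C(2)[of "\<lambda>\<nu>. t \<nu> \<tau>" "\<lambda>\<nu> _. \<zeta> \<nu>"] t_range(1,2)[OF _ \<tau>] by simp_all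
  qed
qed

lemma J_pos: "\<tau> \<in> {0..1} \<Longrightarrow> 0 < J \<tau> \<zeta>"
  using J_bounds by blast

lemma log_J_bound: "\<exists>C\<ge>0. \<forall>\<tau>\<in>{0..1}. \<forall>\<zeta>. \<bar>ln (J \<tau> \<zeta>)\<bar> \<le> C * (1 + grand_total N \<zeta>)"
  using J_bounds by blast

lemma weight_shift:
  assumes "\<nu> \<in> {1..N}"
  shows "weight \<tau> (\<zeta>(\<nu> := \<zeta> \<nu> + k)) x = v \<nu> x ^ k * weight \<tau> \<zeta> x"
proof -
  have "(\<Prod>\<nu>'\<in>{1..N} - {\<nu>}. (1 - v \<nu>' x) powr t \<nu>' \<tau> * v \<nu>' x ^ (\<zeta>(\<nu> := \<zeta> \<nu> + k)) \<nu>')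
      = (\<Prod>\<nu>'\<in>{1..N} - {\<nu>}. (1 - v \<nu>' x) powr t \<nu>' \<tau> * v \<nu>' x ^ \<zeta> \<nu>')"
    by (intro prod.cong) auto
  then show ?thesis
    unfolding weight_def total_weight_def using assms by (simp add: prod.remove[of _ \<nu>] power_add)
qed

lemma moment_pos: "\<tau> \<in> {0..1} \<Longrightarrow> 0 < moment \<tau> \<nu> k \<zeta>"
  unfolding moment_def by (intro divide_pos_pos J_pos)

lemma moment_le_1:
  assumes "\<tau> \<in> {0..1}" "\<nu> \<in> {1..N}"
  shows "moment \<tau> \<nu> k \<zeta> \<le> 1"
proof -
  have "J \<tau> (\<zeta>(\<nu> := \<zeta> \<nu> + k)) \<le> J \<tau> \<zeta>"
    unfolding J_def
  proof (intro integral_mono weight_integrable assms)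
    fix x assume "x \<in> space M"
    with v_unit[OF assms(2)] have "v \<nu> x ^ k \<le> 1" by (intro power_le_one) (auto intro: less_imp_le)
    then show "weight \<tau> (\<zeta>(\<nu> := \<zeta> \<nu> + k)) x \<le> weight \<tau> \<zeta> x"
      unfolding weight_shift[OF assms(2)] using weight_pos[OF \<open>x \<in> space M\<close>, of \<tau> \<zeta>]
      by (intro mult_left_le_one_le) (use v_unit[OF assms(2) \<open>x \<in> space M\<close>] in auto)
  qed
  then show ?thesis unfolding moment_def using J_pos[OF assms(1), of \<zeta>] by simp
qed

lemma ln_moment: "\<tau> \<in> {0..1} \<Longrightarrow> ln (moment \<tau> \<nu> k \<zeta>) = ln (J \<tau> (\<zeta>(\<nu> := \<zeta> \<nu> + k))) - ln (J \<tau> \<zeta>)"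
  using J_pos[of \<tau> \<zeta>] J_pos[of \<tau> "\<zeta>(\<nu> := \<zeta> \<nu> + k)"] by (simp add: moment_def ln_div)

lemma NB_integrable:
  assumes "\<tau> \<in> {0..1}" "\<And>\<zeta>. \<bar>f \<zeta>\<bar> \<le> C * (1 + grand_total N \<zeta>)\<^sup>2"
  shows "integrable (NB \<tau>) (f :: _ \<Rightarrow> real)"
  using P_unit t_range(3)[OF _ assms(1)] assms(2) by (rule nb_product_integrable)

lemma linear_le_square: "0 \<le> C \<Longrightarrow> C * (1 + grand_total N \<zeta>) \<le> C * (1 + grand_total N \<zeta>)\<^sup>2"
  unfolding power2_eq_square by (intro mult_left_mono) (simp_all add: algebra_simps)

lemma log_J_shift_integrable:
  assumes "\<tau> \<in> {0..1}" "\<nu> \<in> {1..N}"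
  shows "integrable (NB \<tau>) (\<lambda>\<zeta>. ln (J \<tau> (\<zeta>(\<nu> := \<zeta> \<nu> + k))))"
proof -
  obtain C where C: "0 \<le> C" "\<And>\<tau> \<zeta>. \<tau> \<in> {0..1} \<Longrightarrow> \<bar>ln (J \<tau> \<zeta>)\<bar> \<le> C * (1 + grand_total N \<zeta>)"
    using log_J_bound by blast
  show ?thesis
  proof (rule NB_integrable[OF assms(1)])
    fix \<zeta>
    have "\<bar>ln (J \<tau> (\<zeta>(\<nu> := \<zeta> \<nu> + k)))\<bar> \<le> C * (1 + (grand_total N \<zeta> + real k))"
      using C(2)[OF assms(1), of "\<zeta>(\<nu> := \<zeta> \<nu> + k)"] by (simp only: grand_total_shift[OF assms(2)])
    also have "\<dots> \<le> C * ((1 + real k) * (1 + grand_total N \<zeta>))"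
      using C(1) by (intro mult_left_mono) (auto simp: algebra_simps)
    also have "\<dots> \<le> C * (1 + real k) * (1 + grand_total N \<zeta>)\<^sup>2"
      using linear_le_square[of "C * (1 + real k)" \<zeta>] C(1) by (simp add: mult.assoc)
    finally show "\<bar>ln (J \<tau> (\<zeta>(\<nu> := \<zeta> \<nu> + k)))\<bar> \<le> C * (1 + real k) * (1 + grand_total N \<zeta>)\<^sup>2" .
  qed
qed

lemma log_J_integrable:
  assumes "\<tau> \<in> {0..1}"
  shows "integrable (NB \<tau>) (\<lambda>\<zeta>. ln (J \<tau> \<zeta>))"
proof -
  obtain C where C: "0 \<le> C" "\<And>\<tau> \<zeta>. \<tau> \<in> {0..1} \<Longrightarrow> \<bar>ln (J \<tau> \<zeta>)\<bar> \<le> C * (1 + grand_total N \<zeta>)"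
    using log_J_bound by blast
  show ?thesis
    by (rule NB_integrable[OF assms]) (rule order_trans[OF C(2)[OF assms] linear_le_square[OF C(1)]])
qed

lemma ln_moment_integrable:
  assumes "\<tau> \<in> {0..1}" "\<nu> \<in> {1..N}"
  shows "integrable (NB \<tau>) (\<lambda>\<zeta>. ln (moment \<tau> \<nu> k \<zeta>))"
  unfolding ln_moment[OF assms(1)]
  by (intro Bochner_Integration.integrable_diff log_J_shift_integrable log_J_integrable assms)

lemma moment_integrable:
  assumes "\<tau> \<in> {0..1}" "\<nu> \<in> {1..N}"
  shows "integrable (NB \<tau>) (\<lambda>\<zeta>. moment \<tau> \<nu> k \<zeta>)"
  by (rule measure_pmf.integrable_const_bound[where B = 1])
     (use moment_pos[OF assms(1), of \<nu> k] moment_le_1[OF assms] in \<open>auto simp: abs_of_pos\<close>)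

lemma log_weight_nonneg:
  assumes "\<nu> \<in> {1..N}" "x \<in> space M"
  shows "0 \<le> - ln (1 - v \<nu> x) * weight \<tau> \<zeta> x"
  using v_unit[OF assms] weight_pos[OF assms(2), of \<tau> \<zeta>]
  by (intro mult_nonneg_nonneg) (auto simp: ln_le_zero_iff intro: less_imp_le)

lemma log_weight_bound:
  "\<exists>C\<ge>0. \<forall>\<nu>\<in>{1..N}. \<forall>\<tau>\<in>{0..1}. \<forall>\<zeta>.
     (\<integral>\<^sup>+ x. ennreal (- ln (1 - v \<nu> x) * weight \<tau> \<zeta> x) \<partial>M) \<le> ennreal (C * (1 + real (\<zeta> \<nu>)) * J \<tau> \<zeta>)"
proof -
  obtain C where C: "0 \<le> C" and b: "\<And>\<nu> \<tau> \<zeta>. \<nu> \<in> {1..N} \<Longrightarrow> \<tau> \<in> {0..1} \<Longrightarrow>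
     (\<integral>\<^sup>+ x. ennreal (- ln (1 - v \<nu> x) * weight \<tau> \<zeta> x) \<partial>M)
       \<le> ennreal (C * (1 + real (\<zeta> \<nu>))) * (\<integral>\<^sup>+ x. ennreal (weight \<tau> \<zeta> x) \<partial>M)"
    using log_bound unfolding weight_def by blast
  show ?thesis
  proof (intro exI[of _ C] conjI ballI allI C)
    fix \<nu> \<tau> \<zeta> assume "\<nu> \<in> {1..N}" "\<tau> \<in> {0..1 :: real}"
    from b[OF this, of \<zeta>] nn_integral_weight[OF this(2), of \<zeta>] C
    show "(\<integral>\<^sup>+ x. ennreal (- ln (1 - v \<nu> x) * weight \<tau> \<zeta> x) \<partial>M) \<le> ennreal (C * (1 + real (\<zeta> \<nu>)) * J \<tau> \<zeta>)"
      by (simp add: ennreal_mult')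
  qed
qed

lemma log_weight_integrable:
  assumes "\<nu> \<in> {1..N}" "\<tau> \<in> {0..1}"
  shows "integrable M (\<lambda>x. - ln (1 - v \<nu> x) * weight \<tau> \<zeta> x)"
proof (rule integrableI_nonneg)
  show "(\<lambda>x. - ln (1 - v \<nu> x) * weight \<tau> \<zeta> x) \<in> borel_measurable M" using assms(1) by measurable
  show "AE x in M. 0 \<le> - ln (1 - v \<nu> x) * weight \<tau> \<zeta> x"
    using log_weight_nonneg[OF assms(1)] by (rule AE_I2)
  obtain C where "(\<integral>\<^sup>+ x. ennreal (- ln (1 - v \<nu> x) * weight \<tau> \<zeta> x) \<partial>M) \<le> ennreal (C * (1 + real (\<zeta> \<nu>)) * J \<tau> \<zeta>)"
    using log_weight_bound assms by blast
  then show "(\<integral>\<^sup>+ x. ennreal (- ln (1 - v \<nu> x) * weight \<tau> \<zeta> x) \<partial>M) < \<infinity>"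
    using le_less_trans ennreal_less_top by (metis infinity_ennreal_def)
qed

lemma log_integral_nonneg: "\<nu> \<in> {1..N} \<Longrightarrow> 0 \<le> log_integral \<tau> \<nu> \<zeta>"
  unfolding log_integral_def by (intro integral_nonneg_AE AE_I2 log_weight_nonneg)

lemma log_integral_bound:
  "\<exists>C\<ge>0. \<forall>\<nu>\<in>{1..N}. \<forall>\<tau>\<in>{0..1}. \<forall>\<zeta>. log_integral \<tau> \<nu> \<zeta> / J \<tau> \<zeta> \<le> C * (1 + grand_total N \<zeta>)"
proof -
  obtain C where C: "0 \<le> C" and b: "\<And>\<nu> \<tau> \<zeta>. \<nu> \<in> {1..N} \<Longrightarrow> \<tau> \<in> {0..1} \<Longrightarrow>
     (\<integral>\<^sup>+ x. ennreal (- ln (1 - v \<nu> x) * weight \<tau> \<zeta> x) \<partial>M) \<le> ennreal (C * (1 + real (\<zeta> \<nu>)) * J \<tau> \<zeta>)"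
    using log_weight_bound by blast
  show ?thesis
  proof (intro exI[of _ C] conjI ballI allI C)
    fix \<nu> \<tau> \<zeta> assume \<nu>: "\<nu> \<in> {1..N}" and \<tau>: "\<tau> \<in> {0..1 :: real}"
    have "ennreal (log_integral \<tau> \<nu> \<zeta>) \<le> ennreal (C * (1 + real (\<zeta> \<nu>)) * J \<tau> \<zeta>)"
      unfolding log_integral_def
      using b[OF \<nu> \<tau>, of \<zeta>] nn_integral_eq_integral[OF log_weight_integrable[OF \<nu> \<tau>, of \<zeta>] AE_I2[OF log_weight_nonneg[OF \<nu>]]]
      by simp
    then have "log_integral \<tau> \<nu> \<zeta> \<le> C * (1 + real (\<zeta> \<nu>)) * J \<tau> \<zeta>"
      using C J_pos[OF \<tau>, of \<zeta>] by (subst (asm) ennreal_le_iff) auto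
    also have "\<dots> \<le> C * (1 + grand_total N \<zeta>) * J \<tau> \<zeta>"
      using component_le_grand_total[OF \<nu>, of \<zeta>] C J_pos[OF \<tau>, of \<zeta>]
      by (intro mult_right_mono mult_left_mono) auto
    finally show "log_integral \<tau> \<nu> \<zeta> / J \<tau> \<zeta> \<le> C * (1 + grand_total N \<zeta>)"
      using J_pos[OF \<tau>, of \<zeta>] by (simp add: field_simps)
  qed
qed

text \<open>
  The power series of \<open>- ln (1 - v)\<close>, integrated against the posterior; its terms are positive, so
  its sum dominates the partial sums.
\<close>

lemma moment_sums:
  assumes \<tau>: "\<tau> \<in> {0..1}" and \<nu>: "\<nu> \<in> {1..N}"
  shows "(\<lambda>k. moment \<tau> \<nu> (Suc k) \<zeta> / real (Suc k)) sums (log_integral \<tau> \<nu> \<zeta> / J \<tau> \<zeta>)"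
proof -
  define S where "S = (\<lambda>n x. \<Sum>k<n. v \<nu> x ^ Suc k / real (Suc k) * weight \<tau> \<zeta> x)"
  have ser: "(\<lambda>k. v \<nu> x ^ Suc k / real (Suc k)) sums - ln (1 - v \<nu> x)" if "x \<in> space M" for x
  proof -
    have "(\<lambda>k. - (v \<nu> x ^ k) / real k) sums ln (1 + - v \<nu> x)"
      using ln_series'[of "- v \<nu> x"] v_unit[OF \<nu> that] by simp
    then have "(\<lambda>k. - (v \<nu> x ^ Suc k) / real (Suc k)) sums ln (1 - v \<nu> x)"
      by (subst sums_Suc_iff) simp
    from sums_minus[OF this] show ?thesis by (simp del: of_nat_Suc power_Suc)
  qed
  have "(\<lambda>n. \<integral>x. S n x \<partial>M) \<longlonglongrightarrow> (\<integral>x. - ln (1 - v \<nu> x) * weight \<tau> \<zeta> x \<partial>M)"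
  proof (rule integral_dominated_convergence[where w = "\<lambda>x. - ln (1 - v \<nu> x) * weight \<tau> \<zeta> x"])
    show "integrable M (\<lambda>x. - ln (1 - v \<nu> x) * weight \<tau> \<zeta> x)" by (rule log_weight_integrable[OF \<nu> \<tau>])
    show "(\<lambda>x. - ln (1 - v \<nu> x) * weight \<tau> \<zeta> x) \<in> borel_measurable M" using \<nu> by measurable
    show "S n \<in> borel_measurable M" for n unfolding S_def using \<nu> by measurable
    show "AE x in M. (\<lambda>n. S n x) \<longlonglongrightarrow> - ln (1 - v \<nu> x) * weight \<tau> \<zeta> x"
      using sums_mult2[OF ser] by (intro AE_I2) (simp add: sums_def S_def)
    show "AE x in M. norm (S n x) \<le> - ln (1 - v \<nu> x) * weight \<tau> \<zeta> x" for n
    proof (intro AE_I2)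
      fix x assume x: "x \<in> space M"
      have nn: "0 \<le> v \<nu> x ^ Suc k / real (Suc k) * weight \<tau> \<zeta> x" for k
        using v_unit[OF \<nu> x] weight_pos[OF x, of \<tau> \<zeta>] by simp
      have s: "(\<lambda>k. v \<nu> x ^ Suc k / real (Suc k) * weight \<tau> \<zeta> x) sums (- ln (1 - v \<nu> x) * weight \<tau> \<zeta> x)"
        by (rule sums_mult2[OF ser[OF x]])
      have "norm (S n x) = S n x" unfolding S_def real_norm_def by (intro abs_of_nonneg sum_nonneg nn)
      also have "\<dots> \<le> - ln (1 - v \<nu> x) * weight \<tau> \<zeta> x"
        unfolding S_def sums_unique[OF s] by (intro sum_le_suminf sums_summable[OF s] nn ballI) auto
      finally show "norm (S n x) \<le> - ln (1 - v \<nu> x) * weight \<tau> \<zeta> x" .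
    qed
  qed
  moreover have "(\<integral>x. S n x \<partial>M) = (\<Sum>k<n. J \<tau> (\<zeta>(\<nu> := \<zeta> \<nu> + Suc k)) / real (Suc k))" for n
  proof -
    have "S n x = (\<Sum>k<n. weight \<tau> (\<zeta>(\<nu> := \<zeta> \<nu> + Suc k)) x / real (Suc k))" for x
      unfolding S_def weight_shift[OF \<nu>] by simp
    then show ?thesis using weight_integrable[OF \<tau>]
      by (simp add: J_def del: of_nat_Suc)
  qed
  ultimately have "(\<lambda>k. J \<tau> (\<zeta>(\<nu> := \<zeta> \<nu> + Suc k)) / real (Suc k)) sums log_integral \<tau> \<nu> \<zeta>"
    by (simp add: sums_def log_integral_def)
  from sums_divide[OF this, of "J \<tau> \<zeta>"] show ?thesis
    by (simp add: moment_def mult.commute del: of_nat_Suc)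
qed

lemma t'_bound: "\<exists>K\<ge>0. \<forall>\<nu>\<in>{1..N}. \<forall>\<tau>\<in>{0..1}. \<bar>t' \<nu> \<tau>\<bar> \<le> K"
proof -
  have "\<forall>\<nu>\<in>{1..N}. \<exists>K\<ge>0. \<forall>\<tau>\<in>{0..1}. \<bar>t' \<nu> \<tau>\<bar> \<le> K"
  proof
    fix \<nu> assume "\<nu> \<in> {1..N}"
    from compact_imp_bounded[OF compact_continuous_image[OF t'_cont[OF this] compact_Icc]]
    obtain K where "\<forall>\<tau>\<in>{0..1}. \<bar>t' \<nu> \<tau>\<bar> \<le> K" unfolding bounded_iff by auto
    then show "\<exists>K\<ge>0. \<forall>\<tau>\<in>{0..1}. \<bar>t' \<nu> \<tau>\<bar> \<le> K"
      by (intro exI[of _ "max 0 K"]) auto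
  qed
  then obtain K where K: "\<And>\<nu>. \<nu> \<in> {1..N} \<Longrightarrow> 0 \<le> K \<nu>"
      "\<And>\<nu> \<tau>. \<nu> \<in> {1..N} \<Longrightarrow> \<tau> \<in> {0..1} \<Longrightarrow> \<bar>t' \<nu> \<tau>\<bar> \<le> K \<nu>"
    by metis
  show ?thesis
  proof (intro exI[of _ "sum K {1..N}"] conjI ballI)
    show "0 \<le> sum K {1..N}" by (intro sum_nonneg K)
    fix \<nu> \<tau> assume \<nu>: "\<nu> \<in> {1..N}" and \<tau>: "\<tau> \<in> {0..1 :: real}"
    have "\<bar>t' \<nu> \<tau>\<bar> \<le> K \<nu>" using K(2)[OF \<nu> \<tau>] .
    also have "\<dots> \<le> sum K {1..N}" using \<nu> K(1) by (intro member_le_sum) auto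
    finally show "\<bar>t' \<nu> \<tau>\<bar> \<le> sum K {1..N}" .
  qed
qed

lemma score_bound:
  "\<exists>C\<ge>0. \<forall>\<nu>\<in>{1..N}. \<forall>\<tau>\<in>{0..1}. \<forall>\<zeta>. \<bar>score \<tau> \<nu> \<zeta>\<bar> \<le> C * (1 + grand_total N \<zeta>)"
proof -
  define C where "C = (\<Sum>\<nu>\<in>{1..N}. 1 / t \<nu> 0 + \<bar>ln (1 - P \<nu>)\<bar>)"
  have nn: "0 \<le> 1 / t \<nu> 0 + \<bar>ln (1 - P \<nu>)\<bar>" if "\<nu> \<in> {1..N}" for \<nu> using t_pos[OF that] by simp
  show ?thesis
  proof (intro exI[of _ C] conjI ballI allI)
    show "0 \<le> C" unfolding C_def by (intro sum_nonneg nn)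
    fix \<nu> \<tau> \<zeta> assume \<nu>: "\<nu> \<in> {1..N}" and \<tau>: "\<tau> \<in> {0..1 :: real}"
    have le_C: "1 / t \<nu> 0 + \<bar>ln (1 - P \<nu>)\<bar> \<le> C"
      unfolding C_def using \<nu> nn by (intro member_le_sum) auto
    have terms: "0 \<le> 1 / (t \<nu> \<tau> + real i) \<and> 1 / (t \<nu> \<tau> + real i) \<le> 1 / t \<nu> 0" for i
      using t_range[OF \<nu> \<tau>] t_pos[OF \<nu>] by (auto intro!: divide_left_mono mult_pos_pos add_pos_nonneg)
    have s0: "0 \<le> (\<Sum>i<\<zeta> \<nu>. 1 / (t \<nu> \<tau> + real i))" using terms by (intro sum_nonneg) auto
    have "(\<Sum>i<\<zeta> \<nu>. 1 / (t \<nu> \<tau> + real i)) \<le> (\<Sum>i<\<zeta> \<nu>. 1 / t \<nu> 0)" using terms by (intro sum_mono) auto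
    also have "\<dots> = real (\<zeta> \<nu>) * (1 / t \<nu> 0)" by simp
    also have "\<dots> \<le> grand_total N \<zeta> * (1 / t \<nu> 0)"
      using component_le_grand_total[OF \<nu>] t_pos[OF \<nu>] by (intro mult_right_mono) auto
    finally have "\<bar>score \<tau> \<nu> \<zeta>\<bar> \<le> grand_total N \<zeta> * (1 / t \<nu> 0) + \<bar>ln (1 - P \<nu>)\<bar>"
      unfolding score_def using s0 by linarith
    also have "\<dots> \<le> (1 / t \<nu> 0 + \<bar>ln (1 - P \<nu>)\<bar>) * (1 + grand_total N \<zeta>)"
    proof -
      define b where "b = 1 / t \<nu> 0"
      have "0 \<le> b" "0 \<le> grand_total N \<zeta> * \<bar>ln (1 - P \<nu>)\<bar>" using t_pos[OF \<nu>] by (auto simp: b_def)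
      then show ?thesis unfolding b_def[symmetric] by (simp add: algebra_simps)
    qed
    also have "\<dots> \<le> C * (1 + grand_total N \<zeta>)" by (intro mult_right_mono le_C) auto
    finally show "\<bar>score \<tau> \<nu> \<zeta>\<bar> \<le> C * (1 + grand_total N \<zeta>)" .
  qed
qed

lemma J_deriv:
  assumes \<tau>: "\<tau> \<in> {0..1}"
  shows "((\<lambda>\<tau>. J \<tau> \<zeta>) has_real_derivative - (\<Sum>\<nu>\<in>{1..N}. t' \<nu> \<tau> * log_integral \<tau> \<nu> \<zeta>)) (at \<tau> within {0..1})"
proof -
  obtain K where K: "0 \<le> K" "\<And>\<nu> \<tau>. \<nu> \<in> {1..N} \<Longrightarrow> \<tau> \<in> {0..1} \<Longrightarrow> \<bar>t' \<nu> \<tau>\<bar> \<le> K"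
    using t'_bound by blast
  define W where "W = (\<lambda>\<tau> x. \<Sum>\<nu>\<in>{1..N}. - t' \<nu> \<tau> * (- ln (1 - v \<nu> x) * weight \<tau> \<zeta> x))"
  define B where "B = (\<lambda>x. \<Sum>\<nu>\<in>{1..N}. K * (- ln (1 - v \<nu> x) * weight 0 (\<lambda>_. 0) x))"
  have "((\<lambda>\<tau>. \<integral>x. weight \<tau> \<zeta> x \<partial>M) has_real_derivative (\<integral>x. W \<tau> x \<partial>M)) (at \<tau> within {0..1})"
  proof (rule has_derivative_integral_dominated[where B = B])
    show "integrable M (weight \<tau> \<zeta>)" if "\<tau> \<in> {0..1}" for \<tau> by (rule weight_integrable[OF that])
    show "W \<tau> \<in> borel_measurable M" unfolding W_def by measurable
    show "integrable M B"
      unfolding B_def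
      by (intro Bochner_Integration.integrable_sum integrable_mult_right log_weight_integrable) auto
    fix x \<sigma> assume x: "x \<in> space M" and \<sigma>: "\<sigma> \<in> {0..1 :: real}"
    have "((\<lambda>\<tau>. \<Prod>\<nu>\<in>{1..N}. (1 - v \<nu> x) powr t \<nu> \<tau> * v \<nu> x ^ \<zeta> \<nu>) has_real_derivative
        (\<Prod>\<nu>\<in>{1..N}. (1 - v \<nu> x) powr t \<nu> \<sigma> * v \<nu> x ^ \<zeta> \<nu>) * (\<Sum>\<nu>\<in>{1..N}. t' \<nu> \<sigma> * ln (1 - v \<nu> x)))
        (at \<sigma> within {0..1})"
    proof (rule has_log_derivative_prod)
      fix \<nu> assume \<nu>: "\<nu> \<in> {1..N}"
      then show "((\<lambda>\<tau>. (1 - v \<nu> x) powr t \<nu> \<tau> * v \<nu> x ^ \<zeta> \<nu>) has_real_derivative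
          (1 - v \<nu> x) powr t \<nu> \<sigma> * v \<nu> x ^ \<zeta> \<nu> * (t' \<nu> \<sigma> * ln (1 - v \<nu> x))) (at \<sigma> within {0..1})"
        using v_unit[OF \<nu> x] unfolding powr_def
        by (auto intro!: derivative_eq_intros t_deriv[OF \<nu> \<sigma>])
    qed simp
    moreover have "weight \<sigma> \<zeta> x * (\<Sum>\<nu>\<in>{1..N}. t' \<nu> \<sigma> * ln (1 - v \<nu> x)) = W \<sigma> x"
      by (simp add: W_def sum_distrib_left mult_ac)
    ultimately show "((\<lambda>\<tau>. weight \<tau> \<zeta> x) has_real_derivative W \<sigma> x) (at \<sigma> within {0..1})"
      unfolding weight_def total_weight_def by simp
    show "\<bar>W \<sigma> x\<bar> \<le> B x"
      unfolding W_def B_def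
    proof (rule order_trans[OF sum_abs sum_mono])
      fix \<nu> assume \<nu>: "\<nu> \<in> {1..N}"
      have "\<bar>- t' \<nu> \<sigma> * (- ln (1 - v \<nu> x) * weight \<sigma> \<zeta> x)\<bar> = \<bar>t' \<nu> \<sigma>\<bar> * (- ln (1 - v \<nu> x) * weight \<sigma> \<zeta> x)"
        by (simp only: abs_mult[of "- t' \<nu> \<sigma>"] abs_of_nonneg[OF log_weight_nonneg[OF \<nu> x]] abs_minus_cancel)
      also have "\<dots> \<le> K * (- ln (1 - v \<nu> x) * weight 0 (\<lambda>_. 0) x)"
        using v_unit[OF \<nu> x] K(1) log_weight_nonneg[OF \<nu> x, of \<sigma> \<zeta>]
        by (intro mult_mono K(2) \<nu> \<sigma> weight_le x order_refl) (auto simp: less_imp_le[OF weight_pos[OF x]])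
      finally show "\<bar>- t' \<nu> \<sigma> * (- ln (1 - v \<nu> x) * weight \<sigma> \<zeta> x)\<bar> \<le> K * (- ln (1 - v \<nu> x) * weight 0 (\<lambda>_. 0) x)" .
    qed
  qed (use \<tau> in auto)
  moreover have "(\<integral>x. W \<tau> x \<partial>M) = - (\<Sum>\<nu>\<in>{1..N}. t' \<nu> \<tau> * log_integral \<tau> \<nu> \<zeta>)"
  proof -
    have "(\<integral>x. W \<tau> x \<partial>M) = (\<Sum>\<nu>\<in>{1..N}. - t' \<nu> \<tau> * log_integral \<tau> \<nu> \<zeta>)"
      unfolding W_def log_integral_def using log_weight_integrable[OF _ \<tau>]
      by (subst Bochner_Integration.integral_sum) (auto intro!: sum.cong integrable_mult_right simp del: mult_minus_left)
    then show ?thesis by (simp add: sum_negf)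
  qed
  ultimately show ?thesis by (simp add: J_def)
qed

lemma log_integral_continuous:
  assumes \<nu>: "\<nu> \<in> {1..N}"
  shows "continuous_on {0..1} (\<lambda>\<tau>. log_integral \<tau> \<nu> \<zeta>)"
  unfolding log_integral_def
proof (rule continuous_on_integral_dominated[where B = "\<lambda>x. - ln (1 - v \<nu> x) * weight 0 (\<lambda>_. 0) x"])
  show "(\<lambda>x. - ln (1 - v \<nu> x) * weight \<tau> \<zeta> x) \<in> borel_measurable M" for \<tau> using \<nu> by measurable
  show "integrable M (\<lambda>x. - ln (1 - v \<nu> x) * weight 0 (\<lambda>_. 0) x)" by (rule log_weight_integrable[OF \<nu>]) simp
  fix x assume x: "x \<in> space M"
  have "continuous_on {0..1} (t \<nu>')" if "\<nu>' \<in> {1..N}" for \<nu>'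
    using t_deriv[OF that] by (rule DERIV_continuous_on)
  then show "continuous_on {0..1} (\<lambda>\<tau>. - ln (1 - v \<nu> x) * weight \<tau> \<zeta> x)"
    unfolding weight_def total_weight_def using v_unit[OF _ x]
    by (intro continuous_intros) force+
  fix \<tau> assume \<tau>: "\<tau> \<in> {0..1 :: real}"
  show "\<bar>- ln (1 - v \<nu> x) * weight \<tau> \<zeta> x\<bar> \<le> - ln (1 - v \<nu> x) * weight 0 (\<lambda>_. 0) x"
    unfolding abs_of_nonneg[OF log_weight_nonneg[OF \<nu> x]]
    using v_unit[OF \<nu> x] by (intro mult_left_mono weight_le x \<tau>) auto
qed

lemma pmf_NB:
  assumes "\<tau> \<in> {0..1}" "\<And>\<nu>. \<nu> \<notin> {1..N} \<Longrightarrow> \<zeta> \<nu> = 0"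
  shows "pmf (NB \<tau>) \<zeta> = (\<Prod>\<nu>\<in>{1..N}. nb_mass (t \<nu> \<tau>) (P \<nu>) (\<zeta> \<nu>))"
  unfolding nb_product_def using assms(2)
  by (subst pmf_Pi')
    (auto intro!: prod.cong pmf_nb t_range(3)[OF _ assms(1)] simp: less_imp_le[OF conjunct1[OF P_unit]] P_unit)

lemma pmf_NB_outside:
  assumes "\<not> (\<forall>\<nu>. \<nu> \<notin> {1..N} \<longrightarrow> \<zeta> \<nu> = 0)"
  shows "pmf (NB \<tau>) \<zeta> = 0"
  unfolding nb_product_def using assms by (intro pmf_Pi_outside) auto

lemma pmf_NB_deriv:
  assumes \<tau>: "\<tau> \<in> {0..1}"
  shows "((\<lambda>\<tau>. pmf (NB \<tau>) \<zeta>) has_real_derivative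
           pmf (NB \<tau>) \<zeta> * (\<Sum>\<nu>\<in>{1..N}. t' \<nu> \<tau> * score \<tau> \<nu> \<zeta>)) (at \<tau> within {0..1})"
proof (cases "\<forall>\<nu>. \<nu> \<notin> {1..N} \<longrightarrow> \<zeta> \<nu> = 0")
  case True
  have "((\<lambda>\<tau>. \<Prod>\<nu>\<in>{1..N}. nb_mass (t \<nu> \<tau>) (P \<nu>) (\<zeta> \<nu>)) has_real_derivative
      (\<Prod>\<nu>\<in>{1..N}. nb_mass (t \<nu> \<tau>) (P \<nu>) (\<zeta> \<nu>)) * (\<Sum>\<nu>\<in>{1..N}. t' \<nu> \<tau> * score \<tau> \<nu> \<zeta>)) (at \<tau> within {0..1})"
  proof (rule has_log_derivative_prod)
    fix \<nu> assume \<nu>: "\<nu> \<in> {1..N}"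
    have "((\<lambda>t. nb_mass t (P \<nu>) (\<zeta> \<nu>)) has_real_derivative
        nb_mass (t \<nu> \<tau>) (P \<nu>) (\<zeta> \<nu>) * score \<tau> \<nu> \<zeta>) (at (t \<nu> \<tau>))"
      unfolding score_def using t_range(3)[OF \<nu> \<tau>] P_unit[OF \<nu>] by (intro has_derivative_nb_mass) auto
    from DERIV_chain2[OF this t_deriv[OF \<nu> \<tau>]]
    show "((\<lambda>\<tau>. nb_mass (t \<nu> \<tau>) (P \<nu>) (\<zeta> \<nu>)) has_real_derivative
      nb_mass (t \<nu> \<tau>) (P \<nu>) (\<zeta> \<nu>) * (t' \<nu> \<tau> * score \<tau> \<nu> \<zeta>)) (at \<tau> within {0..1})"
      by (simp add: mult_ac)
  qed simp
  then have "((\<lambda>\<tau>. \<Prod>\<nu>\<in>{1..N}. nb_mass (t \<nu> \<tau>) (P \<nu>) (\<zeta> \<nu>)) has_real_derivative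
      pmf (NB \<tau>) \<zeta> * (\<Sum>\<nu>\<in>{1..N}. t' \<nu> \<tau> * score \<tau> \<nu> \<zeta>)) (at \<tau> within {0..1})"
    using pmf_NB[OF \<tau>, of \<zeta>] True by simp
  then show ?thesis
    by (rule has_field_derivative_transform_within[where d = 1]) (use \<tau> pmf_NB[of _ \<zeta>] True in auto)
next
  case False
  then show ?thesis using pmf_NB_outside[of \<zeta>] by simp
qed

lemma score_continuous:
  assumes \<nu>: "\<nu> \<in> {1..N}"
  shows "continuous_on {0..1} (\<lambda>\<tau>. score \<tau> \<nu> \<zeta>)"
  unfolding score_def
proof (intro continuous_intros ballI)
  show "continuous_on {0..1} (t \<nu>)" using t_deriv[OF \<nu>] by (rule DERIV_continuous_on)
  fix i \<tau> assume "\<tau> \<in> {0..1 :: real}"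
  then show "t \<nu> \<tau> + real i \<noteq> 0" using t_range(3)[OF \<nu>, of \<tau>] by auto
qed

lemma integrand_bound:
  "\<exists>C\<ge>0. \<forall>\<nu>\<in>{1..N}. \<forall>\<tau>\<in>{0..1}. \<forall>\<zeta>. \<bar>integrand \<tau> \<nu> \<zeta>\<bar> \<le> C * (1 + grand_total N \<zeta>)\<^sup>2"
proof -
  obtain A where A: "0 \<le> A" "\<And>\<tau> \<zeta>. \<tau> \<in> {0..1} \<Longrightarrow> \<bar>ln (J \<tau> \<zeta>)\<bar> \<le> A * (1 + grand_total N \<zeta>)"
    using log_J_bound by blast
  obtain B where B: "0 \<le> B" "\<And>\<nu> \<tau> \<zeta>. \<nu> \<in> {1..N} \<Longrightarrow> \<tau> \<in> {0..1} \<Longrightarrow> \<bar>score \<tau> \<nu> \<zeta>\<bar> \<le> B * (1 + grand_total N \<zeta>)"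
    using score_bound by blast
  obtain D where D: "0 \<le> D" "\<And>\<nu> \<tau> \<zeta>. \<nu> \<in> {1..N} \<Longrightarrow> \<tau> \<in> {0..1} \<Longrightarrow>
      log_integral \<tau> \<nu> \<zeta> / J \<tau> \<zeta> \<le> D * (1 + grand_total N \<zeta>)"
    using log_integral_bound by blast
  show ?thesis
  proof (intro exI[of _ "B * A + D"] conjI ballI allI)
    show "0 \<le> B * A + D" using A B D by simp
    fix \<nu> \<tau> \<zeta> assume \<nu>: "\<nu> \<in> {1..N}" and \<tau>: "\<tau> \<in> {0..1 :: real}"
    have "\<bar>score \<tau> \<nu> \<zeta> * ln (J \<tau> \<zeta>)\<bar> \<le> (B * (1 + grand_total N \<zeta>)) * (A * (1 + grand_total N \<zeta>))"
      unfolding abs_mult by (intro mult_mono A(2)[OF \<tau>] B(2)[OF \<nu> \<tau>]) (auto intro!: mult_nonneg_nonneg B(1))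
    also have "\<dots> = B * A * (1 + grand_total N \<zeta>)\<^sup>2" by (simp add: power2_eq_square mult_ac)
    finally have 1: "\<bar>score \<tau> \<nu> \<zeta> * ln (J \<tau> \<zeta>)\<bar> \<le> B * A * (1 + grand_total N \<zeta>)\<^sup>2" .
    have "0 \<le> log_integral \<tau> \<nu> \<zeta> / J \<tau> \<zeta>"
      using log_integral_nonneg[OF \<nu>] J_pos[OF \<tau>, of \<zeta>] by (intro divide_nonneg_pos)
    moreover have "log_integral \<tau> \<nu> \<zeta> / J \<tau> \<zeta> \<le> D * (1 + grand_total N \<zeta>)\<^sup>2"
      by (rule order_trans[OF D(2)[OF \<nu> \<tau>] linear_le_square[OF D(1)]])
    ultimately show "\<bar>integrand \<tau> \<nu> \<zeta>\<bar> \<le> (B * A + D) * (1 + grand_total N \<zeta>)\<^sup>2"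
      using 1 unfolding integrand_def distrib_right by linarith
  qed
qed

lemma integrand_continuous:
  assumes \<nu>: "\<nu> \<in> {1..N}"
  shows "continuous_on {0..1} (\<lambda>\<tau>. integrand \<tau> \<nu> \<zeta>)"
proof -
  have "continuous_on {0..1} (\<lambda>\<tau>. J \<tau> \<zeta>)" using J_deriv by (rule DERIV_continuous_on)
  then show ?thesis unfolding integrand_def
    using J_pos by (intro continuous_intros score_continuous log_integral_continuous \<nu>) (auto simp: less_imp_neq[symmetric])
qed

text \<open>
  The expectation is written as an integral against counting measure, so that the mass and \<open>ln J\<close>
  can be differentiated together for each fixed value of the totals. The derivatives are bounded by a
  multiple of one probability mass, uniformly in \<open>\<tau>\<close>.
\<close>

lemma expectation_log_J_FTC:
  shows "set_integrable lborel {0..1} (\<lambda>\<tau>. \<Sum>\<nu>\<in>{1..N}. t' \<nu> \<tau> * drift \<tau> \<nu>)"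
    and "(LINT \<tau>:{0..1}|lborel. (\<Sum>\<nu>\<in>{1..N}. t' \<nu> \<tau> * drift \<tau> \<nu>))
       = expect 1 (\<lambda>\<zeta>. ln (J 1 \<zeta>)) - expect 0 (\<lambda>\<zeta>. ln (J 0 \<zeta>))"
proof -
  obtain K where K: "0 \<le> K" "\<And>\<nu> \<tau>. \<nu> \<in> {1..N} \<Longrightarrow> \<tau> \<in> {0..1} \<Longrightarrow> \<bar>t' \<nu> \<tau>\<bar> \<le> K"
    using t'_bound by blast
  obtain A where A: "0 \<le> A" "\<And>\<nu> \<tau> \<zeta>. \<nu> \<in> {1..N} \<Longrightarrow> \<tau> \<in> {0..1} \<Longrightarrow>
      \<bar>integrand \<tau> \<nu> \<zeta>\<bar> \<le> A * (1 + grand_total N \<zeta>)\<^sup>2"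
    using integrand_bound by blast
  have "\<exists>C Q. 0 \<le> C \<and> (\<forall>s z. (\<forall>\<nu>\<in>{1..N}. 0 < s \<nu> \<and> s \<nu> \<le> t \<nu> 1) \<longrightarrow>
           (1 + grand_total N z)\<^sup>2 * pmf (nb_product N s P) z \<le> C * pmf Q z)"
    by (rule nb_product_dominated) (use P_unit t_range(3)[of _ 1] in auto)
  then obtain C Q where "0 \<le> C" and "\<forall>s z. (\<forall>\<nu>\<in>{1..N}. 0 < s \<nu> \<and> s \<nu> \<le> t \<nu> 1) \<longrightarrow>
           (1 + grand_total N z)\<^sup>2 * pmf (nb_product N s P) z \<le> C * pmf Q z"
    by (elim exE conjE)
  then have Q: "(1 + grand_total N \<zeta>)\<^sup>2 * pmf (NB \<tau>) \<zeta> \<le> C * pmf Q \<zeta>" if "\<tau> \<in> {0..1}" for \<tau> \<zeta>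
    using t_range(2,3)[OF _ that] by simp
  define F where "F = (\<lambda>\<tau> \<zeta>. pmf (NB \<tau>) \<zeta> * ln (J \<tau> \<zeta>))"
  define F' where "F' = (\<lambda>\<tau> \<zeta>. pmf (NB \<tau>) \<zeta> * (\<Sum>\<nu>\<in>{1..N}. t' \<nu> \<tau> * integrand \<tau> \<nu> \<zeta>))"
  define B where "B = (\<lambda>\<zeta>. real N * (K * A) * (C * pmf Q \<zeta>))"
  have Bint: "integrable (count_space UNIV) B"
    unfolding B_def by (intro integrable_mult_right integrable_pmf_count_space)
  have bnd: "\<bar>F' \<tau> \<zeta>\<bar> \<le> B \<zeta>" if \<tau>: "\<tau> \<in> {0..1}" for \<tau> \<zeta>
  proof -
    have "\<bar>\<Sum>\<nu>\<in>{1..N}. t' \<nu> \<tau> * integrand \<tau> \<nu> \<zeta>\<bar> \<le> (\<Sum>\<nu>\<in>{1..N}. K * (A * (1 + grand_total N \<zeta>)\<^sup>2))"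
    proof (rule order_trans[OF sum_abs sum_mono])
      fix \<nu> assume \<nu>: "\<nu> \<in> {1..N}"
      show "\<bar>t' \<nu> \<tau> * integrand \<tau> \<nu> \<zeta>\<bar> \<le> K * (A * (1 + grand_total N \<zeta>)\<^sup>2)"
        unfolding abs_mult by (intro mult_mono K(1) K(2)[OF \<nu> \<tau>] A(2)[OF \<nu> \<tau>]) auto
    qed
    also have "\<dots> = real N * (K * A) * (1 + grand_total N \<zeta>)\<^sup>2" by simp
    finally have "\<bar>F' \<tau> \<zeta>\<bar> \<le> pmf (NB \<tau>) \<zeta> * (real N * (K * A) * (1 + grand_total N \<zeta>)\<^sup>2)"
      unfolding F'_def abs_mult abs_of_nonneg[OF pmf_nonneg] by (intro mult_left_mono pmf_nonneg)
    also have "\<dots> = real N * (K * A) * ((1 + grand_total N \<zeta>)\<^sup>2 * pmf (NB \<tau>) \<zeta>)" by (simp add: mult_ac)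
    also have "\<dots> \<le> B \<zeta>" unfolding B_def using K(1) A(1) by (intro mult_left_mono Q \<tau>) auto
    finally show ?thesis .
  qed
  have F_deriv: "((\<lambda>\<tau>. F \<tau> \<zeta>) has_real_derivative F' \<tau> \<zeta>) (at \<tau> within {0..1})"
    if \<tau>: "\<tau> \<in> {0..1}" for \<tau> \<zeta>
  proof -
    have "((\<lambda>\<tau>. ln (J \<tau> \<zeta>)) has_real_derivative
        1 / J \<tau> \<zeta> * - (\<Sum>\<nu>\<in>{1..N}. t' \<nu> \<tau> * log_integral \<tau> \<nu> \<zeta>)) (at \<tau> within {0..1})"
      by (rule DERIV_chain2[OF DERIV_ln_divide[OF J_pos[OF \<tau>]] J_deriv[OF \<tau>]])
    from DERIV_mult[OF pmf_NB_deriv[OF \<tau>, of \<zeta>] this]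
    show ?thesis unfolding F_def F'_def
      by (rule DERIV_cong)
        (simp add: integrand_def sum_distrib_left sum_distrib_right sum_subtractf[symmetric] sum_negf[symmetric] sum.distrib[symmetric]
           sum_divide_distrib algebra_simps)
  qed
  have drift_eq: "(\<integral>\<zeta>. F' \<tau> \<zeta> \<partial>count_space UNIV) = (\<Sum>\<nu>\<in>{1..N}. t' \<nu> \<tau> * drift \<tau> \<nu>)"
    if \<tau>: "\<tau> \<in> {0..1}" for \<tau>
  proof -
    have int: "integrable (NB \<tau>) (integrand \<tau> \<nu>)" if "\<nu> \<in> {1..N}" for \<nu>
      by (rule NB_integrable[OF \<tau>]) (rule A(2)[OF that \<tau>])
    have "(\<integral>\<zeta>. F' \<tau> \<zeta> \<partial>count_space UNIV)
        = expect \<tau> (\<lambda>\<zeta>. \<Sum>\<nu>\<in>{1..N}. t' \<nu> \<tau> * integrand \<tau> \<nu> \<zeta>)"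
      unfolding F'_def by (rule expectation_eq_count_space[symmetric])
    also have "\<dots> = (\<Sum>\<nu>\<in>{1..N}. t' \<nu> \<tau> * drift \<tau> \<nu>)"
      using int by (subst Bochner_Integration.integral_sum) (auto simp: drift_def)
    finally show ?thesis .
  qed
  have G_deriv: "((\<lambda>\<tau>. \<integral>\<zeta>. F \<tau> \<zeta> \<partial>count_space UNIV) has_real_derivative (\<integral>\<zeta>. F' \<tau> \<zeta> \<partial>count_space UNIV)) (at \<tau> within {0..1})"
    if \<tau>: "\<tau> \<in> {0..1}" for \<tau>
  proof (rule has_derivative_integral_dominated[where B = B])
    show "integrable (count_space UNIV) (F \<sigma>)" if "\<sigma> \<in> {0..1}" for \<sigma>
      unfolding F_def integrable_pmf_iff_count_space[symmetric] by (rule log_J_integrable[OF that])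
  qed (use \<tau> F_deriv bnd Bint in auto)
  have G_cont: "continuous_on {0..1} (\<lambda>\<tau>. \<integral>\<zeta>. F' \<tau> \<zeta> \<partial>count_space UNIV)"
  proof (rule continuous_on_integral_dominated[where B = B])
    show "continuous_on {0..1} (\<lambda>\<tau>. F' \<tau> \<zeta>)" for \<zeta>
      unfolding F'_def using DERIV_continuous_on[OF pmf_NB_deriv]
      by (intro continuous_intros integrand_continuous t'_cont) auto
  qed (use bnd Bint in auto)
  then have cont: "continuous_on {0..1} (\<lambda>\<tau>. \<Sum>\<nu>\<in>{1..N}. t' \<nu> \<tau> * drift \<tau> \<nu>)"
    by (rule continuous_on_eq) (rule drift_eq)
  then show "set_integrable lborel {0..1} (\<lambda>\<tau>. \<Sum>\<nu>\<in>{1..N}. t' \<nu> \<tau> * drift \<tau> \<nu>)"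
    by (rule borel_integrable_atLeastAtMost')
  have "(LINT \<tau>:{0..1}|lborel. (\<Sum>\<nu>\<in>{1..N}. t' \<nu> \<tau> * drift \<tau> \<nu>))
      = (\<integral>\<zeta>. F 1 \<zeta> \<partial>count_space UNIV) - (\<integral>\<zeta>. F 0 \<zeta> \<partial>count_space UNIV)"
    unfolding set_lebesgue_integral_def
    using G_deriv drift_eq
    by (intro integral_FTC_atLeastAtMost cont) (auto simp: has_real_derivative_iff_has_vector_derivative)
  then show "(LINT \<tau>:{0..1}|lborel. (\<Sum>\<nu>\<in>{1..N}. t' \<nu> \<tau> * drift \<tau> \<nu>))
       = expect 1 (\<lambda>\<zeta>. ln (J 1 \<zeta>)) - expect 0 (\<lambda>\<zeta>. ln (J 0 \<zeta>))"
    by (simp add: F_def expectation_eq_count_space)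
qed

lemma pmf_map_shift:
  "pmf (map_pmf (\<lambda>\<zeta>. \<zeta>(\<nu> := \<zeta> \<nu> + k)) p) \<zeta>
     = (if k \<le> \<zeta> \<nu> then pmf p (\<zeta>(\<nu> := \<zeta> \<nu> - k)) else 0)"
  for p :: "(nat \<Rightarrow> nat) pmf"
proof (cases "k \<le> \<zeta> \<nu>")
  case True
  have inj: "inj (\<lambda>\<zeta> :: nat \<Rightarrow> nat. \<zeta>(\<nu> := \<zeta> \<nu> + k))"
    by (rule injI) (metis add_right_cancel fun_upd_same fun_upd_triv fun_upd_upd)
  have "pmf (map_pmf (\<lambda>\<zeta>. \<zeta>(\<nu> := \<zeta> \<nu> + k)) p) ((\<lambda>\<zeta>. \<zeta>(\<nu> := \<zeta> \<nu> + k)) (\<zeta>(\<nu> := \<zeta> \<nu> - k))) = pmf p (\<zeta>(\<nu> := \<zeta> \<nu> - k))"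
    by (rule pmf_map_inj'[OF inj])
  then show ?thesis using True by simp
next
  case False
  then have "\<zeta> \<notin> (\<lambda>\<zeta>. \<zeta>(\<nu> := \<zeta> \<nu> + k)) ` set_pmf p" by auto
  then show ?thesis using False by (simp add: pmf_map_outside)
qed

text \<open>
  The forward equation of one component, multiplied by the masses of the others. Read as masses of
  the shifted law, the downward shifts turn into upward shifts of the integrand.
\<close>

lemma score_sums:
  assumes \<tau>: "\<tau> \<in> {0..1}" and \<nu>: "\<nu> \<in> {1..N}"
  shows "(\<lambda>k. P \<nu> ^ Suc k / real (Suc k) *
            (pmf (map_pmf (\<lambda>\<zeta>. \<zeta>(\<nu> := \<zeta> \<nu> + Suc k)) (NB \<tau>)) \<zeta> - pmf (NB \<tau>) \<zeta>))
         sums (pmf (NB \<tau>) \<zeta> * score \<tau> \<nu> \<zeta>)"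
proof (cases "\<forall>\<nu>. \<nu> \<notin> {1..N} \<longrightarrow> \<zeta> \<nu> = 0")
  case True
  define R where "R = (\<Prod>\<nu>'\<in>{1..N} - {\<nu>}. nb_mass (t \<nu>' \<tau>) (P \<nu>') (\<zeta> \<nu>'))"
  have R: "pmf (NB \<tau>) (\<zeta>(\<nu> := j)) = nb_mass (t \<nu> \<tau>) (P \<nu>) j * R" for j
  proof -
    have "(\<Prod>\<nu>'\<in>{1..N} - {\<nu>}. nb_mass (t \<nu>' \<tau>) (P \<nu>') ((\<zeta>(\<nu> := j)) \<nu>')) = R"
      unfolding R_def by (intro prod.cong) auto
    moreover have "\<nu>' \<notin> {1..N} \<Longrightarrow> (\<zeta>(\<nu> := j)) \<nu>' = 0" for \<nu>' using True \<nu> by auto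
    ultimately show ?thesis
      using \<nu> by (subst pmf_NB[OF \<tau>]) (auto simp: prod.remove[of _ \<nu>])
  qed
  have R0: "pmf (NB \<tau>) \<zeta> = nb_mass (t \<nu> \<tau>) (P \<nu>) (\<zeta> \<nu>) * R" using R[of "\<zeta> \<nu>"] by simp
  have "(\<lambda>k. P \<nu> ^ Suc k / real (Suc k) *
      ((if Suc k \<le> \<zeta> \<nu> then nb_mass (t \<nu> \<tau>) (P \<nu>) (\<zeta> \<nu> - Suc k) else 0) - nb_mass (t \<nu> \<tau>) (P \<nu>) (\<zeta> \<nu>)) * R)
      sums (nb_mass (t \<nu> \<tau>) (P \<nu>) (\<zeta> \<nu>) * score \<tau> \<nu> \<zeta> * R)"
    unfolding score_def using t_range(3)[OF \<nu> \<tau>] P_unit[OF \<nu>] by (intro sums_mult2 nb_mass_sums_shift) auto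
  also have "(\<lambda>k. P \<nu> ^ Suc k / real (Suc k) *
      ((if Suc k \<le> \<zeta> \<nu> then nb_mass (t \<nu> \<tau>) (P \<nu>) (\<zeta> \<nu> - Suc k) else 0) - nb_mass (t \<nu> \<tau>) (P \<nu>) (\<zeta> \<nu>)) * R)
    = (\<lambda>k. P \<nu> ^ Suc k / real (Suc k) *
            (pmf (map_pmf (\<lambda>\<zeta>. \<zeta>(\<nu> := \<zeta> \<nu> + Suc k)) (NB \<tau>)) \<zeta> - pmf (NB \<tau>) \<zeta>))"
    unfolding pmf_map_shift R R0 by (intro ext) (simp add: algebra_simps del: of_nat_Suc power_Suc)
  also have "nb_mass (t \<nu> \<tau>) (P \<nu>) (\<zeta> \<nu>) * score \<tau> \<nu> \<zeta> * R = pmf (NB \<tau>) \<zeta> * score \<tau> \<nu> \<zeta>"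
    by (simp add: R0 mult_ac)
  finally show ?thesis .
next
  case False
  then have "\<not> (\<forall>\<nu>'. \<nu>' \<notin> {1..N} \<longrightarrow> (\<zeta>(\<nu> := j)) \<nu>' = 0)" for j
    using \<nu> by (metis fun_upd_other)
  then have "pmf (NB \<tau>) (\<zeta>(\<nu> := j)) = 0" for j by (rule pmf_NB_outside)
  then show ?thesis
    unfolding pmf_map_shift using pmf_NB_outside[OF False] by (simp del: fun_upd_apply cong: if_cong)
qed

text \<open>
  Summation by parts: integrating \<open>score_sums\<close> term by term against \<open>ln J\<close>. The exchange is
  absolutely convergent, since \<open>ln J\<close> grows at most linearly and jumps of size \<open>k\<close> have weight
  \<open>P \<nu> ^ k / k\<close>.
\<close>

lemma expectation_score_log_J_sums:
  assumes \<tau>: "\<tau> \<in> {0..1}" and \<nu>: "\<nu> \<in> {1..N}"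
  shows "(\<lambda>k. P \<nu> ^ Suc k / real (Suc k) * expect \<tau> (\<lambda>\<zeta>. ln (moment \<tau> \<nu> (Suc k) \<zeta>)))
     sums expect \<tau> (\<lambda>\<zeta>. score \<tau> \<nu> \<zeta> * ln (J \<tau> \<zeta>))"
proof -
  obtain C where C: "0 \<le> C" "\<And>\<zeta>. \<bar>ln (J \<tau> \<zeta>)\<bar> \<le> C * (1 + grand_total N \<zeta>)"
    using log_J_bound \<tau> by blast
  have p: "0 < P \<nu>" "P \<nu> < 1" using P_unit[OF \<nu>] by auto
  have p_le: "P \<nu> ^ Suc k / real (Suc k) \<le> P \<nu> ^ Suc k" for k
    using p by (simp add: divide_le_eq mult_le_cancel_left1 del: power_Suc)
  let ?sh = "\<lambda>k \<zeta>. \<zeta>(\<nu> := \<zeta> \<nu> + Suc k)"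
  define l where "l = (\<lambda>\<zeta>. ln (J \<tau> \<zeta>))"
  define Q where "Q = (\<lambda>k. map_pmf (?sh k) (NB \<tau>))"
  define f where "f = (\<lambda>k \<zeta>. P \<nu> ^ Suc k / real (Suc k) * (pmf (Q k) \<zeta> * l \<zeta> - pmf (NB \<tau>) \<zeta> * l \<zeta>))"
  define h where "h = (\<lambda>k \<zeta>. P \<nu> ^ Suc k * (pmf (Q k) \<zeta> * \<bar>l \<zeta>\<bar> + pmf (NB \<tau>) \<zeta> * \<bar>l \<zeta>\<bar>))"
  have shift: "measure_pmf.expectation (Q k) g = expect \<tau> (\<lambda>\<zeta>. g (?sh k \<zeta>))" for k and g :: "_ \<Rightarrow> real"
    unfolding Q_def by (simp del: fun_upd_apply)
  have lsh: "integrable (NB \<tau>) (\<lambda>\<zeta>. l (?sh k \<zeta>))" for k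
    unfolding l_def by (rule log_J_shift_integrable[OF \<tau> \<nu>])
  have lQ: "integrable (Q k) l" for k unfolding Q_def integrable_map_pmf_eq by (rule lsh)
  have lN: "integrable (NB \<tau>) l" unfolding l_def by (rule log_J_integrable[OF \<tau>])
  note cs = lQ[unfolded integrable_pmf_iff_count_space] lN[unfolded integrable_pmf_iff_count_space]
    integrable_abs[OF lQ, unfolded integrable_pmf_iff_count_space] integrable_abs[OF lN, unfolded integrable_pmf_iff_count_space]
  have f_int: "integrable (count_space UNIV) (f k)" and h_int: "integrable (count_space UNIV) (h k)" for k
    unfolding f_def h_def
    by (intro integrable_mult_right Bochner_Integration.integrable_diff Bochner_Integration.integrable_add cs)+
  have f_le: "norm (f k \<zeta>) \<le> h k \<zeta>" for k \<zeta>
  proof -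
    have "norm (f k \<zeta>) = P \<nu> ^ Suc k / real (Suc k) * \<bar>pmf (Q k) \<zeta> * l \<zeta> - pmf (NB \<tau>) \<zeta> * l \<zeta>\<bar>"
      unfolding f_def real_norm_def abs_mult[of "P \<nu> ^ Suc k / real (Suc k)"] using p by simp
    also have "\<dots> \<le> h k \<zeta>"
      unfolding h_def using p p_le[of k] abs_triangle_ineq4[of "pmf (Q k) \<zeta> * l \<zeta>" "pmf (NB \<tau>) \<zeta> * l \<zeta>"]
      by (intro mult_mono) (simp_all add: abs_mult)
    finally show ?thesis .
  qed
  have geo: "summable (\<lambda>k. P \<nu> ^ Suc k)" "summable (\<lambda>k. real (Suc k) * P \<nu> ^ Suc k)"
    using p summable_mult[OF sums_summable[OF geometric_deriv_sums[of "P \<nu>"]], of "P \<nu>"]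
    by (simp_all add: summable_geometric mult_ac)
  have "(\<lambda>k. \<integral>\<zeta>. f k \<zeta> \<partial>count_space UNIV) sums (\<integral>\<zeta>. (\<Sum>k. f k \<zeta>) \<partial>count_space UNIV)"
  proof (rule sums_integral)
    show "AE \<zeta> in count_space UNIV. summable (\<lambda>k. norm (f k \<zeta>))"
    proof (intro AE_I2, rule summable_comparison_test'[where N = 0])
      fix \<zeta> :: "nat \<Rightarrow> nat" and k
      show "summable (\<lambda>k. P \<nu> ^ Suc k * (2 * \<bar>l \<zeta>\<bar>))" by (rule summable_mult2[OF geo(1)])
      have "h k \<zeta> \<le> P \<nu> ^ Suc k * (1 * \<bar>l \<zeta>\<bar> + 1 * \<bar>l \<zeta>\<bar>)"
        unfolding h_def using p by (intro mult_left_mono add_mono mult_right_mono pmf_le_1) auto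
      then show "norm (norm (f k \<zeta>)) \<le> P \<nu> ^ Suc k * (2 * \<bar>l \<zeta>\<bar>)" using f_le[of k \<zeta>] by simp
    qed
    define E where "E = expect \<tau> (grand_total N)"
    have g: "integrable (NB \<tau>) (grand_total N)"
      by (rule NB_integrable[OF \<tau>, where C = 1]) (simp add: power2_eq_square algebra_simps)
    have val: "expect \<tau> (\<lambda>\<zeta>. C * (1 + (grand_total N \<zeta> + c))) = C * (1 + (E + c))" for c
      using g by (simp add: E_def)
    have h_le: "(\<integral>\<zeta>. h k \<zeta> \<partial>count_space UNIV) \<le> P \<nu> ^ Suc k * (2 * C * (1 + E)) + C * (real (Suc k) * P \<nu> ^ Suc k)" for k
    proof -
      have "(\<integral>\<zeta>. h k \<zeta> \<partial>count_space UNIV) = P \<nu> ^ Suc k * (expect \<tau> (\<lambda>\<zeta>. \<bar>l (?sh k \<zeta>)\<bar>) + expect \<tau> (\<lambda>\<zeta>. \<bar>l \<zeta>\<bar>))"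
        unfolding h_def integral_mult_right_zero Bochner_Integration.integral_add[OF cs(3,4)]
        by (simp only: expectation_eq_count_space[symmetric] shift)
      also have "\<dots> \<le> P \<nu> ^ Suc k * (expect \<tau> (\<lambda>\<zeta>. C * (1 + (grand_total N \<zeta> + real (Suc k)))) + expect \<tau> (\<lambda>\<zeta>. C * (1 + (grand_total N \<zeta> + 0))))"
      proof (intro mult_left_mono add_mono integral_mono integrable_abs lsh lN)
        show "\<bar>l (?sh k \<zeta>)\<bar> \<le> C * (1 + (grand_total N \<zeta> + real (Suc k)))" for \<zeta>
          using C(2)[of "?sh k \<zeta>"] unfolding l_def grand_total_shift[OF \<nu>] .
      qed (use C(2) p g in \<open>auto simp: l_def\<close>)
      finally show ?thesis unfolding val by (simp add: algebra_simps del: of_nat_Suc power_Suc)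
    qed
    show "summable (\<lambda>k. \<integral>\<zeta>. norm (f k \<zeta>) \<partial>count_space UNIV)"
    proof (rule summable_comparison_test'[where N = 0])
      show "summable (\<lambda>k. P \<nu> ^ Suc k * (2 * C * (1 + E)) + C * (real (Suc k) * P \<nu> ^ Suc k))"
        by (intro summable_add summable_mult summable_mult2 geo)
      fix k
      have "(\<integral>\<zeta>. norm (f k \<zeta>) \<partial>count_space UNIV) \<le> (\<integral>\<zeta>. h k \<zeta> \<partial>count_space UNIV)"
        by (intro integral_mono integrable_norm f_int h_int f_le)
      then show "norm (\<integral>\<zeta>. norm (f k \<zeta>) \<partial>count_space UNIV)
          \<le> P \<nu> ^ Suc k * (2 * C * (1 + E)) + C * (real (Suc k) * P \<nu> ^ Suc k)"
        using h_le[of k] by (simp add: abs_of_nonneg integral_nonneg_AE)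
    qed
  qed (rule f_int)
  also have "(\<lambda>k. \<integral>\<zeta>. f k \<zeta> \<partial>count_space UNIV)
      = (\<lambda>k. P \<nu> ^ Suc k / real (Suc k) * expect \<tau> (\<lambda>\<zeta>. ln (moment \<tau> \<nu> (Suc k) \<zeta>)))"
  proof
    fix k
    have "(\<integral>\<zeta>. f k \<zeta> \<partial>count_space UNIV) = P \<nu> ^ Suc k / real (Suc k) * (expect \<tau> (\<lambda>\<zeta>. l (?sh k \<zeta>)) - expect \<tau> l)"
      unfolding f_def integral_mult_right_zero Bochner_Integration.integral_diff[OF cs(1,2)]
      by (simp only: expectation_eq_count_space[symmetric] shift)
    then show "(\<integral>\<zeta>. f k \<zeta> \<partial>count_space UNIV) = P \<nu> ^ Suc k / real (Suc k) * expect \<tau> (\<lambda>\<zeta>. ln (moment \<tau> \<nu> (Suc k) \<zeta>))"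
      unfolding ln_moment[OF \<tau>] using Bochner_Integration.integral_diff[OF lsh lN] by (simp only: l_def)
  qed
  also have "(\<integral>\<zeta>. (\<Sum>k. f k \<zeta>) \<partial>count_space UNIV) = (\<integral>\<zeta>. pmf (NB \<tau>) \<zeta> * (score \<tau> \<nu> \<zeta> * l \<zeta>) \<partial>count_space UNIV)"
  proof (intro Bochner_Integration.integral_cong refl)
    fix \<zeta>
    have "(\<lambda>k. P \<nu> ^ Suc k / real (Suc k) * (pmf (Q k) \<zeta> - pmf (NB \<tau>) \<zeta>) * l \<zeta>) sums (pmf (NB \<tau>) \<zeta> * score \<tau> \<nu> \<zeta> * l \<zeta>)"
      unfolding Q_def by (intro sums_mult2 score_sums \<tau> \<nu>)
    then have "(\<lambda>k. f k \<zeta>) sums (pmf (NB \<tau>) \<zeta> * (score \<tau> \<nu> \<zeta> * l \<zeta>))"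
      by (simp only: f_def mult.assoc left_diff_distrib)
    then show "(\<Sum>k. f k \<zeta>) = pmf (NB \<tau>) \<zeta> * (score \<tau> \<nu> \<zeta> * l \<zeta>)" by (rule sums_unique[symmetric])
  qed
  finally show ?thesis unfolding l_def expectation_eq_count_space[of "NB \<tau>" "\<lambda>\<zeta>. score \<tau> \<nu> \<zeta> * ln (J \<tau> \<zeta>)"] .
qed

lemma log_integral_ratio_integrable:
  assumes \<tau>: "\<tau> \<in> {0..1}" and \<nu>: "\<nu> \<in> {1..N}"
  shows "integrable (NB \<tau>) (\<lambda>\<zeta>. log_integral \<tau> \<nu> \<zeta> / J \<tau> \<zeta>)"
proof -
  obtain D where D: "0 \<le> D" "\<And>\<zeta>. log_integral \<tau> \<nu> \<zeta> / J \<tau> \<zeta> \<le> D * (1 + grand_total N \<zeta>)"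
    using log_integral_bound \<tau> \<nu> by blast
  show ?thesis
  proof (rule NB_integrable[OF \<tau>])
    fix \<zeta>
    have "0 \<le> log_integral \<tau> \<nu> \<zeta> / J \<tau> \<zeta>"
      using log_integral_nonneg[OF \<nu>] J_pos[OF \<tau>, of \<zeta>] by (intro divide_nonneg_pos)
    then show "\<bar>log_integral \<tau> \<nu> \<zeta> / J \<tau> \<zeta>\<bar> \<le> D * (1 + grand_total N \<zeta>)\<^sup>2"
      using order_trans[OF D(2) linear_le_square[OF D(1)], of \<zeta>] by (simp only: abs_of_nonneg)
  qed
qed

lemma expectation_moment_sums:
  assumes \<tau>: "\<tau> \<in> {0..1}" and \<nu>: "\<nu> \<in> {1..N}"
  shows "(\<lambda>k. 1 / real (Suc k) * expect \<tau> (moment \<tau> \<nu> (Suc k)))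
     sums expect \<tau> (\<lambda>\<zeta>. log_integral \<tau> \<nu> \<zeta> / J \<tau> \<zeta>)"
proof -
  define S where "S = (\<lambda>n \<zeta>. \<Sum>k<n. moment \<tau> \<nu> (Suc k) \<zeta> / real (Suc k))"
  have "(\<lambda>n. expect \<tau> (S n))
      \<longlonglongrightarrow> expect \<tau> (\<lambda>\<zeta>. log_integral \<tau> \<nu> \<zeta> / J \<tau> \<zeta>)"
  proof (rule integral_dominated_convergence[where w = "\<lambda>\<zeta>. log_integral \<tau> \<nu> \<zeta> / J \<tau> \<zeta>"])
    show "integrable (NB \<tau>) (\<lambda>\<zeta>. log_integral \<tau> \<nu> \<zeta> / J \<tau> \<zeta>)"
      by (rule log_integral_ratio_integrable[OF \<tau> \<nu>])
    show "AE \<zeta> in NB \<tau>. (\<lambda>n. S n \<zeta>) \<longlonglongrightarrow> log_integral \<tau> \<nu> \<zeta> / J \<tau> \<zeta>"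
      using moment_sums[OF \<tau> \<nu>] by (intro AE_I2) (simp add: sums_def S_def)
    show "AE \<zeta> in NB \<tau>. norm (S n \<zeta>) \<le> log_integral \<tau> \<nu> \<zeta> / J \<tau> \<zeta>" for n
    proof (intro AE_I2)
      fix \<zeta>
      have nn: "0 \<le> moment \<tau> \<nu> (Suc k) \<zeta> / real (Suc k)" for k
        using moment_pos[OF \<tau>, of \<nu> "Suc k" \<zeta>] by simp
      note s = moment_sums[OF \<tau> \<nu>, of \<zeta>]
      have "norm (S n \<zeta>) = S n \<zeta>" unfolding S_def real_norm_def by (intro abs_of_nonneg sum_nonneg nn)
      also have "\<dots> \<le> log_integral \<tau> \<nu> \<zeta> / J \<tau> \<zeta>"
        unfolding S_def sums_unique[OF s] by (intro sum_le_suminf sums_summable[OF s] nn ballI) auto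
      finally show "norm (S n \<zeta>) \<le> log_integral \<tau> \<nu> \<zeta> / J \<tau> \<zeta>" .
    qed
  qed auto
  moreover have "expect \<tau> (S n)
      = (\<Sum>k<n. 1 / real (Suc k) * expect \<tau> (moment \<tau> \<nu> (Suc k)))" for n
    unfolding S_def using moment_integrable[OF \<tau> \<nu>] by (simp del: of_nat_Suc)
  ultimately show ?thesis by (simp add: sums_def)
qed

text \<open>
  The two series for the law and for \<open>J\<close> combined; the terms are Kullback-Leibler losses up to sign
  and a constant.
\<close>

lemma drift_sums:
  assumes \<tau>: "\<tau> \<in> {0..1}" and \<nu>: "\<nu> \<in> {1..N}"
  shows "(\<lambda>k. 1 / real (Suc k) * expect \<tau>
            (\<lambda>\<zeta>. P \<nu> ^ Suc k * ln (moment \<tau> \<nu> (Suc k) \<zeta>) - moment \<tau> \<nu> (Suc k) \<zeta>))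
     sums drift \<tau> \<nu>"
proof -
  have li: "integrable (NB \<tau>) (\<lambda>\<zeta>. log_integral \<tau> \<nu> \<zeta> / J \<tau> \<zeta>)"
    by (rule log_integral_ratio_integrable[OF \<tau> \<nu>])
  have "integrable (NB \<tau>) (integrand \<tau> \<nu>)"
  proof -
    obtain A where "\<And>\<zeta>. \<bar>integrand \<tau> \<nu> \<zeta>\<bar> \<le> A * (1 + grand_total N \<zeta>)\<^sup>2"
      using integrand_bound \<tau> \<nu> by blast
    then show ?thesis by (rule NB_integrable[OF \<tau>])
  qed
  from Bochner_Integration.integrable_add[OF this li]
  have "integrable (NB \<tau>) (\<lambda>\<zeta>. score \<tau> \<nu> \<zeta> * ln (J \<tau> \<zeta>))" by (simp add: integrand_def)
  then have "drift \<tau> \<nu> = expect \<tau> (\<lambda>\<zeta>. score \<tau> \<nu> \<zeta> * ln (J \<tau> \<zeta>))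
      - expect \<tau> (\<lambda>\<zeta>. log_integral \<tau> \<nu> \<zeta> / J \<tau> \<zeta>)"
    unfolding drift_def integrand_def[abs_def] by (rule Bochner_Integration.integral_diff[OF _ li])
  moreover have "1 / real (Suc k) * expect \<tau>
            (\<lambda>\<zeta>. P \<nu> ^ Suc k * ln (moment \<tau> \<nu> (Suc k) \<zeta>) - moment \<tau> \<nu> (Suc k) \<zeta>)
      = P \<nu> ^ Suc k / real (Suc k) * expect \<tau> (\<lambda>\<zeta>. ln (moment \<tau> \<nu> (Suc k) \<zeta>))
        - 1 / real (Suc k) * expect \<tau> (moment \<tau> \<nu> (Suc k))" for k
    using ln_moment_integrable[OF \<tau> \<nu>, of "Suc k"] moment_integrable[OF \<tau> \<nu>, of "Suc k"]
    by (simp add: right_diff_distrib del: of_nat_Suc power_Suc)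
  ultimately show ?thesis
    using sums_diff[OF expectation_score_log_J_sums[OF \<tau> \<nu>] expectation_moment_sums[OF \<tau> \<nu>]] by (simp only:)
qed

end

section \<open>Mixtures of Dirichlet priors\<close>

lemma sigma_finite_measure_lebesgue_param: "sigma_finite_measure (lebesgue_param N m)"
proof -
  have sf: "sigma_finite_measure (\<Pi>\<^sub>M i\<in>{1..m \<nu>}. (lborel :: real measure))" for \<nu>
  proof -
    interpret finite_product_sigma_finite "\<lambda>_. lborel :: real measure" "{1..m \<nu>}" by standard auto
    show ?thesis by unfold_locales
  qed
  interpret P: product_sigma_finite "\<lambda>\<nu>. \<Pi>\<^sub>M i\<in>{1..m \<nu>}. (lborel :: real measure)"
    by (rule product_sigma_finite.intro) (rule sf)
  interpret finite_product_sigma_finite "\<lambda>\<nu>. \<Pi>\<^sub>M i\<in>{1..m \<nu>}. (lborel :: real measure)" "{1..N}"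
    by standard auto
  have "sigma_finite_measure (\<Pi>\<^sub>M \<nu>\<in>{1..N}. \<Pi>\<^sub>M i\<in>{1..m \<nu>}. (lborel :: real measure))" by unfold_locales
  then show ?thesis
    unfolding lebesgue_param_def by (rule sigma_finite_measure_restrict_space) (rule param_space_sets)
qed

text \<open>
  By Markov's inequality the sets on which \<open>f\<close> is at least \<open>1 / i\<close> have finite mass.
\<close>

lemma sigma_finite_measure_if_finite_nn_integral:
  assumes [measurable]: "f \<in> borel_measurable M" and pos: "\<And>x. x \<in> space M \<Longrightarrow> 0 < f x"
    and fin: "(\<integral>\<^sup>+ x. f x \<partial>M) < \<infinity>"
  shows "sigma_finite_measure M"
proof
  define A where "A = (\<lambda>i :: nat. {x \<in> space M. 1 \<le> of_nat i * f x})"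
  show "\<exists>A. countable A \<and> A \<subseteq> sets M \<and> \<Union>A = space M \<and> (\<forall>a\<in>A. emeasure M a \<noteq> \<infinity>)"
  proof (intro exI[of _ "range A"] conjI ballI)
    show "countable (range A)" by simp
    show "range A \<subseteq> sets M" unfolding A_def by auto
    show "\<Union>(range A) = space M"
    proof safe
      fix x assume x: "x \<in> space M"
      have "\<exists>i::nat. 1 \<le> of_nat i * f x"
      proof (cases "f x")
        case (real c)
        then have c: "0 < c" using pos[OF x] by (simp add: ennreal_less_zero_iff)
        obtain i :: nat where "1 / c < real i" using reals_Archimedean2 by blast
        then have "1 \<le> real i * c" using c by (simp add: field_simps)
        then have "1 \<le> of_nat i * f x"
          unfolding real by (simp add: ennreal_of_nat_eq_real_of_nat ennreal_mult'[symmetric] flip: ennreal_1)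
        then show ?thesis ..
      next
        case top
        then show ?thesis by (intro exI[of _ 1]) simp
      qed
      then show "x \<in> \<Union>(range A)" using x by (auto simp: A_def)
    qed (auto simp: A_def)
    fix a assume "a \<in> range A"
    then obtain i where a: "a = A i" by auto
    have "emeasure M (A i) \<le> of_nat i * (\<integral>\<^sup>+ x. f x * indicator (space M) x \<partial>M)"
      unfolding A_def by (rule nn_integral_Markov_inequality) auto
    also have "(\<integral>\<^sup>+ x. f x * indicator (space M) x \<partial>M) = (\<integral>\<^sup>+ x. f x \<partial>M)"
      by (intro nn_integral_cong) auto
    also have "of_nat i * \<dots> < \<infinity>" using fin by (simp add: ennreal_mult_less_top of_nat_less_top)
    finally show "emeasure M a \<noteq> \<infinity>" unfolding a by simp
  qed
qed

text \<open>
  The Dirichlet prior is the instance with a point mass for \<open>M\<close> and with \<open>\<gamma>\<close> zero; this is why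
  \<open>\<gamma>\<close> may vanish.
\<close>

locale mixture_model =
  fixes N :: nat and m :: "nat \<Rightarrow> nat" and M :: "real measure" and \<gamma> :: "nat \<Rightarrow> real \<Rightarrow> real"
    and a0 :: "nat \<Rightarrow> real" and a :: "nat \<Rightarrow> nat \<Rightarrow> real" and r :: "nat \<Rightarrow> real"
  assumes m: "\<And>\<nu>. \<nu> \<in> {1..N} \<Longrightarrow> 1 \<le> m \<nu>"
    and a: "\<And>\<nu> i. \<nu> \<in> {1..N} \<Longrightarrow> i \<in> {1..m \<nu>} \<Longrightarrow> 0 < a \<nu> i"
    and \<gamma>_measurable: "\<And>\<nu>. \<nu> \<in> {1..N} \<Longrightarrow> \<gamma> \<nu> \<in> borel_measurable M"
    and \<gamma>_nonneg: "\<And>\<nu> u. \<nu> \<in> {1..N} \<Longrightarrow> u \<in> space M \<Longrightarrow> 0 \<le> \<gamma> \<nu> u"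
    and well_defined: "posterior_well_defined N m r (mixture_prior N m M \<gamma> a0 a)"
    and a0_r: "\<And>\<nu>. \<nu> \<in> {1..N} \<Longrightarrow> 0 < a0 \<nu> + r \<nu>"
begin

abbreviation prior :: "(nat \<Rightarrow> nat \<Rightarrow> real) \<Rightarrow> ennreal" where
  "prior \<equiv> mixture_prior N m M \<gamma> a0 a"

abbreviation tot :: "(nat \<Rightarrow> nat \<Rightarrow> real) \<Rightarrow> nat \<Rightarrow> real" where
  "tot q \<equiv> \<lambda>\<nu>. psum (m \<nu>) (q \<nu>)"

lemma interior: "q \<in> param_space N m \<Longrightarrow> interior_point N m q"
  by (rule param_space_interior_point[OF _ m order_refl])

lemma kernel_integral_bounds:
  "0 < (\<integral>\<^sup>+ q. prior q * ennreal (nm_kernel N m r z q) \<partial>lebesgue_param N m)"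
  "(\<integral>\<^sup>+ q. prior q * ennreal (nm_kernel N m r z q) \<partial>lebesgue_param N m) < \<infinity>"
  using well_defined[unfolded posterior_well_defined_def Let_def, rule_format, of z]
  unfolding nm_kernel_def by blast+

lemma dirichlet_measurable_pair:
  "(\<lambda>(q, u). dirichlet_prior N m (\<lambda>\<nu>. \<gamma> \<nu> u + a0 \<nu>) a q) \<in> borel_measurable (lebesgue_param N m \<Otimes>\<^sub>M M)"
proof -
  have 1: "(\<lambda>x. psum (m \<nu>) (fst x \<nu>)) \<in> borel_measurable (lebesgue_param N m \<Otimes>\<^sub>M M)" if "\<nu> \<in> {1..N}" for \<nu>
    by (rule measurable_compose[OF measurable_fst psum_component_measurable[OF that]])
  have 2: "(\<lambda>x. fst x \<nu> i) \<in> borel_measurable (lebesgue_param N m \<Otimes>\<^sub>M M)" if "\<nu> \<in> {1..N}" "i \<in> {1..m \<nu>}" for \<nu> i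
    by (rule measurable_compose[OF measurable_fst coordinate_measurable[where m = m, OF that]])
  have 3: "(\<lambda>x. \<gamma> \<nu> (snd x)) \<in> borel_measurable (lebesgue_param N m \<Otimes>\<^sub>M M)" if "\<nu> \<in> {1..N}" for \<nu>
    by (rule measurable_compose[OF measurable_snd \<gamma>_measurable[OF that]])
  show ?thesis
    unfolding dirichlet_prior_def case_prod_beta
    by (intro measurable_compose[OF _ measurable_ennreal] borel_measurable_prod borel_measurable_times
        powr_real_measurable borel_measurable_diff borel_measurable_add borel_measurable_const 1 2 3)
qed

lemma dirichlet_measurable_snd:
  assumes "q \<in> param_space N m"
  shows "(\<lambda>u. dirichlet_prior N m (\<lambda>\<nu>. \<gamma> \<nu> u + a0 \<nu>) a q) \<in> borel_measurable M"
  using measurable_compose[OF measurable_Pair1'[of q "lebesgue_param N m" M] dirichlet_measurable_pair] assms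
  by (simp add: space_lebesgue_param)

text \<open>
  If the mixture density were infinite everywhere, the kernel masses would be zero or infinite. So
  it is finite at some parameter, where it integrates a positive function of the mixing variable.
\<close>

lemma sigma_finite_mixing: "sigma_finite_measure M"
proof -
  let ?I = "\<integral>\<^sup>+ q. prior q * ennreal (nm_kernel N m r (\<lambda>_ _. 0) q) \<partial>lebesgue_param N m"
  have I: "0 < ?I" "?I < \<infinity>"
    using kernel_integral_bounds by auto
  have "\<exists>q\<in>param_space N m. prior q < \<infinity>"
  proof (rule ccontr)
    assume "\<not> ?thesis"
    then have inf: "prior q = \<infinity>" if "q \<in> param_space N m" for q using that by (metis infinity_ennreal_def top.not_eq_extremum)
    have "?I = (\<integral>\<^sup>+ q. \<infinity> \<partial>lebesgue_param N m)"
    proof (intro nn_integral_cong)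
      fix q assume "q \<in> space (lebesgue_param N m)"
      then have q: "q \<in> param_space N m" by (simp add: space_lebesgue_param)
      show "prior q * ennreal (nm_kernel N m r (\<lambda>_ _. 0) q) = \<infinity>"
        using inf[OF q] nm_kernel_pos[OF interior[OF q], of r "\<lambda>_ _. 0"] by (simp add: ennreal_top_mult ennreal_eq_0_iff not_le)
    qed
    also have "\<dots> = \<infinity> * emeasure (lebesgue_param N m) (space (lebesgue_param N m))" by simp
    finally have "?I = 0 \<or> ?I = \<infinity>" by (cases "emeasure (lebesgue_param N m) (space (lebesgue_param N m)) = 0") (auto simp: ennreal_top_mult)
    then show False using I by auto
  qed
  then obtain q where q: "q \<in> param_space N m" "prior q < \<infinity>" by blast
  show ?thesis
  proof (rule sigma_finite_measure_if_finite_nn_integral)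
    show "(\<lambda>u. dirichlet_prior N m (\<lambda>\<nu>. \<gamma> \<nu> u + a0 \<nu>) a q) \<in> borel_measurable M"
      by (rule dirichlet_measurable_snd[OF q(1)])
    show "(\<integral>\<^sup>+ u. dirichlet_prior N m (\<lambda>\<nu>. \<gamma> \<nu> u + a0 \<nu>) a q \<partial>M) < \<infinity>"
      using q(2) by (simp add: mixture_prior_def)
    have "0 < (1 - psum (m \<nu>) (q \<nu>)) powr c * (\<Prod>i\<in>{1..m \<nu>}. q \<nu> i powr (a \<nu> i - 1))" if "\<nu> \<in> {1..N}" for \<nu> c
      using param_space_unit[OF q(1) that m[OF that]] param_space_pos[OF q(1) that]
      by (intro mult_pos_pos prod_pos) force+
    then show "0 < dirichlet_prior N m (\<lambda>\<nu>. \<gamma> \<nu> u + a0 \<nu>) a q" for u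
      unfolding dirichlet_prior_def ennreal_less_zero_iff by (intro prod_pos)
  qed
qed

lemma prior_measurable: "prior \<in> borel_measurable (lebesgue_param N m)"
  unfolding mixture_prior_def[abs_def]
  by (rule sigma_finite_measure.borel_measurable_nn_integral[OF sigma_finite_mixing dirichlet_measurable_pair])

text \<open>
  The part of a kernel mass that depends on the totals only.
\<close>

definition total_mass :: "(nat \<Rightarrow> real) \<Rightarrow> (nat \<Rightarrow> nat) \<Rightarrow> ennreal" where
  "total_mass t \<zeta> = (\<integral>\<^sup>+ u. (\<Prod>\<nu>\<in>{1..N}. \<integral>\<^sup>+ v. halfline_power (psum (m \<nu>) (a \<nu>) + real (\<zeta> \<nu>)) v
                             * halfline_power (\<gamma> \<nu> u + a0 \<nu> + t \<nu>) (1 - v) \<partial>lborel) \<partial>M)"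

lemma total_mass_integrand_measurable:
  "(\<lambda>u. \<Prod>\<nu>\<in>{1..N}. \<integral>\<^sup>+ v. halfline_power (psum (m \<nu>) (a \<nu>) + real (\<zeta> \<nu>)) v
             * halfline_power (\<gamma> \<nu> u + a0 \<nu> + t \<nu>) (1 - v) \<partial>lborel) \<in> borel_measurable M"
proof -
  have "(\<lambda>u. \<integral>\<^sup>+ v. halfline_power (psum (m \<nu>) (a \<nu>) + real (\<zeta> \<nu>)) v
           * halfline_power (\<gamma> \<nu> u + a0 \<nu> + t \<nu>) (1 - v) \<partial>lborel) \<in> borel_measurable M" if "\<nu> \<in> {1..N}" for \<nu>
  proof (rule lborel.borel_measurable_nn_integral)
    have "(\<lambda>x. \<gamma> \<nu> (fst x)) \<in> borel_measurable (M \<Otimes>\<^sub>M lborel)"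
      by (rule measurable_compose[OF measurable_fst \<gamma>_measurable[OF that]])
    then show "(\<lambda>(u, v). halfline_power (psum (m \<nu>) (a \<nu>) + real (\<zeta> \<nu>)) v
           * halfline_power (\<gamma> \<nu> u + a0 \<nu> + t \<nu>) (1 - v)) \<in> borel_measurable (M \<Otimes>\<^sub>M lborel)"
      unfolding halfline_power_def case_prod_beta by measurable
  qed
  then show ?thesis by (rule borel_measurable_prod_ennreal)
qed

text \<open>
  Tonelli's theorem moves the mixing variable outside, where the prior is a Dirichlet density.
\<close>

lemma prior_integral:
  "(\<integral>\<^sup>+ q. prior q * ennreal (nm_kernel N m t z q * (\<Prod>\<nu>\<in>{1..N}. psum (m \<nu>) (q \<nu>) ^ k \<nu>)) \<partial>lebesgue_param N m)
     = ennreal (prior_const N m a z) * total_mass t (\<lambda>\<nu>. totals m z \<nu> + k \<nu>)"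
proof -
  let ?K = "\<lambda>q. ennreal (nm_kernel N m t z q * (\<Prod>\<nu>\<in>{1..N}. psum (m \<nu>) (q \<nu>) ^ k \<nu>))"
  let ?d = "\<lambda>q u. dirichlet_prior N m (\<lambda>\<nu>. \<gamma> \<nu> u + a0 \<nu>) a q"
  have K: "?K \<in> borel_measurable (lebesgue_param N m)"
    by (intro measurable_compose[OF _ measurable_ennreal] borel_measurable_times nm_kernel_measurable
        borel_measurable_prod borel_measurable_power psum_component_measurable)
  interpret pair_sigma_finite "lebesgue_param N m" M
    by (intro pair_sigma_finite.intro sigma_finite_measure_lebesgue_param sigma_finite_mixing)
  have "(\<integral>\<^sup>+ q. prior q * ?K q \<partial>lebesgue_param N m)
      = (\<integral>\<^sup>+ q. (\<integral>\<^sup>+ u. ?d q u * ?K q \<partial>M) \<partial>lebesgue_param N m)"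
    by (intro nn_integral_cong)
       (auto simp: mixture_prior_def space_lebesgue_param intro!: nn_integral_multc[symmetric] dirichlet_measurable_snd)
  also have "\<dots> = (\<integral>\<^sup>+ u. (\<integral>\<^sup>+ q. ?d q u * ?K q \<partial>lebesgue_param N m) \<partial>M)"
  proof (rule Fubini'[symmetric])
    have "(\<lambda>x. ?d (fst x) (snd x) * ?K (fst x)) \<in> borel_measurable (lebesgue_param N m \<Otimes>\<^sub>M M)"
      using dirichlet_measurable_pair by (intro borel_measurable_times_ennreal measurable_compose[OF measurable_fst K]) (simp add: case_prod_beta)
    then show "(\<lambda>(q, u). ?d q u * ?K q) \<in> borel_measurable (lebesgue_param N m \<Otimes>\<^sub>M M)"
      by (simp add: case_prod_beta)
  qed
  also have "\<dots> = (\<integral>\<^sup>+ u. ennreal (prior_const N m a z) *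
      (\<Prod>\<nu>\<in>{1..N}. \<integral>\<^sup>+ v. halfline_power (psum (m \<nu>) (a \<nu>) + real (totals m z \<nu> + k \<nu>)) v
                             * halfline_power (\<gamma> \<nu> u + a0 \<nu> + t \<nu>) (1 - v) \<partial>lborel) \<partial>M)"
    by (intro nn_integral_cong dirichlet_prior_integral m a)
  also have "\<dots> = ennreal (prior_const N m a z) * total_mass t (\<lambda>\<nu>. totals m z \<nu> + k \<nu>)"
    unfolding total_mass_def
    by (rule nn_integral_cmult) (rule total_mass_integrand_measurable)
  finally show ?thesis .
qed

lemma psum_a_pos: "\<nu> \<in> {1..N} \<Longrightarrow> 0 < psum (m \<nu>) (a \<nu>)"
  unfolding psum_def using a m by (intro sum_pos) auto

lemma prior_const_pos: "0 < prior_const N m a z"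
  unfolding prior_const_def
  by (intro prod_pos dirichlet_const_pos) (use a m in \<open>auto intro: add_pos_nonneg\<close>)

lemma total_mass_integrand_Beta:
  assumes u: "u \<in> space M" and t: "\<And>\<nu>. \<nu> \<in> {1..N} \<Longrightarrow> 0 < a0 \<nu> + t \<nu>"
  shows "(\<Prod>\<nu>\<in>{1..N}. \<integral>\<^sup>+ v. halfline_power (psum (m \<nu>) (a \<nu>) + real (\<zeta> \<nu>)) v
                             * halfline_power (\<gamma> \<nu> u + a0 \<nu> + t \<nu>) (1 - v) \<partial>lborel)
      = ennreal (\<Prod>\<nu>\<in>{1..N}. Beta (psum (m \<nu>) (a \<nu>) + real (\<zeta> \<nu>)) (\<gamma> \<nu> u + a0 \<nu> + t \<nu>))"
proof -
  have pos: "0 < psum (m \<nu>) (a \<nu>) + real (\<zeta> \<nu>)" "0 < \<gamma> \<nu> u + a0 \<nu> + t \<nu>" if "\<nu> \<in> {1..N}" for \<nu>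
    using psum_a_pos[OF that] \<gamma>_nonneg[OF that u] t[OF that] by auto
  show ?thesis
    by (subst prod_ennreal[symmetric]) (auto intro!: prod.cong Beta_nn_integral pos less_imp_le[OF Beta_real_pos])
qed

lemma total_mass_Beta:
  assumes "\<And>\<nu>. \<nu> \<in> {1..N} \<Longrightarrow> 0 < a0 \<nu> + t \<nu>"
  shows "total_mass t \<zeta> = (\<integral>\<^sup>+ u. ennreal (\<Prod>\<nu>\<in>{1..N}. Beta (psum (m \<nu>) (a \<nu>) + real (\<zeta> \<nu>)) (\<gamma> \<nu> u + a0 \<nu> + t \<nu>)) \<partial>M)"
  unfolding total_mass_def by (intro nn_integral_cong total_mass_integrand_Beta assms)

abbreviation prior_measure :: "(nat \<Rightarrow> nat \<Rightarrow> real) measure" where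
  "prior_measure \<equiv> density (lebesgue_param N m) prior"

lemma nn_integral_prior_measure:
  assumes "f \<in> borel_measurable (lebesgue_param N m)"
  shows "(\<integral>\<^sup>+ q. f q \<partial>prior_measure) = (\<integral>\<^sup>+ q. prior q * f q \<partial>lebesgue_param N m)"
  by (rule nn_integral_density[OF prior_measurable assms])

lemma total_weight_measurable:
  "(\<lambda>q. total_weight N t \<zeta> (tot q)) \<in> borel_measurable (lebesgue_param N m)"
  unfolding total_weight_def
  by (intro borel_measurable_prod borel_measurable_times borel_measurable_power powr_real_measurable
      borel_measurable_diff borel_measurable_const psum_component_measurable)

lemma total_weight_integral:
  "(\<integral>\<^sup>+ q. ennreal (total_weight N t \<zeta> (tot q)) \<partial>prior_measure)
     = ennreal (prior_const N m a (\<lambda>_ _. 0)) * total_mass t \<zeta>"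
proof -
  have "total_weight N t \<zeta> (tot q) = nm_kernel N m t (\<lambda>_ _. 0) q * (\<Prod>\<nu>\<in>{1..N}. tot q \<nu> ^ \<zeta> \<nu>)" for q
    by (simp add: total_weight_def nm_kernel_def prod.distrib)
  note eq = this
  show ?thesis
    unfolding nn_integral_prior_measure[OF measurable_compose[OF total_weight_measurable measurable_ennreal]]
    unfolding eq
    using prior_integral[of t "\<lambda>_ _. 0" \<zeta>] by (simp add: totals_def)
qed

text \<open>
  Since \<open>- ln (1 - w) \<le> (1 - w) ^ (- \<epsilon>) / \<epsilon>\<close>, the logarithm can be traded for a decrease of \<open>t \<nu>\<close>
  by \<open>\<epsilon>\<close>. For fixed mixing variable this changes one Beta factor, by at most a multiple linear in
  \<open>\<zeta> \<nu>\<close>. The second arguments of the Beta functions are bounded below by \<open>\<delta> \<nu> / 2\<close> uniformly in the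
  mixing variable, because the shifts are nonnegative.
\<close>

lemma log_weight_integral_bound:
  "\<exists>C\<ge>0. \<forall>\<nu>\<in>{1..N}. \<forall>t \<zeta>. (\<forall>\<nu>\<in>{1..N}. r \<nu> \<le> t \<nu>) \<longrightarrow>
     (\<integral>\<^sup>+ q. ennreal (- ln (1 - tot q \<nu>) * total_weight N t \<zeta> (tot q)) \<partial>prior_measure)
     \<le> ennreal (C * (1 + real (\<zeta> \<nu>))) * (\<integral>\<^sup>+ q. ennreal (total_weight N t \<zeta> (tot q)) \<partial>prior_measure)"
proof -
  define \<delta> where "\<delta> = (\<lambda>\<nu>. a0 \<nu> + r \<nu>)"
  define \<epsilon> where "\<epsilon> = (\<lambda>\<nu>. min 1 (\<delta> \<nu> / 2))"
  define b where "b = (\<lambda>\<nu>. psum (m \<nu>) (a \<nu>))"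
  \<comment> \<open>A bound for \<open>1 + \<beta> / y\<close> with \<open>\<beta> = b + \<zeta> \<nu>\<close> and \<open>y \<ge> \<delta> / 2\<close>, up to the factor \<open>1 + \<zeta> \<nu>\<close>.\<close>
  define \<kappa> where "\<kappa> = (\<lambda>\<nu>. 1 + 2 * (b \<nu> + 1) / \<delta> \<nu>)"
  define C where "C = (\<Sum>\<nu>\<in>{1..N}. \<kappa> \<nu> / \<epsilon> \<nu>)"
  have \<delta>: "0 < \<delta> \<nu>" and \<epsilon>: "0 < \<epsilon> \<nu>" "\<epsilon> \<nu> \<le> 1" "\<epsilon> \<nu> \<le> \<delta> \<nu> / 2" and b: "0 < b \<nu>" and \<kappa>: "0 < \<kappa> \<nu>" if "\<nu> \<in> {1..N}" for \<nu>
    using a0_r[OF that] psum_a_pos[OF that] by (auto simp: \<delta>_def \<epsilon>_def b_def \<kappa>_def min_def intro!: add_pos_pos divide_pos_pos)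
  have C: "\<kappa> \<nu> / \<epsilon> \<nu> \<le> C" if "\<nu> \<in> {1..N}" for \<nu>
    unfolding C_def using that \<kappa> \<epsilon> by (intro member_le_sum) (auto intro!: less_imp_le[OF divide_pos_pos])
  show ?thesis
  proof (intro exI[of _ C] conjI ballI allI impI)
    show "0 \<le> C" unfolding C_def using \<kappa> \<epsilon> by (intro sum_nonneg less_imp_le[OF divide_pos_pos])
    fix \<nu> and t :: "nat \<Rightarrow> real" and \<zeta> :: "nat \<Rightarrow> nat"
    assume \<nu>: "\<nu> \<in> {1..N}" and t: "\<forall>\<nu>\<in>{1..N}. r \<nu> \<le> t \<nu>"
    define t\<epsilon> where "t\<epsilon> = t(\<nu> := t \<nu> - \<epsilon> \<nu>)"
    let ?W = "\<lambda>t q. total_weight N t \<zeta> (tot q)"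
    let ?\<kappa> = "\<kappa> \<nu> * (1 + real (\<zeta> \<nu>))" and ?c = "ennreal (prior_const N m a (\<lambda>_ _. 0))"
    let ?B = "\<lambda>t u \<nu>. Beta (b \<nu> + real (\<zeta> \<nu>)) (\<gamma> \<nu> u + a0 \<nu> + t \<nu>)"
    have pos: "0 < a0 \<nu>' + t \<nu>'" "0 < a0 \<nu>' + t\<epsilon> \<nu>'" if "\<nu>' \<in> {1..N}" for \<nu>'
      using a0_r[OF that] bspec[OF t that] \<epsilon>[OF that] \<delta>[OF that] by (auto simp: t\<epsilon>_def \<delta>_def)
    have step: "total_mass t\<epsilon> \<zeta> \<le> ennreal ?\<kappa> * total_mass t \<zeta>"
    proof -
      have "total_mass t\<epsilon> \<zeta> = (\<integral>\<^sup>+ u. ennreal (\<Prod>\<nu>\<in>{1..N}. ?B t\<epsilon> u \<nu>) \<partial>M)"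
        unfolding b_def by (rule total_mass_Beta) (rule pos(2))
      also have "\<dots> \<le> (\<integral>\<^sup>+ u. ennreal ?\<kappa> * ennreal (\<Prod>\<nu>\<in>{1..N}. ?B t u \<nu>) \<partial>M)"
      proof (intro nn_integral_mono)
        fix u assume u: "u \<in> space M"
        have Bpos: "0 < ?B t u \<nu>'" if "\<nu>' \<in> {1..N}" for \<nu>'
          using b[OF that] pos(1)[OF that] \<gamma>_nonneg[OF that u] by (intro Beta_real_pos) auto
        have R: "0 \<le> (\<Prod>\<nu>\<in>{1..N} - {\<nu>}. ?B t u \<nu>)" using Bpos by (intro prod_nonneg less_imp_le) auto
        have y: "\<delta> \<nu> / 2 \<le> \<gamma> \<nu> u + a0 \<nu> + t\<epsilon> \<nu>"
          using \<gamma>_nonneg[OF \<nu> u] bspec[OF t \<nu>] \<epsilon>(3)[OF \<nu>] by (simp add: t\<epsilon>_def \<delta>_def field_simps)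
        have bz: "b \<nu> + real (\<zeta> \<nu>) \<le> (b \<nu> + 1) * (1 + real (\<zeta> \<nu>))"
          using b[OF \<nu>] by (simp add: algebra_simps)
        have "?B t\<epsilon> u \<nu> \<le> (1 + (b \<nu> + real (\<zeta> \<nu>)) / (\<gamma> \<nu> u + a0 \<nu> + t\<epsilon> \<nu>)) *
            Beta (b \<nu> + real (\<zeta> \<nu>)) (\<gamma> \<nu> u + a0 \<nu> + t\<epsilon> \<nu> + \<epsilon> \<nu>)"
          using b[OF \<nu>] y \<delta>[OF \<nu>] \<epsilon>[OF \<nu>] by (intro Beta_shift_bound) auto
        also have "\<gamma> \<nu> u + a0 \<nu> + t\<epsilon> \<nu> + \<epsilon> \<nu> = \<gamma> \<nu> u + a0 \<nu> + t \<nu>" by (simp add: t\<epsilon>_def)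
        also have "(1 + (b \<nu> + real (\<zeta> \<nu>)) / (\<gamma> \<nu> u + a0 \<nu> + t\<epsilon> \<nu>)) * ?B t u \<nu>
            \<le> ?\<kappa> * ?B t u \<nu>"
        proof (intro mult_right_mono less_imp_le[OF Bpos[OF \<nu>]])
          have "(b \<nu> + real (\<zeta> \<nu>)) / (\<gamma> \<nu> u + a0 \<nu> + t\<epsilon> \<nu>) \<le> ((b \<nu> + 1) * (1 + real (\<zeta> \<nu>))) / (\<delta> \<nu> / 2)"
            using bz y \<delta>[OF \<nu>] b[OF \<nu>] by (intro frac_le) auto
          also have "\<dots> = 2 * (b \<nu> + 1) / \<delta> \<nu> * (1 + real (\<zeta> \<nu>))" by simp
          finally show "1 + (b \<nu> + real (\<zeta> \<nu>)) / (\<gamma> \<nu> u + a0 \<nu> + t\<epsilon> \<nu>) \<le> ?\<kappa>"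
            unfolding \<kappa>_def distrib_right by simp
        qed
        finally have "?B t\<epsilon> u \<nu> \<le> ?\<kappa> * ?B t u \<nu>" .
        from mult_right_mono[OF this R]
        have "?B t\<epsilon> u \<nu> * (\<Prod>\<nu>\<in>{1..N} - {\<nu>}. ?B t u \<nu>) \<le> ?\<kappa> * (\<Prod>\<nu>\<in>{1..N}. ?B t u \<nu>)"
          using \<nu> by (simp add: prod.remove[of _ \<nu>] mult.assoc)
        moreover have "(\<Prod>\<nu>\<in>{1..N}. ?B t\<epsilon> u \<nu>) = ?B t\<epsilon> u \<nu> * (\<Prod>\<nu>\<in>{1..N} - {\<nu>}. ?B t u \<nu>)"
          using \<nu> by (auto simp: prod.remove[of _ \<nu>] t\<epsilon>_def intro!: prod.cong)
        ultimately have "(\<Prod>\<nu>\<in>{1..N}. ?B t\<epsilon> u \<nu>) \<le> ?\<kappa> * (\<Prod>\<nu>\<in>{1..N}. ?B t u \<nu>)" by simp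
        then show "ennreal (\<Prod>\<nu>\<in>{1..N}. ?B t\<epsilon> u \<nu>)
            \<le> ennreal ?\<kappa> * ennreal (\<Prod>\<nu>\<in>{1..N}. ?B t u \<nu>)"
          using \<kappa>[OF \<nu>] by (simp add: ennreal_mult'[symmetric] ennreal_leI)
      qed
      also have "\<dots> = ennreal ?\<kappa> * (\<integral>\<^sup>+ u. ennreal (\<Prod>\<nu>\<in>{1..N}. ?B t u \<nu>) \<partial>M)"
      proof (rule nn_integral_cmult)
        show "(\<lambda>u. ennreal (\<Prod>\<nu>\<in>{1..N}. ?B t u \<nu>)) \<in> borel_measurable M"
          unfolding b_def
          by (subst measurable_cong[OF total_mass_integrand_Beta[symmetric]]) (use pos(1) total_mass_integrand_measurable in auto)
      qed
      also have "(\<integral>\<^sup>+ u. ennreal (\<Prod>\<nu>\<in>{1..N}. ?B t u \<nu>) \<partial>M) = total_mass t \<zeta>"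
        unfolding b_def by (rule total_mass_Beta[symmetric]) (rule pos(1))
      finally show ?thesis .
    qed
    have "(\<integral>\<^sup>+ q. ennreal (- ln (1 - tot q \<nu>) * ?W t q) \<partial>prior_measure)
        \<le> (\<integral>\<^sup>+ q. ennreal (1 / \<epsilon> \<nu>) * ennreal (?W t\<epsilon> q) \<partial>prior_measure)"
    proof (intro nn_integral_mono)
      fix q assume "q \<in> space prior_measure"
      then have q: "q \<in> param_space N m" by (simp add: space_lebesgue_param)
      define w where "w = tot q \<nu>"
      have w: "0 < w" "w < 1" unfolding w_def using param_space_unit[OF q \<nu> m[OF \<nu>]] .
      have W: "0 \<le> ?W t q" unfolding total_weight_def using param_space_unit[OF q _ m] by (intro prod_nonneg) (auto simp: less_imp_le)
      have shift: "?W t\<epsilon> q = (1 - w) powr (- \<epsilon> \<nu>) * ?W t q"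
      proof -
        have "(\<Prod>\<nu>'\<in>{1..N} - {\<nu>}. (1 - tot q \<nu>') powr t\<epsilon> \<nu>' * tot q \<nu>' ^ \<zeta> \<nu>')
            = (\<Prod>\<nu>'\<in>{1..N} - {\<nu>}. (1 - tot q \<nu>') powr t \<nu>' * tot q \<nu>' ^ \<zeta> \<nu>')"
          by (intro prod.cong) (auto simp: t\<epsilon>_def)
        moreover have "(1 - w) powr t\<epsilon> \<nu> = (1 - w) powr (- \<epsilon> \<nu>) * (1 - w) powr t \<nu>"
          by (simp add: t\<epsilon>_def powr_add[symmetric])
        ultimately show ?thesis using \<nu> by (simp add: total_weight_def prod.remove[of _ \<nu>] w_def)
      qed
      have log: "- ln (1 - w) \<le> 1 / \<epsilon> \<nu> * (1 - w) powr (- \<epsilon> \<nu>)"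
      proof -
        have "ln ((1 - w) powr (- \<epsilon> \<nu>)) \<le> (1 - w) powr (- \<epsilon> \<nu>)"
          using w by (intro ln_bound) simp
        then have "- \<epsilon> \<nu> * ln (1 - w) \<le> (1 - w) powr (- \<epsilon> \<nu>)" using w by (simp add: ln_powr)
        then show ?thesis using \<epsilon>(1)[OF \<nu>] by (simp add: field_simps)
      qed
      have "- ln (1 - w) * ?W t q \<le> 1 / \<epsilon> \<nu> * ?W t\<epsilon> q"
        using mult_right_mono[OF log W] unfolding shift by (simp only: mult.assoc)
      then show "ennreal (- ln (1 - tot q \<nu>) * ?W t q) \<le> ennreal (1 / \<epsilon> \<nu>) * ennreal (?W t\<epsilon> q)"
        unfolding w_def using \<epsilon>(1)[OF \<nu>] by (subst ennreal_mult'[symmetric]) (auto intro: ennreal_leI)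
    qed
    also have "\<dots> = ennreal (1 / \<epsilon> \<nu>) * (?c * total_mass t\<epsilon> \<zeta>)"
      unfolding total_weight_integral[symmetric]
      by (rule nn_integral_cmult) (use total_weight_measurable[of t\<epsilon> \<zeta>] in simp)
    also have "\<dots> \<le> ennreal (1 / \<epsilon> \<nu>) * (?c * (ennreal ?\<kappa> * total_mass t \<zeta>))"
      by (intro mult_left_mono step) auto
    also have "\<dots> = ennreal (\<kappa> \<nu> / \<epsilon> \<nu> * (1 + real (\<zeta> \<nu>))) * (?c * total_mass t \<zeta>)"
    proof -
      have "ennreal (\<kappa> \<nu> / \<epsilon> \<nu> * (1 + real (\<zeta> \<nu>))) = ennreal (1 / \<epsilon> \<nu>) * ennreal ?\<kappa>"
        using \<epsilon>(1)[OF \<nu>] by (subst ennreal_mult'[symmetric]) auto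
      then show ?thesis by (simp add: mult_ac)
    qed
    also have "\<dots> \<le> ennreal (C * (1 + real (\<zeta> \<nu>))) * (?c * total_mass t \<zeta>)"
      using C[OF \<nu>] by (intro mult_right_mono ennreal_leI) auto
    finally show "(\<integral>\<^sup>+ q. ennreal (- ln (1 - tot q \<nu>) * ?W t q) \<partial>prior_measure)
        \<le> ennreal (C * (1 + real (\<zeta> \<nu>))) * (\<integral>\<^sup>+ q. ennreal (?W t q) \<partial>prior_measure)"
      unfolding total_weight_integral .
  qed
qed

end

locale mixture_path = mixture_model +
  fixes t t' :: "nat \<Rightarrow> real \<Rightarrow> real" and p :: "nat \<Rightarrow> nat \<Rightarrow> real"
  assumes r_pos: "\<And>\<nu>. \<nu> \<in> {1..N} \<Longrightarrow> 0 < r \<nu>"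
    and t_0: "\<And>\<nu>. \<nu> \<in> {1..N} \<Longrightarrow> t \<nu> 0 = r \<nu>"
    and t_mono: "\<And>\<nu>. \<nu> \<in> {1..N} \<Longrightarrow> mono_on {0..1} (t \<nu>)"
    and t_deriv: "\<And>\<nu> \<tau>. \<nu> \<in> {1..N} \<Longrightarrow> \<tau> \<in> {0..1} \<Longrightarrow>
      (t \<nu> has_real_derivative t' \<nu> \<tau>) (at \<tau> within {0..1})"
    and t'_cont: "\<And>\<nu>. \<nu> \<in> {1..N} \<Longrightarrow> continuous_on {0..1} (t' \<nu>)"
    and p: "p \<in> param_space N m"
begin

lemma r_le_t: "\<nu> \<in> {1..N} \<Longrightarrow> \<tau> \<in> {0..1} \<Longrightarrow> r \<nu> \<le> t \<nu> \<tau>"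
  using mono_onD[OF t_mono, of \<nu> 0 \<tau>] t_0[of \<nu>] by simp

sublocale tilt: tilted_prior N prior_measure "\<lambda>\<nu> q. psum (m \<nu>) (q \<nu>)" t t' "\<lambda>\<nu>. psum (m \<nu>) (p \<nu>)"
proof
  show "(\<lambda>q. psum (m \<nu>) (q \<nu>)) \<in> borel_measurable prior_measure" if "\<nu> \<in> {1..N}" for \<nu>
    using psum_component_measurable[OF that] by simp
  show "0 < psum (m \<nu>) (q \<nu>) \<and> psum (m \<nu>) (q \<nu>) < 1" if "\<nu> \<in> {1..N}" "q \<in> space prior_measure" for \<nu> q
    using param_space_unit[of q N m \<nu>] m[OF that(1)] that by (simp add: space_lebesgue_param)
  show "0 < psum (m \<nu>) (p \<nu>) \<and> psum (m \<nu>) (p \<nu>) < 1" if "\<nu> \<in> {1..N}" for \<nu>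
    using param_space_unit[OF p that m[OF that]] by simp
  have kernel: "(\<integral>\<^sup>+ q. ennreal (total_weight N (\<lambda>\<nu>. t \<nu> 0) (\<lambda>_. 0) (tot q)) \<partial>prior_measure)
      = (\<integral>\<^sup>+ q. prior q * ennreal (nm_kernel N m r (\<lambda>_ _. 0) q) \<partial>lebesgue_param N m)"
  proof -
    have "total_weight N (\<lambda>\<nu>. t \<nu> 0) (\<lambda>_. 0) (tot q) = nm_kernel N m r (\<lambda>_ _. 0) q" for q
      unfolding total_weight_def nm_kernel_def by (intro prod.cong) (auto simp: t_0)
    then show ?thesis
      using measurable_compose[OF nm_kernel_measurable measurable_ennreal]
      by (simp only: nn_integral_prior_measure)
  qed
  show "emeasure prior_measure (space prior_measure) \<noteq> 0"
  proof
    assume "emeasure prior_measure (space prior_measure) = 0"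
    then have "AE q in prior_measure. ennreal (total_weight N (\<lambda>\<nu>. t \<nu> 0) (\<lambda>_. 0) (tot q)) = 0"
      by (intro AE_I[of _ _ "space prior_measure"]) auto
    then have "(\<integral>\<^sup>+ q. ennreal (total_weight N (\<lambda>\<nu>. t \<nu> 0) (\<lambda>_. 0) (tot q)) \<partial>prior_measure) = 0"
      by (subst nn_integral_cong_AE[where v = "\<lambda>_. 0"]) auto
    then show False using kernel kernel_integral_bounds(1)[of "\<lambda>_ _. 0"] by simp
  qed
  show "(\<integral>\<^sup>+ q. ennreal (total_weight N (\<lambda>\<nu>. t \<nu> 0) (\<lambda>_. 0) (tot q)) \<partial>prior_measure) < \<infinity>"
    unfolding kernel by (rule kernel_integral_bounds(2))
  obtain C where C: "0 \<le> C" "\<forall>\<nu>\<in>{1..N}. \<forall>t \<zeta>. (\<forall>\<nu>\<in>{1..N}. r \<nu> \<le> t \<nu>) \<longrightarrow>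
     (\<integral>\<^sup>+ q. ennreal (- ln (1 - tot q \<nu>) * total_weight N t \<zeta> (tot q)) \<partial>prior_measure)
     \<le> ennreal (C * (1 + real (\<zeta> \<nu>))) * (\<integral>\<^sup>+ q. ennreal (total_weight N t \<zeta> (tot q)) \<partial>prior_measure)"
    using log_weight_integral_bound by blast
  show "\<exists>C\<ge>0. \<forall>\<nu>\<in>{1..N}. \<forall>\<tau>\<in>{0..1}. \<forall>\<zeta>.
      (\<integral>\<^sup>+ q. ennreal (- ln (1 - tot q \<nu>) * total_weight N (\<lambda>\<nu>. t \<nu> \<tau>) \<zeta> (tot q)) \<partial>prior_measure)
       \<le> ennreal (C * (1 + real (\<zeta> \<nu>))) *
         (\<integral>\<^sup>+ q. ennreal (total_weight N (\<lambda>\<nu>. t \<nu> \<tau>) \<zeta> (tot q)) \<partial>prior_measure)"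
    by (intro exI[of _ C] conjI ballI allI C(1) C(2)[rule_format]) (use r_le_t in blast)+
  show "0 < t \<nu> 0" if "\<nu> \<in> {1..N}" for \<nu> using r_pos[OF that] t_0[OF that] by simp
qed (use t_mono t_deriv t'_cont in auto)

end

section \<open>Predictive risk\<close>

text \<open>
  The combinatorial factor of the joint mass. It does not involve the parameter, so it cancels from
  posteriors and from log ratios.
\<close>

definition nm_coef :: "nat \<Rightarrow> (nat \<Rightarrow> nat) \<Rightarrow> (nat \<Rightarrow> real) \<Rightarrow> (nat \<Rightarrow> nat \<Rightarrow> nat) \<Rightarrow> real" where
  "nm_coef N m t x = (\<Prod>\<nu>\<in>{1..N}. Gamma (t \<nu> + real (\<Sum>i\<in>{1..m \<nu>}. x \<nu> i))
      / (Gamma (t \<nu>) * (\<Prod>i\<in>{1..m \<nu>}. fact (x \<nu> i))))"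

lemma nm_coef_pos:
  assumes "\<And>\<nu>. \<nu> \<in> {1..N} \<Longrightarrow> 0 < t \<nu>"
  shows "0 < nm_coef N m t x"
  unfolding nm_coef_def using assms
  by (intro prod_pos divide_pos_pos mult_pos_pos Gamma_real_pos add_pos_nonneg) (auto simp del: of_nat_sum)

lemma joint_mass_eq: "joint_mass N m t q x = nm_coef N m t x * nm_kernel N m t x q"
  unfolding joint_mass_def nm_coef_def nm_kernel_def nm_mass_def prod.distrib[symmetric]
  by (simp only: mult.assoc)

context mixture_path
begin

text \<open>
  The kernel mass \<open>W\<close> of the prior along the path; the quotient is \<open>C(z)\<close>.
\<close>

definition kernel_mass :: "real \<Rightarrow> (nat \<Rightarrow> nat \<Rightarrow> nat) \<Rightarrow> real" where
  "kernel_mass \<tau> z = prior_const N m a z / prior_const N m a (\<lambda>_ _. 0) * tilt.J \<tau> (totals m z)"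

lemma ennreal_J:
  assumes "\<tau> \<in> {0..1}"
  shows "ennreal (tilt.J \<tau> \<zeta>) = ennreal (prior_const N m a (\<lambda>_ _. 0)) * total_mass (\<lambda>\<nu>. t \<nu> \<tau>) \<zeta>"
  using tilt.nn_integral_weight[OF assms, of \<zeta>] total_weight_integral[of "\<lambda>\<nu>. t \<nu> \<tau>" \<zeta>]
  by (simp add: tilt.weight_def)

text \<open>
  The factor \<open>C(z)\<close> is the ratio of the constants for the counts \<open>z\<close> and for no counts: the latter
  gives \<open>J\<close>, in which the totals appear as powers of the block sums.
\<close>

lemma kernel_integral:
  assumes \<tau>: "\<tau> \<in> {0..1}"
  shows "(\<integral>\<^sup>+ q. prior q * ennreal (nm_kernel N m (\<lambda>\<nu>. t \<nu> \<tau>) z q * (\<Prod>\<nu>\<in>{1..N}. psum (m \<nu>) (q \<nu>) ^ k \<nu>)) \<partial>lebesgue_param N m)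
     = ennreal (prior_const N m a z / prior_const N m a (\<lambda>_ _. 0) * tilt.J \<tau> (\<lambda>\<nu>. totals m z \<nu> + k \<nu>))"
proof -
  let ?c = "prior_const N m a"
  have c: "0 < ?c z" for z by (rule prior_const_pos)
  have "ennreal (?c z / ?c (\<lambda>_ _. 0) * tilt.J \<tau> (\<lambda>\<nu>. totals m z \<nu> + k \<nu>))
      = ennreal (?c z / ?c (\<lambda>_ _. 0)) * (ennreal (?c (\<lambda>_ _. 0)) * total_mass (\<lambda>\<nu>. t \<nu> \<tau>) (\<lambda>\<nu>. totals m z \<nu> + k \<nu>))"
    unfolding ennreal_J[OF \<tau>, symmetric]
    by (intro ennreal_mult less_imp_le divide_pos_pos c tilt.J_pos[OF \<tau>])
  also have "\<dots> = ennreal (?c z / ?c (\<lambda>_ _. 0) * ?c (\<lambda>_ _. 0)) * total_mass (\<lambda>\<nu>. t \<nu> \<tau>) (\<lambda>\<nu>. totals m z \<nu> + k \<nu>)"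
    by (subst ennreal_mult''[OF less_imp_le[OF c]]) (simp add: mult.assoc)
  also have "?c z / ?c (\<lambda>_ _. 0) * ?c (\<lambda>_ _. 0) = ?c z" using c[of "\<lambda>_ _. 0"] by simp
  finally show ?thesis unfolding prior_integral by simp
qed

lemma kernel_mass_integral:
  assumes "\<tau> \<in> {0..1}"
  shows "(\<integral>\<^sup>+ q. prior q * ennreal (nm_kernel N m (\<lambda>\<nu>. t \<nu> \<tau>) z q) \<partial>lebesgue_param N m) = ennreal (kernel_mass \<tau> z)"
  using kernel_integral[OF assms, of z "\<lambda>_. 0"] by (simp add: kernel_mass_def)

lemma kernel_mass_pos: "\<tau> \<in> {0..1} \<Longrightarrow> 0 < kernel_mass \<tau> z"
  unfolding kernel_mass_def by (intro mult_pos_pos divide_pos_pos prior_const_pos tilt.J_pos)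

lemma ln_kernel_mass:
  assumes "\<tau> \<in> {0..1}"
  shows "ln (kernel_mass \<tau> z) = ln (prior_const N m a z / prior_const N m a (\<lambda>_ _. 0)) + ln (tilt.J \<tau> (totals m z))"
  unfolding kernel_mass_def
  by (rule ln_mult_pos) (intro divide_pos_pos prior_const_pos tilt.J_pos assms)+

lemma ln_kernel_mass_bound:
  "\<exists>C\<ge>0. \<forall>\<tau>\<in>{0..1}. \<forall>z. \<bar>ln (kernel_mass \<tau> z)\<bar> \<le> C * (1 + grand_total N (totals m z))"
proof -
  let ?W = "\<lambda>t z. \<integral>\<^sup>+ q. ennreal (nm_kernel N m t z q) \<partial>prior_measure"
  have W: "?W (\<lambda>\<nu>. t \<nu> \<tau>) z = ennreal (kernel_mass \<tau> z)" if "\<tau> \<in> {0..1}" for \<tau> z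
    unfolding kernel_mass_integral[OF that, symmetric]
    by (intro nn_integral_prior_measure measurable_compose[OF nm_kernel_measurable measurable_ennreal])
  have "\<exists>C\<ge>0. \<forall>s z. (\<forall>\<nu>\<in>{1..N}. t \<nu> 0 \<le> s \<nu> \<and> s \<nu> \<le> t \<nu> 1) \<longrightarrow>
      0 < enn2real (?W s z) \<and> \<bar>ln (enn2real (?W s z))\<bar> \<le> C * (1 + grand_total N (totals m z))"
  proof (rule ln_kernel_integral_bound[where lo = "\<lambda>\<nu>. t \<nu> 0"])
    show "(\<lambda>q. q \<nu> i) \<in> borel_measurable prior_measure" if "\<nu> \<in> {1..N}" "i \<in> {1..m \<nu>}" for \<nu> i
      using coordinate_measurable[where m = m, OF that] by simp
    show "interior_point N m q" if "q \<in> space prior_measure" for q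
      using that interior by (simp add: space_lebesgue_param)
    show "?W (\<lambda>\<nu>. t \<nu> 0) (\<lambda>_ _. 0) < \<infinity>" using W[of 0 "\<lambda>_ _. 0"] by simp
  qed (use tilt.v_meas tilt.nonnull tilt.t_pos less_imp_le in blast)+
  then obtain C where C: "0 \<le> C" "\<And>s z. (\<forall>\<nu>\<in>{1..N}. t \<nu> 0 \<le> s \<nu> \<and> s \<nu> \<le> t \<nu> 1) \<Longrightarrow>
      \<bar>ln (enn2real (?W s z))\<bar> \<le> C * (1 + grand_total N (totals m z))"
    by blast
  show ?thesis
  proof (intro exI[of _ C] conjI ballI allI C(1))
    fix \<tau> :: real and z :: "nat \<Rightarrow> nat \<Rightarrow> nat" assume \<tau>: "\<tau> \<in> {0..1}"
    show "\<bar>ln (kernel_mass \<tau> z)\<bar> \<le> C * (1 + grand_total N (totals m z))"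
      using C(2)[of "\<lambda>\<nu>. t \<nu> \<tau>" z] tilt.t_range(1,2)[OF _ \<tau>] kernel_mass_pos[OF \<tau>, of z]
      by (simp add: W[OF \<tau>] less_imp_le)
  qed
qed

lemma posterior_integral:
  assumes \<tau>: "\<tau> \<in> {0..1}" and [measurable]: "f \<in> borel_measurable (lebesgue_param N m)"
    and f: "\<And>q. q \<in> param_space N m \<Longrightarrow> 0 \<le> f q"
  shows "(LINT q|posterior N m (\<lambda>\<nu>. t \<nu> \<tau>) prior z. f q)
     = enn2real (\<integral>\<^sup>+ q. prior q * ennreal (nm_kernel N m (\<lambda>\<nu>. t \<nu> \<tau>) z q * f q) \<partial>lebesgue_param N m) / kernel_mass \<tau> z"
proof -
  let ?t = "\<lambda>\<nu>. t \<nu> \<tau>"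
  define c where "c = nm_coef N m ?t z"
  have c: "0 < c" unfolding c_def by (rule nm_coef_pos) (rule tilt.t_range(3)[OF _ \<tau>])
  define w where "w = kernel_mass \<tau> z"
  have w: "0 < w" unfolding w_def by (rule kernel_mass_pos[OF \<tau>])
  note [measurable] = prior_measurable
  have ker [measurable]: "nm_kernel N m ?t z \<in> borel_measurable (lebesgue_param N m)" by (rule nm_kernel_measurable)
  have "(\<integral>\<^sup>+ q. prior q * ennreal (joint_mass N m ?t q z) \<partial>lebesgue_param N m)
      = (\<integral>\<^sup>+ q. ennreal c * (prior q * ennreal (nm_kernel N m ?t z q)) \<partial>lebesgue_param N m)"
    using c by (simp add: joint_mass_eq c_def[symmetric] ennreal_mult' less_imp_le mult_ac)
  also have "\<dots> = ennreal (c * w)"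
    using c by (subst nn_integral_cmult) (simp_all add: kernel_mass_integral[OF \<tau>] w_def ennreal_mult' less_imp_le)
  finally have norm: "(\<integral>\<^sup>+ q. prior q * ennreal (joint_mass N m ?t q z) \<partial>lebesgue_param N m) = ennreal (c * w)" .
  have dens: "prior q * ennreal (joint_mass N m ?t q z) / ennreal (c * w)
      = ennreal (1 / w) * (prior q * ennreal (nm_kernel N m ?t z q))" for q
  proof -
    have "ennreal (joint_mass N m ?t q z) / ennreal (c * w) = ennreal (1 / w) * ennreal (nm_kernel N m ?t z q)"
      unfolding joint_mass_eq c_def[symmetric] divide_ennreal_def using c w
      by (simp add: inverse_ennreal ennreal_mult'[symmetric] ennreal_mult''[symmetric] field_simps)
    then show ?thesis by (simp add: ennreal_times_divide[symmetric] mult_ac)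
  qed
  have post: "posterior N m ?t prior z
      = density (lebesgue_param N m) (\<lambda>q. ennreal (1 / w) * (prior q * ennreal (nm_kernel N m ?t z q)))"
    unfolding posterior_def norm dens ..
  have "(LINT q|posterior N m ?t prior z. f q) = enn2real (\<integral>\<^sup>+ q. ennreal (f q) \<partial>posterior N m ?t prior z)"
    by (rule integral_eq_nn_integral) (use f in \<open>auto simp: post space_lebesgue_param intro!: AE_I2\<close>)
  also have "(\<integral>\<^sup>+ q. ennreal (f q) \<partial>posterior N m ?t prior z)
      = (\<integral>\<^sup>+ q. ennreal (1 / w) * (prior q * ennreal (nm_kernel N m ?t z q)) * ennreal (f q) \<partial>lebesgue_param N m)"
    unfolding post by (rule nn_integral_density) measurable
  also have "\<dots> = (\<integral>\<^sup>+ q. ennreal (1 / w) * (prior q * ennreal (nm_kernel N m ?t z q * f q)) \<partial>lebesgue_param N m)"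
    by (intro nn_integral_cong)
       (auto simp: space_lebesgue_param ennreal_mult less_imp_le[OF nm_kernel_pos[OF interior]] f mult.assoc)
  also have "\<dots> = ennreal (1 / w) * (\<integral>\<^sup>+ q. prior q * ennreal (nm_kernel N m ?t z q * f q) \<partial>lebesgue_param N m)"
    by (rule nn_integral_cmult) measurable
  finally show ?thesis using w by (simp add: enn2real_mult w_def)
qed

text \<open>
  A power of a block sum acts like \<open>k\<close> additional counts in that block, without changing the factor
  \<open>C(z)\<close>.
\<close>

lemma post_moment_eq:
  assumes \<tau>: "\<tau> \<in> {0..1}" and \<nu>: "\<nu> \<in> {1..N}"
  shows "post_moment N m (\<lambda>\<mu>. t \<mu> \<tau>) prior \<nu> k z = tilt.moment \<tau> \<nu> k (totals m z)"
proof -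
  define \<kappa> where "\<kappa> = (\<lambda>\<nu>'. if \<nu>' = \<nu> then k else 0)"
  have pw: "psum (m \<nu>) (q \<nu>) ^ k = (\<Prod>\<nu>'\<in>{1..N}. psum (m \<nu>') (q \<nu>') ^ \<kappa> \<nu>')" for q
  proof -
    have "(\<Prod>\<nu>'\<in>{1..N}. psum (m \<nu>') (q \<nu>') ^ \<kappa> \<nu>') = (\<Prod>\<nu>'\<in>{1..N}. if \<nu>' = \<nu> then psum (m \<nu>) (q \<nu>) ^ k else 1)"
      by (intro prod.cong) (auto simp: \<kappa>_def)
    then show ?thesis using \<nu> by (simp add: prod.delta)
  qed
  have up: "(\<lambda>\<nu>'. totals m z \<nu>' + \<kappa> \<nu>') = (totals m z)(\<nu> := totals m z \<nu> + k)"
    by (auto simp: \<kappa>_def fun_eq_iff)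
  have "post_moment N m (\<lambda>\<mu>. t \<mu> \<tau>) prior \<nu> k z
      = enn2real (\<integral>\<^sup>+ q. prior q * ennreal (nm_kernel N m (\<lambda>\<nu>. t \<nu> \<tau>) z q * psum (m \<nu>) (q \<nu>) ^ k) \<partial>lebesgue_param N m) / kernel_mass \<tau> z"
    unfolding post_moment_def
  proof (rule posterior_integral[OF \<tau>])
    show "(\<lambda>q. psum (m \<nu>) (q \<nu>) ^ k) \<in> borel_measurable (lebesgue_param N m)"
      by (intro borel_measurable_power psum_component_measurable \<nu>)
    show "0 \<le> psum (m \<nu>) (q \<nu>) ^ k" if "q \<in> param_space N m" for q
      using param_space_unit[OF that \<nu> m[OF \<nu>]] by simp
  qed
  also have "\<dots> = tilt.moment \<tau> \<nu> k (totals m z)"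
    using prior_const_pos[of z] prior_const_pos[of "\<lambda>_ _. 0"] tilt.J_pos[OF \<tau>]
    unfolding pw kernel_integral[OF \<tau>] up
    by (simp add: tilt.moment_def kernel_mass_def less_imp_le)
  finally show ?thesis .
qed

end

locale prediction = mixture_path +
  fixes n :: nat and s :: "nat \<Rightarrow> real"
  assumes n: "n \<le> N" and s: "\<And>\<nu>. \<nu> \<in> {1..n} \<Longrightarrow> 0 < s \<nu>"
    and t_1: "\<And>\<nu>. \<nu> \<in> {1..N} \<Longrightarrow> t \<nu> 1 = (if \<nu> \<le> n then r \<nu> + s \<nu> else r \<nu>)"
begin

lemma interior_p: "interior_point n m p"
  by (rule param_space_interior_point[OF p m n])

text \<open>
  The sum of the observed and the predicted counts. Values of \<open>y\<close> beyond the first \<open>n\<close> blocks, where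
  nothing is predicted, are ignored.
\<close>

definition pooled :: "(nat \<Rightarrow> nat \<Rightarrow> nat) \<Rightarrow> (nat \<Rightarrow> nat \<Rightarrow> nat) \<Rightarrow> nat \<Rightarrow> nat \<Rightarrow> nat" where
  "pooled x y \<nu> i = x \<nu> i + (if \<nu> \<le> n then y \<nu> i else 0)"

lemma nm_kernel_pooled:
  assumes q: "q \<in> param_space N m"
  shows "nm_kernel N m (\<lambda>\<nu>. t \<nu> 0) x q * nm_kernel n m s y q = nm_kernel N m (\<lambda>\<nu>. t \<nu> 1) (pooled x y) q"
proof -
  have "{\<nu> \<in> {1..N}. \<nu> \<le> n} = {1..n}" using n by auto
  then have eq: "nm_kernel n m s y q
      = (\<Prod>\<nu>\<in>{1..N}. if \<nu> \<le> n then (1 - psum (m \<nu>) (q \<nu>)) powr s \<nu> * (\<Prod>i\<in>{1..m \<nu>}. q \<nu> i ^ y \<nu> i) else 1)"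
    unfolding nm_kernel_def by (subst prod.inter_filter[symmetric]) auto
  show ?thesis
    unfolding eq nm_kernel_def[of N] prod.distrib[symmetric]
    by (intro prod.cong refl) (simp add: t_0 t_1 pooled_def powr_add power_add prod.distrib)
qed

lemma bayes_predictive_eq:
  "bayes_predictive N n m r s prior y x = nm_coef n m s y * (kernel_mass 1 (pooled x y) / kernel_mass 0 x)"
proof -
  have r: "posterior N m r prior x = posterior N m (\<lambda>\<nu>. t \<nu> 0) prior x"
  proof -
    have "joint_mass N m r q z = joint_mass N m (\<lambda>\<nu>. t \<nu> 0) q z" for q z
      unfolding joint_mass_def by (intro prod.cong) (auto simp: t_0)
    then show ?thesis by (simp add: posterior_def)
  qed
  have sub: "{1..n} \<subseteq> {1..N}" using n by auto
  have c: "0 < nm_coef n m s y" by (rule nm_coef_pos) (rule s)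
  have ker [measurable]: "nm_kernel n m s y \<in> borel_measurable (lebesgue_param N m)"
    unfolding nm_kernel_def[abs_def] using sub
    by (intro borel_measurable_prod borel_measurable_times borel_measurable_power powr_real_measurable
      borel_measurable_diff borel_measurable_const psum_component_measurable coordinate_measurable) auto
  have ker0: "0 \<le> nm_kernel n m s y q" if "q \<in> param_space N m" for q
    unfolding nm_kernel_def using param_space_pos[OF that] sub
    by (intro prod_nonneg mult_nonneg_nonneg) (auto simp: less_imp_le subset_iff)
  have "bayes_predictive N n m r s prior y x
      = (LINT q|posterior N m (\<lambda>\<nu>. t \<nu> 0) prior x. nm_coef n m s y * nm_kernel n m s y q)"
    unfolding bayes_predictive_def r joint_mass_eq ..
  also have "\<dots> = nm_coef n m s y * (LINT q|posterior N m (\<lambda>\<nu>. t \<nu> 0) prior x. nm_kernel n m s y q)"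
    by simp
  also have "(LINT q|posterior N m (\<lambda>\<nu>. t \<nu> 0) prior x. nm_kernel n m s y q)
      = enn2real (\<integral>\<^sup>+ q. prior q * ennreal (nm_kernel N m (\<lambda>\<nu>. t \<nu> 0) x q * nm_kernel n m s y q) \<partial>lebesgue_param N m) / kernel_mass 0 x"
    by (rule posterior_integral) (use ker ker0 in auto)
  also have "(\<integral>\<^sup>+ q. prior q * ennreal (nm_kernel N m (\<lambda>\<nu>. t \<nu> 0) x q * nm_kernel n m s y q) \<partial>lebesgue_param N m)
      = ennreal (kernel_mass 1 (pooled x y))"
    unfolding kernel_mass_integral[of 1, simplified, symmetric]
    by (intro nn_integral_cong) (simp add: nm_kernel_pooled space_lebesgue_param)
  finally show ?thesis using kernel_mass_pos[of 1 "pooled x y"] by (simp add: less_imp_le)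
qed

lemma log_ratio_eq:
  "log_ratio n m s p (bayes_predictive N n m r s prior) (x, y)
     = ln (nm_kernel n m s y p) + ln (kernel_mass 0 x) - ln (kernel_mass 1 (pooled x y))"
proof -
  have c: "0 < nm_coef n m s y" by (rule nm_coef_pos) (rule s)
  have k: "0 < nm_kernel n m s y p" by (rule nm_kernel_pos[OF interior_p])
  have w: "0 < kernel_mass 0 x" "0 < kernel_mass 1 (pooled x y)" by (auto intro: kernel_mass_pos)
  have "joint_mass n m s p y / bayes_predictive N n m r s prior y x
      = nm_kernel n m s y p * kernel_mass 0 x / kernel_mass 1 (pooled x y)"
    unfolding joint_mass_eq bayes_predictive_eq using c by simp
  then have "log_ratio n m s p (bayes_predictive N n m r s prior) (x, y)
      = ln (nm_kernel n m s y p * kernel_mass 0 x / kernel_mass 1 (pooled x y))"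
    by (simp only: log_ratio_def prod.case)
  then show ?thesis using k w by (simp add: ln_div ln_mult)
qed

definition pooled_totals :: "(nat \<Rightarrow> nat \<Rightarrow> nat) \<times> (nat \<Rightarrow> nat \<Rightarrow> nat) \<Rightarrow> nat \<Rightarrow> nat" where
  "pooled_totals = (\<lambda>(x, y) \<nu>. totals m x \<nu> + totals m y \<nu>)"

lemma map_pooled_totals: "map_pmf pooled_totals (obs_pmf N n m r s p) = tilt.NB 1"
proof -
  have "map_pmf pooled_totals (obs_pmf N n m r s p)
      = nb_product N (\<lambda>\<nu>. if \<nu> \<le> n then r \<nu> + s \<nu> else r \<nu>) (\<lambda>\<nu>. psum (m \<nu>) (p \<nu>))"
    unfolding pooled_totals_def by (rule map_totals_obs_pmf[OF n r_pos s p])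
  also have "\<dots> = tilt.NB 1" unfolding nb_product_def by (intro Pi_pmf_cong) (auto simp: t_1)
  finally show ?thesis .
qed

lemma map_fst_totals: "map_pmf (\<lambda>(x, y). totals m x) (obs_pmf N n m r s p) = tilt.NB 0"
proof -
  have "(\<lambda>(x :: nat \<Rightarrow> nat \<Rightarrow> nat, y :: nat \<Rightarrow> nat \<Rightarrow> nat). totals m x) = totals m \<circ> fst"
    by (simp add: fun_eq_iff)
  then have "map_pmf (\<lambda>(x, y). totals m x) (obs_pmf N n m r s p) = map_pmf (totals m) (map_pmf fst (obs_pmf N n m r s p))"
    by (simp only: pmf.map_comp)
  also have "\<dots> = map_pmf (totals m) (nm_product_pmf N m r p)"
    by (simp add: obs_pmf_def map_fst_pair_pmf)
  also have "\<dots> = nb_product N r (\<lambda>\<nu>. psum (m \<nu>) (p \<nu>))"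
    by (rule map_totals_nm_product_pmf[OF r_pos p])
  also have "\<dots> = tilt.NB 0" unfolding nb_product_def by (intro Pi_pmf_cong) (auto simp: t_0)
  finally show ?thesis .
qed

lemma totals_pooled:
  assumes "(x, y) \<in> set_pmf (obs_pmf N n m r s p)"
  shows "totals m (pooled x y) = pooled_totals (x, y)"
proof
  fix \<nu>
  have "y \<in> set_pmf (nm_product_pmf n m s p)" using assms by (simp add: obs_pmf_def)
  moreover have "set_pmf (nm_product_pmf n m s p) \<subseteq> {y. \<forall>\<nu>. \<nu> \<notin> {1..n} \<longrightarrow> y \<nu> = (\<lambda>_. 0)}"
    unfolding nm_product_pmf_def by (rule set_Pi_pmf_subset) simp
  ultimately have y: "\<nu> \<notin> {1..n} \<longrightarrow> y \<nu> = (\<lambda>_. 0)" by blast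
  show "totals m (pooled x y) \<nu> = pooled_totals (x, y) \<nu>"
  proof (cases "\<nu> \<le> n")
    case True
    then show ?thesis by (simp add: totals_def pooled_def pooled_totals_def sum.distrib)
  next
    case False
    then have "y \<nu> = (\<lambda>_. 0)" using y by simp
    then show ?thesis using False by (simp add: totals_def pooled_def pooled_totals_def)
  qed
qed

text \<open>
  The general bound for kernel masses, applied to the point mass at the true parameter.
\<close>

lemma ln_nm_kernel_bound: "\<exists>C\<ge>0. \<forall>y. \<bar>ln (nm_kernel n m s y p)\<bar> \<le> C * (1 + grand_total n (totals m y))"
proof -
  have pos: "0 < nm_kernel n m s y p" for y by (rule nm_kernel_pos[OF interior_p])
  have W: "(\<integral>\<^sup>+ x. ennreal (nm_kernel n m t y p) \<partial>count_space {()}) = ennreal (nm_kernel n m t y p)" for t y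
    by (simp add: nn_integral_count_space_finite)
  have "\<exists>C\<ge>0. \<forall>t z. (\<forall>\<nu>\<in>{1..n}. s \<nu> \<le> t \<nu> \<and> t \<nu> \<le> s \<nu>) \<longrightarrow>
      0 < enn2real (\<integral>\<^sup>+ x. ennreal (nm_kernel n m t z p) \<partial>count_space {()}) \<and>
      \<bar>ln (enn2real (\<integral>\<^sup>+ x. ennreal (nm_kernel n m t z p) \<partial>count_space {()}))\<bar> \<le> C * (1 + grand_total n (totals m z))"
    by (rule ln_kernel_integral_bound[where lo = s]) (use interior_p s in \<open>auto simp: less_imp_le W\<close>)
  then obtain C where "0 \<le> C" "\<And>t z. (\<forall>\<nu>\<in>{1..n}. s \<nu> \<le> t \<nu> \<and> t \<nu> \<le> s \<nu>) \<Longrightarrow>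
      \<bar>ln (enn2real (\<integral>\<^sup>+ x. ennreal (nm_kernel n m t z p) \<partial>count_space {()}))\<bar> \<le> C * (1 + grand_total n (totals m z))"
    by blast
  from this(1) this(2)[of s] show ?thesis
    unfolding W using pos by (intro exI[of _ C]) (simp add: less_imp_le)
qed

lemma log_ratio_integrable:
  "integrable (obs_pmf N n m r s p) (log_ratio n m s p (bayes_predictive N n m r s prior))"
proof -
  obtain A where A: "0 \<le> A" "\<And>\<tau> z. \<tau> \<in> {0..1} \<Longrightarrow> \<bar>ln (kernel_mass \<tau> z)\<bar> \<le> A * (1 + grand_total N (totals m z))"
    using ln_kernel_mass_bound by blast
  obtain B where B: "0 \<le> B" "\<And>y. \<bar>ln (nm_kernel n m s y p)\<bar> \<le> B * (1 + grand_total n (totals m y))"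
    using ln_nm_kernel_bound by blast
  let ?G = "\<lambda>\<omega>. grand_total N (pooled_totals \<omega>)"
  have g_mono: "grand_total N \<zeta> \<le> grand_total N \<zeta>'" if "\<And>\<nu>. \<zeta> \<nu> \<le> \<zeta>' \<nu>" for \<zeta> \<zeta>' :: "nat \<Rightarrow> nat"
    unfolding grand_total_def using that by (intro of_nat_mono sum_mono)
  have bound: "\<bar>log_ratio n m s p (bayes_predictive N n m r s prior) \<omega>\<bar> \<le> (B + A + A) * (1 + ?G \<omega>)" for \<omega>
  proof (cases \<omega>)
    case (Pair x y)
    have "grand_total n (totals m y) \<le> grand_total N (totals m y)"
      unfolding grand_total_def using n by (intro of_nat_mono sum_mono2) auto
    also have "\<dots> \<le> ?G \<omega>" by (rule g_mono) (simp add: Pair pooled_totals_def)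
    finally have 1: "\<bar>ln (nm_kernel n m s y p)\<bar> \<le> B * (1 + ?G \<omega>)"
      using B by (intro order_trans[OF B(2)] mult_left_mono) auto
    have "grand_total N (totals m x) \<le> ?G \<omega>" by (rule g_mono) (simp add: Pair pooled_totals_def)
    then have 2: "\<bar>ln (kernel_mass 0 x)\<bar> \<le> A * (1 + ?G \<omega>)"
      using A(1) by (intro order_trans[OF A(2)] mult_left_mono) auto
    have "grand_total N (totals m (pooled x y)) \<le> ?G \<omega>"
      by (rule g_mono) (auto simp: Pair pooled_totals_def totals_def pooled_def sum.distrib intro!: sum_mono)
    then have 3: "\<bar>ln (kernel_mass 1 (pooled x y))\<bar> \<le> A * (1 + ?G \<omega>)"
      using A(1) by (intro order_trans[OF A(2)] mult_left_mono) auto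
    show ?thesis
      using 1 2 3 unfolding distrib_right[of "B + A"] distrib_right[of B] Pair log_ratio_eq by linarith
  qed
  have "integrable (tilt.NB 1) (\<lambda>\<zeta>. (B + A + A) * (1 + grand_total N \<zeta>))"
  proof (rule tilt.NB_integrable)
    show "\<bar>(B + A + A) * (1 + grand_total N \<zeta>)\<bar> \<le> (B + A + A) * (1 + grand_total N \<zeta>)\<^sup>2" for \<zeta>
      using A(1) B(1) tilt.linear_le_square[of "B + A + A" \<zeta>] by simp
  qed simp
  then have "integrable (obs_pmf N n m r s p) (\<lambda>\<omega>. (B + A + A) * (1 + ?G \<omega>))"
    unfolding map_pooled_totals[symmetric] integrable_map_pmf_eq .
  then show ?thesis
  proof (rule Bochner_Integration.integrable_bound)
    show "AE \<omega> in obs_pmf N n m r s p. norm (log_ratio n m s p (bayes_predictive N n m r s prior) \<omega>)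
        \<le> norm ((B + A + A) * (1 + ?G \<omega>))"
      unfolding real_norm_def by (intro AE_I2 order_trans[OF bound abs_ge_self])
  qed simp
qed

text \<open>
  The part of the log ratio that is common to all priors of the model.
\<close>

definition baseline :: "(nat \<Rightarrow> nat \<Rightarrow> nat) \<times> (nat \<Rightarrow> nat \<Rightarrow> nat) \<Rightarrow> real" where
  "baseline = (\<lambda>(x, y). ln (nm_kernel n m s y p) + ln (prior_const N m a x / prior_const N m a (\<lambda>_ _. 0))
     - ln (prior_const N m a (pooled x y) / prior_const N m a (\<lambda>_ _. 0)))"

text \<open>
  The totals of the observation have the law at the start of the path, those of the pooled counts
  the law at its end.
\<close>

lemma risk_decomposition:
  "risk N n m r s p (bayes_predictive N n m r s prior)
     = measure_pmf.expectation (obs_pmf N n m r s p) baseline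
       + measure_pmf.expectation (tilt.NB 0) (\<lambda>\<zeta>. ln (tilt.J 0 \<zeta>))
       - measure_pmf.expectation (tilt.NB 1) (\<lambda>\<zeta>. ln (tilt.J 1 \<zeta>))"
proof -
  let ?O = "obs_pmf N n m r s p"
  let ?l = "log_ratio n m s p (bayes_predictive N n m r s prior)"
  let ?X = "\<lambda>(x :: nat \<Rightarrow> nat \<Rightarrow> nat, y :: nat \<Rightarrow> nat \<Rightarrow> nat). totals m x"
  have 0: "integrable ?O (\<lambda>\<omega>. ln (tilt.J 0 (?X \<omega>)))"
    using tilt.log_J_integrable[of 0] unfolding map_fst_totals[symmetric] integrable_map_pmf_eq by simp
  have 1: "integrable ?O (\<lambda>\<omega>. ln (tilt.J 1 (pooled_totals \<omega>)))"
    using tilt.log_J_integrable[of 1] unfolding map_pooled_totals[symmetric] integrable_map_pmf_eq by simp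
  have ae: "AE \<omega> in ?O. ?l \<omega> - ln (tilt.J 0 (?X \<omega>)) + ln (tilt.J 1 (pooled_totals \<omega>)) = baseline \<omega>"
  proof (subst AE_measure_pmf_iff, intro ballI)
    fix \<omega> assume \<omega>: "\<omega> \<in> set_pmf ?O"
    obtain x y where xy: "\<omega> = (x, y)" by (cases \<omega>)
    show "?l \<omega> - ln (tilt.J 0 (?X \<omega>)) + ln (tilt.J 1 (pooled_totals \<omega>)) = baseline \<omega>"
      using totals_pooled[OF \<omega>[unfolded xy]] unfolding xy log_ratio_eq
      by (simp add: ln_kernel_mass baseline_def)
  qed
  have "measure_pmf.expectation ?O baseline
      = measure_pmf.expectation ?O (\<lambda>\<omega>. ?l \<omega> - ln (tilt.J 0 (?X \<omega>)) + ln (tilt.J 1 (pooled_totals \<omega>)))"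
    by (rule integral_cong_AE) (use ae in auto)
  also have "\<dots> = measure_pmf.expectation ?O ?l - measure_pmf.expectation ?O (\<lambda>\<omega>. ln (tilt.J 0 (?X \<omega>)))
      + measure_pmf.expectation ?O (\<lambda>\<omega>. ln (tilt.J 1 (pooled_totals \<omega>)))"
    using 0 1 log_ratio_integrable by simp
  also have "measure_pmf.expectation ?O (\<lambda>\<omega>. ln (tilt.J 0 (?X \<omega>))) = measure_pmf.expectation (tilt.NB 0) (\<lambda>\<zeta>. ln (tilt.J 0 \<zeta>))"
    unfolding map_fst_totals[symmetric] integral_map_pmf ..
  also have "measure_pmf.expectation ?O (\<lambda>\<omega>. ln (tilt.J 1 (pooled_totals \<omega>))) = measure_pmf.expectation (tilt.NB 1) (\<lambda>\<zeta>. ln (tilt.J 1 \<zeta>))"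
    unfolding map_pooled_totals[symmetric] integral_map_pmf ..
  finally show ?thesis unfolding risk_def by simp
qed

text \<open>
  The loss is an affine function of \<open>m\<close> and \<open>ln m\<close>, and its constant part is the same for all
  priors.
\<close>

lemma expectation_KL_loss:
  fixes k :: nat
  assumes \<tau>: "\<tau> \<in> {0..1}" and \<nu>: "\<nu> \<in> {1..N}"
  defines "\<theta> \<equiv> psum (m \<nu>) (p \<nu>) ^ k"
  defines "K \<equiv> \<lambda>z. KL_loss (post_moment N m (\<lambda>\<mu>. t \<mu> \<tau>) prior \<nu> k z) \<theta>"
  shows "integrable (nm_product_pmf N m (\<lambda>\<mu>. t \<mu> \<tau>) p) K"
    and "measure_pmf.expectation (nm_product_pmf N m (\<lambda>\<mu>. t \<mu> \<tau>) p) K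
       = (\<theta> * ln \<theta> - \<theta>) - measure_pmf.expectation (tilt.NB \<tau>)
           (\<lambda>\<zeta>. \<theta> * ln (tilt.moment \<tau> \<nu> k \<zeta>) - tilt.moment \<tau> \<nu> k \<zeta>)"
proof -
  let ?f = "\<lambda>\<zeta>. (\<theta> * ln \<theta> - \<theta>) - (\<theta> * ln (tilt.moment \<tau> \<nu> k \<zeta>) - tilt.moment \<tau> \<nu> k \<zeta>)"
  have \<theta>: "0 < \<theta>" unfolding \<theta>_def using param_space_unit(1)[OF p \<nu> m[OF \<nu>]] by simp
  have K: "K = (\<lambda>z. ?f (totals m z))"
  proof
    fix z
    show "K z = ?f (totals m z)"
      using tilt.moment_pos[OF \<tau>, of \<nu> k "totals m z"] \<theta>
      by (simp add: K_def KL_loss_def post_moment_eq[OF \<tau> \<nu>] ln_div algebra_simps)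
  qed
  have map: "map_pmf (totals m) (nm_product_pmf N m (\<lambda>\<mu>. t \<mu> \<tau>) p) = tilt.NB \<tau>"
    by (rule map_totals_nm_product_pmf[OF tilt.t_range(3)[OF _ \<tau>] p])
  have int: "integrable (tilt.NB \<tau>) (\<lambda>\<zeta>. \<theta> * ln (tilt.moment \<tau> \<nu> k \<zeta>) - tilt.moment \<tau> \<nu> k \<zeta>)"
    by (intro Bochner_Integration.integrable_diff integrable_mult_right tilt.ln_moment_integrable tilt.moment_integrable \<tau> \<nu>)
  have "integrable (tilt.NB \<tau>) ?f" using int by simp
  then show "integrable (nm_product_pmf N m (\<lambda>\<mu>. t \<mu> \<tau>) p) K"
    unfolding K map[symmetric] integrable_map_pmf_eq .
  have "measure_pmf.expectation (nm_product_pmf N m (\<lambda>\<mu>. t \<mu> \<tau>) p) K = measure_pmf.expectation (tilt.NB \<tau>) ?f"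
    unfolding K map[symmetric] integral_map_pmf ..
  also have "\<dots> = (\<theta> * ln \<theta> - \<theta>) - measure_pmf.expectation (tilt.NB \<tau>)
           (\<lambda>\<zeta>. \<theta> * ln (tilt.moment \<tau> \<nu> k \<zeta>) - tilt.moment \<tau> \<nu> k \<zeta>)"
    using int by (subst Bochner_Integration.integral_diff) auto
  finally show "measure_pmf.expectation (nm_product_pmf N m (\<lambda>\<mu>. t \<mu> \<tau>) p) K
       = (\<theta> * ln \<theta> - \<theta>) - measure_pmf.expectation (tilt.NB \<tau>)
           (\<lambda>\<zeta>. \<theta> * ln (tilt.moment \<tau> \<nu> k \<zeta>) - tilt.moment \<tau> \<nu> k \<zeta>)" .
qed

end

lemma dirichlet_prior_eq_mixture:
  "dirichlet_prior N m a0 a = mixture_prior N m (return (restrict_space borel {0<..}) 1) (\<lambda>_ _. 0) a0 a"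
proof
  fix p
  have "1 \<in> space (restrict_space borel {0 :: real<..})" by (simp add: space_restrict_space)
  then show "dirichlet_prior N m a0 a p = mixture_prior N m (return (restrict_space borel {0<..}) 1) (\<lambda>_ _. 0) a0 a p"
    unfolding mixture_prior_def by (subst nn_integral_return) simp_all
qed

text \<open>
  The kernel mass is a product over the blocks, one of whose factors would be an infinite Beta
  integral; then the product is infinite or zero.
\<close>

lemma dirichlet_well_defined_imp_pos:
  assumes m: "\<And>\<nu>. \<nu> \<in> {1..N} \<Longrightarrow> 1 \<le> m \<nu>"
    and a: "\<And>\<nu> i. \<nu> \<in> {1..N} \<Longrightarrow> i \<in> {1..m \<nu>} \<Longrightarrow> 0 < a \<nu> i"
    and wd: "posterior_well_defined N m r (dirichlet_prior N m a0 a)" and \<nu>: "\<nu> \<in> {1..N}"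
  shows "0 < a0 \<nu> + r \<nu>"
proof (rule ccontr)
  assume "\<not> ?thesis"
  then have le: "a0 \<nu> + r \<nu> \<le> 0" by simp
  let ?F = "\<lambda>\<nu>. \<integral>\<^sup>+ v. halfline_power (psum (m \<nu>) (a \<nu>)) v * halfline_power (a0 \<nu> + r \<nu>) (1 - v) \<partial>lborel"
  let ?I = "\<integral>\<^sup>+ q. dirichlet_prior N m a0 a q * ennreal (nm_kernel N m r (\<lambda>_ _. 0) q) \<partial>lebesgue_param N m"
  have I: "0 < ?I" "?I < \<infinity>"
    using wd[unfolded posterior_well_defined_def Let_def, rule_format, of "\<lambda>_ _. 0"]
    unfolding nm_kernel_def by blast+
  have "?I = ennreal (prior_const N m a (\<lambda>_ _. 0)) * (\<Prod>\<nu>\<in>{1..N}. ?F \<nu>)"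
    using dirichlet_prior_integral[where c = a0 and t = r and z = "\<lambda>_ _. 0" and k = "\<lambda>_. 0", OF m a]
    by (simp add: totals_def)
  also have "(\<Prod>\<nu>\<in>{1..N}. ?F \<nu>) = ?F \<nu> * (\<Prod>\<nu>\<in>{1..N} - {\<nu>}. ?F \<nu>)"
    using \<nu> by (simp add: prod.remove)
  also have "?F \<nu> = \<infinity>"
    using m[OF \<nu>] a[OF \<nu>] le by (intro Beta_nn_integral_infinite) (auto simp: psum_def intro!: sum_pos)
  finally have "?I = ennreal (prior_const N m a (\<lambda>_ _. 0)) * (\<infinity> * (\<Prod>\<nu>\<in>{1..N} - {\<nu>}. ?F \<nu>))" .
  then have "?I = 0 \<or> ?I = \<infinity>"
    by (cases "(\<Prod>\<nu>\<in>{1..N} - {\<nu>}. ?F \<nu>) = 0"; cases "ennreal (prior_const N m a (\<lambda>_ _. 0)) = 0")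
       (simp_all add: ennreal_top_mult ennreal_mult_top)
  then show False using I by auto
qed

section \<open>The risk difference\<close>

theorem corollary5p1:
  fixes N n :: nat and m :: "nat \<Rightarrow> nat" and r s :: "nat \<Rightarrow> real"
    and t :: "nat \<Rightarrow> real \<Rightarrow> real"
    and a0 :: "nat \<Rightarrow> real" and a :: "nat \<Rightarrow> nat \<Rightarrow> real"
    and M :: "real measure" and \<gamma> :: "nat \<Rightarrow> real \<Rightarrow> real"
    and p :: "nat \<Rightarrow> nat \<Rightarrow> real"
  defines "\<pi>\<^sub>0 \<equiv> dirichlet_prior N m a0 a"
    and "\<pi>\<^sub>M \<equiv> mixture_prior N m M \<gamma> a0 a"
  assumes N: "1 \<le> N" and n: "n \<in> {1..N}"
    and m: "\<And>\<nu>. \<nu> \<in> {1..N} \<Longrightarrow> 1 \<le> m \<nu>"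
    and r: "\<And>\<nu>. \<nu> \<in> {1..N} \<Longrightarrow> 0 < r \<nu>"
    and s: "\<And>\<nu>. \<nu> \<in> {1..n} \<Longrightarrow> 0 < s \<nu>"
    and t_pos: "\<And>\<nu> \<tau>. \<nu> \<in> {1..N} \<Longrightarrow> \<tau> \<in> {0..1} \<Longrightarrow> 0 < t \<nu> \<tau>"
    and t_smooth: "\<And>\<nu>. \<nu> \<in> {1..N} \<Longrightarrow> smooth_on_01 (t \<nu>)"
    and t_mono: "\<And>\<nu>. \<nu> \<in> {1..N} \<Longrightarrow> mono_on {0..1} (t \<nu>)"
    and t_0: "\<And>\<nu>. \<nu> \<in> {1..N} \<Longrightarrow> t \<nu> 0 = r \<nu>"
    and t_1: "\<And>\<nu>. \<nu> \<in> {1..N} \<Longrightarrow> t \<nu> 1 = (if \<nu> \<le> n then r \<nu> + s \<nu> else r \<nu>)"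
    and a: "\<And>\<nu> i. \<nu> \<in> {1..N} \<Longrightarrow> i \<in> {1..m \<nu>} \<Longrightarrow> 0 < a \<nu> i"
    and M: "sets M = sets (restrict_space borel {0<..})"
    and \<gamma>_meas: "\<And>\<nu>. \<nu> \<in> {1..N} \<Longrightarrow> \<gamma> \<nu> \<in> borel_measurable M"
    and \<gamma>_pos: "\<And>\<nu> u. \<nu> \<in> {1..N} \<Longrightarrow> 0 < u \<Longrightarrow> 0 < \<gamma> \<nu> u"
    and post_0: "posterior_well_defined N m r \<pi>\<^sub>0"
    and post_M: "posterior_well_defined N m r \<pi>\<^sub>M"
    and p: "p \<in> param_space N m"
  shows
    \<comment> \<open>the expectations, the series and the integral in the identity exist\<close>
    "integrable (obs_pmf N n m r s p) (log_ratio n m s p (bayes_predictive N n m r s \<pi>\<^sub>M)) \<and>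
     integrable (obs_pmf N n m r s p) (log_ratio n m s p (bayes_predictive N n m r s \<pi>\<^sub>0)) \<and>
     (\<forall>\<tau>\<in>{0..1}. \<forall>\<nu>\<in>{1..n}. \<forall>k\<ge>1.
        integrable (nm_product_pmf N m (\<lambda>\<mu>. t \<mu> \<tau>) p)
          (KL_loss_diff N m (\<lambda>\<mu>. t \<mu> \<tau>) \<pi>\<^sub>M \<pi>\<^sub>0 p \<nu> k)) \<and>
     (\<forall>\<tau>\<in>{0..1}. \<forall>\<nu>\<in>{1..n}.
        summable (\<lambda>k. 1 / real (Suc k) *
          measure_pmf.expectation (nm_product_pmf N m (\<lambda>\<mu>. t \<mu> \<tau>) p)
            (KL_loss_diff N m (\<lambda>\<mu>. t \<mu> \<tau>) \<pi>\<^sub>M \<pi>\<^sub>0 p \<nu> (Suc k)))) \<and>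
     set_integrable lborel {0..1}
       (\<lambda>\<tau>. \<Sum>\<nu>\<in>{1..n}. vector_derivative (t \<nu>) (at \<tau> within {0..1}) *
          (\<Sum>k. 1 / real (Suc k) *
             measure_pmf.expectation (nm_product_pmf N m (\<lambda>\<mu>. t \<mu> \<tau>) p)
               (KL_loss_diff N m (\<lambda>\<mu>. t \<mu> \<tau>) \<pi>\<^sub>M \<pi>\<^sub>0 p \<nu> (Suc k)))) \<and>
     risk N n m r s p (bayes_predictive N n m r s \<pi>\<^sub>M)
       - risk N n m r s p (bayes_predictive N n m r s \<pi>\<^sub>0)
     = (LINT \<tau>:{0..1}|lborel.
          (\<Sum>\<nu>\<in>{1..n}. vector_derivative (t \<nu>) (at \<tau> within {0..1}) *
             (\<Sum>k. 1 / real (Suc k) *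
                measure_pmf.expectation (nm_product_pmf N m (\<lambda>\<mu>. t \<mu> \<tau>) p)
                  (KL_loss_diff N m (\<lambda>\<mu>. t \<mu> \<tau>) \<pi>\<^sub>M \<pi>\<^sub>0 p \<nu> (Suc k)))))"
proof -
  define P where "P = (\<lambda>\<nu>. psum (m \<nu>) (p \<nu>))"
  define t' where "t' = (\<lambda>\<nu> \<tau>. vector_derivative (t \<nu>) (at \<tau> within {0..1}))"
  have t_smooth_C1: "(t \<nu> has_real_derivative t' \<nu> \<tau>) (at \<tau> within {0..1})"
      "continuous_on {0..1} (t' \<nu>)" if \<nu>: "\<nu> \<in> {1..N}" and \<tau>: "\<tau> \<in> {0..1}" for \<nu> \<tau>
  proof -
    obtain d where d: "d 0 = t \<nu>"
        "\<And>k \<tau>. \<tau> \<in> {0..1} \<Longrightarrow> (d k has_real_derivative d (Suc k) \<tau>) (at \<tau> within {0..1})"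
      using t_smooth[OF \<nu>] unfolding smooth_on_01_def by blast
    have eq: "t' \<nu> \<tau> = d (Suc 0) \<tau>" if "\<tau> \<in> {0..1}" for \<tau>
      unfolding t'_def using d(2)[OF that, of 0] that
      by (intro vector_derivative_within_closed_interval)
         (auto simp: d(1) has_real_derivative_iff_has_vector_derivative)
    show "(t \<nu> has_real_derivative t' \<nu> \<tau>) (at \<tau> within {0..1})"
      using d(2)[OF \<tau>, of 0] by (simp add: eq[OF \<tau>] d(1))
    have "continuous_on {0..1} (d (Suc 0))" using d(2) by (rule DERIV_continuous_on)
    then show "continuous_on {0..1} (t' \<nu>)" by (rule continuous_on_eq) (simp add: eq)
  qed
  have t'_cont: "continuous_on {0..1} (t' \<nu>)" if "\<nu> \<in> {1..N}" for \<nu>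
    using t_smooth_C1(2)[OF that, of 0] by simp
  \<comment> \<open>Beyond the first \<open>n\<close> blocks the path is monotone with equal endpoints, hence constant.\<close>
  have t'_0: "t' \<nu> \<tau> = 0" if \<nu>: "\<nu> \<in> {1..N} - {1..n}" and \<tau>: "\<tau> \<in> {0..1}" for \<nu> \<tau>
  proof -
    have const: "t \<nu> \<sigma> = r \<nu>" if \<sigma>: "\<sigma> \<in> {0..1}" for \<sigma>
      using mono_onD[OF t_mono, of \<nu> 0 \<sigma>] mono_onD[OF t_mono, of \<nu> \<sigma> 1] \<nu> \<sigma> t_0[of \<nu>] t_1[of \<nu>] by auto
    have "((\<lambda>_. r \<nu>) has_vector_derivative 0) (at \<tau> within {0..1})" by simp
    then have "(t \<nu> has_vector_derivative 0) (at \<tau> within {0..1})"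
      by (rule has_vector_derivative_transform[OF \<tau>, rotated]) (rule const)
    then show ?thesis unfolding t'_def using \<tau> by (intro vector_derivative_within_closed_interval) auto
  qed
  have a0_r: "0 < a0 \<nu> + r \<nu>" if "\<nu> \<in> {1..N}" for \<nu>
    using dirichlet_well_defined_imp_pos[of N m a r a0, OF m a post_0[unfolded \<pi>\<^sub>0_def] that] .
  have space_M: "space M = {0<..}"
    using sets_eq_imp_space_eq[OF M] by (simp add: space_restrict_space)
  define M0 :: "real measure" where "M0 = return (restrict_space borel {0<..}) 1"
  have prior_0: "\<pi>\<^sub>0 = mixture_prior N m M0 (\<lambda>_ _. 0) a0 a"
    unfolding \<pi>\<^sub>0_def M0_def by (rule dirichlet_prior_eq_mixture)
  interpret mix: prediction N m M \<gamma> a0 a r t t' p n s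
    by unfold_locales
      (use m a \<gamma>_meas \<gamma>_pos post_M[unfolded \<pi>\<^sub>M_def] a0_r r t_0 t_mono t_smooth_C1(1) t'_cont p n s t_1 space_M in
        \<open>auto simp: less_imp_le\<close>)
  interpret dir: prediction N m M0 "\<lambda>_ _. 0" a0 a r t t' p n s
    by unfold_locales
      (use m a post_0[unfolded prior_0] a0_r r t_0 t_mono t_smooth_C1(1) t'_cont p n s t_1 in auto)
  note prior_eqs = \<pi>\<^sub>M_def prior_0
  let ?NM = "\<lambda>\<tau>. nm_product_pmf N m (\<lambda>\<mu>. t \<mu> \<tau>) p"
  let ?D = "\<lambda>\<tau> \<nu> k. KL_loss_diff N m (\<lambda>\<mu>. t \<mu> \<tau>) \<pi>\<^sub>M \<pi>\<^sub>0 p \<nu> k"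
  have D_eq: "?D \<tau> \<nu> k = (\<lambda>z. KL_loss (post_moment N m (\<lambda>\<mu>. t \<mu> \<tau>) \<pi>\<^sub>M \<nu> k z) (psum (m \<nu>) (p \<nu>) ^ k)
      - KL_loss (post_moment N m (\<lambda>\<mu>. t \<mu> \<tau>) \<pi>\<^sub>0 \<nu> k z) (psum (m \<nu>) (p \<nu>) ^ k))" for \<tau> \<nu> k
    by (simp add: KL_loss_diff_def fun_eq_iff)
  have D_int: "integrable (?NM \<tau>) (?D \<tau> \<nu> k)" if "\<tau> \<in> {0..1}" "\<nu> \<in> {1..N}" for \<tau> \<nu> k
    unfolding D_eq unfolding prior_eqs
    by (intro Bochner_Integration.integrable_diff mix.expectation_KL_loss(1) dir.expectation_KL_loss(1) that)
  \<comment> \<open>The constant parts of the two losses cancel, which leaves the two drifts.\<close>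
  have D_sums: "(\<lambda>k. 1 / real (Suc k) * measure_pmf.expectation (?NM \<tau>) (?D \<tau> \<nu> (Suc k)))
      sums (dir.tilt.drift \<tau> \<nu> - mix.tilt.drift \<tau> \<nu>)" if \<tau>: "\<tau> \<in> {0..1}" and \<nu>: "\<nu> \<in> {1..N}" for \<tau> \<nu>
  proof -
    have "measure_pmf.expectation (?NM \<tau>) (?D \<tau> \<nu> k)
      = measure_pmf.expectation (dir.tilt.NB \<tau>) (\<lambda>\<zeta>. psum (m \<nu>) (p \<nu>) ^ k * ln (dir.tilt.moment \<tau> \<nu> k \<zeta>) - dir.tilt.moment \<tau> \<nu> k \<zeta>)
        - measure_pmf.expectation (mix.tilt.NB \<tau>) (\<lambda>\<zeta>. psum (m \<nu>) (p \<nu>) ^ k * ln (mix.tilt.moment \<tau> \<nu> k \<zeta>) - mix.tilt.moment \<tau> \<nu> k \<zeta>)" for k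
      unfolding D_eq unfolding prior_eqs
      by (subst Bochner_Integration.integral_diff[OF mix.expectation_KL_loss(1)[OF \<tau> \<nu>] dir.expectation_KL_loss(1)[OF \<tau> \<nu>]])
         (simp only: mix.expectation_KL_loss(2)[OF \<tau> \<nu>] dir.expectation_KL_loss(2)[OF \<tau> \<nu>])
    then show ?thesis
      using sums_diff[OF dir.tilt.drift_sums[OF \<tau> \<nu>] mix.tilt.drift_sums[OF \<tau> \<nu>]]
      by (simp only: right_diff_distrib)
  qed
  let ?G = "\<lambda>\<tau>. \<Sum>\<nu>\<in>{1..n}. vector_derivative (t \<nu>) (at \<tau> within {0..1}) *
      (\<Sum>k. 1 / real (Suc k) * measure_pmf.expectation (?NM \<tau>) (?D \<tau> \<nu> (Suc k)))"
  let ?GD = "\<lambda>\<tau>. \<Sum>\<nu>\<in>{1..N}. t' \<nu> \<tau> * dir.tilt.drift \<tau> \<nu>"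
  let ?GM = "\<lambda>\<tau>. \<Sum>\<nu>\<in>{1..N}. t' \<nu> \<tau> * mix.tilt.drift \<tau> \<nu>"
  have sub: "{1..n} \<subseteq> {1..N}" using n by auto
  have G_eq: "?G \<tau> = ?GD \<tau> - ?GM \<tau>" if \<tau>: "\<tau> \<in> {0..1}" for \<tau>
  proof -
    have "?G \<tau> = (\<Sum>\<nu>\<in>{1..n}. t' \<nu> \<tau> * (dir.tilt.drift \<tau> \<nu> - mix.tilt.drift \<tau> \<nu>))"
      using sub by (intro sum.cong refl) (simp only: t'_def sums_unique[OF D_sums[OF \<tau>], symmetric] subset_iff)
    also have "\<dots> = (\<Sum>\<nu>\<in>{1..N}. t' \<nu> \<tau> * (dir.tilt.drift \<tau> \<nu> - mix.tilt.drift \<tau> \<nu>))"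
      using sub t'_0[OF _ \<tau>] by (intro sum.mono_neutral_left) auto
    finally show ?thesis by (simp only: right_diff_distrib sum_subtractf)
  qed
  have GD: "set_integrable lborel {0..1} ?GD" and GM: "set_integrable lborel {0..1} ?GM"
    by (rule dir.tilt.expectation_log_J_FTC(1), rule mix.tilt.expectation_log_J_FTC(1))
  have G_int: "set_integrable lborel {0..1} ?G"
  proof -
    have "set_integrable lborel {0..1} (\<lambda>\<tau>. ?GD \<tau> - ?GM \<tau>)" by (rule set_integral_diff(1)[OF GD GM])
    also have "?this \<longleftrightarrow> set_integrable lborel {0..1} ?G" by (intro set_integrable_cong refl) (simp only: G_eq)
    finally show ?thesis .
  qed
  have "(LINT \<tau>:{0..1}|lborel. ?G \<tau>) = (LINT \<tau>:{0..1}|lborel. ?GD \<tau> - ?GM \<tau>)"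
    by (rule set_lebesgue_integral_cong) (auto simp only: G_eq sets_lborel intro!: closed_atLeastAtMost borel_closed)
  also have "\<dots> = (LINT \<tau>:{0..1}|lborel. ?GD \<tau>) - (LINT \<tau>:{0..1}|lborel. ?GM \<tau>)"
    by (rule set_integral_diff(2)[OF GD GM])
  also have "\<dots> = risk N n m r s p (bayes_predictive N n m r s \<pi>\<^sub>M) - risk N n m r s p (bayes_predictive N n m r s \<pi>\<^sub>0)"
    unfolding prior_eqs mix.risk_decomposition dir.risk_decomposition
      dir.tilt.expectation_log_J_FTC(2) mix.tilt.expectation_log_J_FTC(2) by simp
  finally have risk: "risk N n m r s p (bayes_predictive N n m r s \<pi>\<^sub>M) - risk N n m r s p (bayes_predictive N n m r s \<pi>\<^sub>0)
      = (LINT \<tau>:{0..1}|lborel. ?G \<tau>)" by simp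
  have logs: "integrable (obs_pmf N n m r s p) (log_ratio n m s p (bayes_predictive N n m r s \<pi>\<^sub>M))"
      "integrable (obs_pmf N n m r s p) (log_ratio n m s p (bayes_predictive N n m r s \<pi>\<^sub>0))"
    unfolding prior_eqs by (rule mix.log_ratio_integrable, rule dir.log_ratio_integrable)
  have D_int': "integrable (?NM \<tau>) (?D \<tau> \<nu> k)" if "\<tau> \<in> {0..1}" "\<nu> \<in> {1..n}" for \<tau> \<nu> k
    using D_int[OF that(1)] sub that(2) by blast
  have D_summable: "summable (\<lambda>k. 1 / real (Suc k) * measure_pmf.expectation (?NM \<tau>) (?D \<tau> \<nu> (Suc k)))"
    if "\<tau> \<in> {0..1}" "\<nu> \<in> {1..n}" for \<tau> \<nu>
    using sums_summable[OF D_sums[OF that(1)]] sub that(2) by blast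
  show ?thesis
    by (intro conjI ballI allI impI logs D_int' D_summable G_int risk)
qed

end
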